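(* Let $V$ be an $n$-dimensional complex Hilbert space, let $m$ and $k$ be positive integers with $1\le k\le m\le n$, and let $\chi$ be a partition of $m$ (identified with the corresponding irreducible character of $S_m$). Let $T\mapsto K_\chi(T)$ be the map that associates to each $T\in\mathcal{L}(V)$ the induced operator $K_\chi(T)$ on the symmetry class $V_\chi$. Then, for every $T\in\mathcal{L}(V)$ with singular values $\nu_1\ge\nu_2\ge\cdots\ge\nu_n$, the norm of the derivative of order $k$ of this map at $T$ is $$\Vert D^kK_\chi(T)\Vert = k!\,p_{m-k}(\nu_{\omega(\chi)}),$$ where $p_{m-k}$ is the elementary symmetric polynomial of degree $m-k$ in $m$ variables.
   Context: $\mathcal{L}(V)$ is the space of linear operators on $V$, with the operator norm. $\otimes^mV$ carries the inner product induced from $V$, determined by $\langle v_1\otimes\cdots\otimes v_m,w_1\otimes\cdots\otimes w_m\rangle=\prod_i\langle v_i,w_i\rangle$. Irreducible characters of the symmetric group $S_m$ are identified with partitions of $m$ in the usual way, so that $(m)$ corresponds to the principal character and $(1,\ldots,1)$ to the alternating character. For an irreducible character $\chi$ of $S_m$, let $$K_\chi=\frac{\chi(\mathrm{id})}{m!}\sum_{\sigma\in S_m}\chi(\sigma)P(\sigma)\in\mathcal{L}(\otimes^mV),\qquad P(\sigma)(v_1\otimes\cdots\otimes v_m)=v_{\sigma^{-1}(1)}\otimes\cdots\otimes v_{\sigma^{-1}(m)}.$$ The symmetry class of tensors is $V_\chi=K_\chi(\otimes^mV)$ (with the inner product inherited from $\otimes^m V$). For $T\in\mathcal{L}(V)$,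 $V_\chi$ is invariant under $\otimes^mT$, and $K_\chi(T)\in\mathcal{L}(V_\chi)$ denotes the restriction of $\otimes^mT$ to $V_\chi$. The $k$-th derivative of a map $f$ on $\mathcal{L}(V)$ at $T$ is the multilinear map $$D^kf(T)(X^1,\ldots,X^k)=\frac{\partial^k}{\partial t_1\cdots\partial t_k}\Big|_{t_1=\cdots=t_k=0}f(T+t_1X^1+\cdots+t_kX^k),$$ and the norm of a $k$-linear map $\Phi$ on $\mathcal{L}(V)^k$ is $\Vert\Phi\Vert=\sup_{\Vert X^1\Vert=\cdots=\Vert X^k\Vert=1}\Vert\Phi(X^1,\ldots,X^k)\Vert$, with operator norms throughout. For a partition $\pi=(\pi_1,\ldots,\pi_{l(\pi)})$ of $m$ with $l(\pi)$ nonzero parts $\pi_1\ge\cdots\ge\pi_{l(\pi)}$, $\omega(\pi)$ is the $m$-tuple consisting of $\pi_1$ copies of $1$, followed by $\pi_2$ copies of $2$, ..., followed by $\pi_{l(\pi)}$ copies of $l(\pi)$. For $\nu=(\nu_1,\ldots,\nu_n)$ and a map $\alpha:\{1,\ldots,m\}\to\{1,\ldots,n\}$ (identified with the $m$-tuple of its values), $\nu_\alpha=(\nu_{\alpha(1)},\ldots,\nu_{\alpha(m)})$. By convention $p_0=1$. *)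

theory Defs
  imports
    "HOL-Analysis.Analysis"
    "HOL-Combinatorics.Permutations"
    "HOL-Library.Function_Algebras"
begin

section \<open>Complex inner product spaces\<close>

text \<open>The inner product is linear in the first and antilinear in the second argument.
  Completeness is not an axiom: all spaces below are finite-dimensional.\<close>

class complex_inner_space = real_normed_vector +
  fixes scaleC :: "complex \<Rightarrow> 'a \<Rightarrow> 'a"  (infixr "*\<^sub>C" 75)
    and cinner :: "'a \<Rightarrow> 'a \<Rightarrow> complex"
  assumes scaleC_add_right: "a *\<^sub>C (x + y) = a *\<^sub>C x + a *\<^sub>C y"
    and scaleC_add_left: "(a + b) *\<^sub>C x = a *\<^sub>C x + b *\<^sub>C x"
    and scaleC_scaleC: "a *\<^sub>C (b *\<^sub>C x) = (a * b) *\<^sub>C x"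
    and scaleC_one: "1 *\<^sub>C x = x"
    and scaleR_scaleC: "scaleR r x = complex_of_real r *\<^sub>C x"
    and cinner_commute: "cinner x y = cnj (cinner y x)"
    and cinner_add_left: "cinner (x + y) z = cinner x z + cinner y z"
    and cinner_scaleC_left: "cinner (a *\<^sub>C x) y = a * cinner x y"
    and cinner_self: "cinner x x = complex_of_real ((norm x)\<^sup>2)"

global_interpretation complex_space: vector_space "scaleC :: complex \<Rightarrow> 'a \<Rightarrow> 'a::complex_inner_space"
  defines cspan = complex_space.span
    and cdim = complex_space.dim
  by unfold_locales (simp_all add: scaleC_add_right scaleC_add_left scaleC_scaleC scaleC_one)

text \<open>The type of bounded operators is only real-linear; \<open>clinear_ops\<close> is \<open>L(V)\<close>.  The norm of
  the type is the operator norm.\<close>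

definition clinear_ops :: "('a::complex_inner_space \<Rightarrow>\<^sub>L 'b::complex_inner_space) set" where
  "clinear_ops = {A. \<forall>c x. blinfun_apply A (c *\<^sub>C x) = c *\<^sub>C blinfun_apply A x}"

definition adjoint_op :: "('a::complex_inner_space \<Rightarrow>\<^sub>L 'a) \<Rightarrow> 'a \<Rightarrow>\<^sub>L 'a" where
  "adjoint_op A = (THE B. \<forall>x y. cinner (blinfun_apply B x) y = cinner x (blinfun_apply A y))"

text \<open>\<open>\<nu> 1 \<ge> \<dots> \<ge> \<nu> n\<close> are the nonnegative square roots of the eigenvalues of \<open>T\<^sup>*T\<close>, each
  repeated according to its multiplicity.\<close>

definition singular_values :: "nat \<Rightarrow> ('a::complex_inner_space \<Rightarrow>\<^sub>L 'a) \<Rightarrow> (nat \<Rightarrow> real) \<Rightarrow> bool" where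
  "singular_values n T \<nu> \<longleftrightarrow>
     (\<forall>i\<in>{1..n}. 0 \<le> \<nu> i) \<and>
     (\<forall>i\<in>{1..n}. \<forall>j\<in>{1..n}. i \<le> j \<longrightarrow> \<nu> j \<le> \<nu> i) \<and>
     (\<forall>s\<ge>0. card {i\<in>{1..n}. \<nu> i = s} =
        cdim {x. blinfun_apply (adjoint_op T o\<^sub>L T) x = complex_of_real (s\<^sup>2) *\<^sub>C x})"

section \<open>Partitions and irreducible characters of the symmetric group\<close>

text \<open>\<open>S\<^sub>m\<close> is the group of permutations of \<open>{1..m}\<close>; a partition is the list of its nonzero
  parts.\<close>

definition is_partition :: "nat \<Rightarrow> nat list \<Rightarrow> bool" where
  "is_partition m \<pi> \<longleftrightarrow> sorted_wrt (\<ge>) \<pi> \<and> 0 \<notin> set \<pi> \<and> sum_list \<pi> = m"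

definition omega :: "nat list \<Rightarrow> nat list" where
  "omega \<pi> = concat (map (\<lambda>i. replicate (\<pi> ! i) (Suc i)) [0..<length \<pi>])"

text \<open>Row and column of the entry \<open>i\<close> in the tableau of shape \<open>\<pi>\<close> filled with \<open>1, \<dots>, m\<close> row
  by row.\<close>

definition tableau_row :: "nat list \<Rightarrow> nat \<Rightarrow> nat" where
  "tableau_row \<pi> i = omega \<pi> ! (i - 1)"

definition tableau_col :: "nat list \<Rightarrow> nat \<Rightarrow> nat" where
  "tableau_col \<pi> i = card {j\<in>{1..i}. tableau_row \<pi> j = tableau_row \<pi> i}"

definition row_group :: "nat \<Rightarrow> nat list \<Rightarrow> (nat \<Rightarrow> nat) set" where
  "row_group m \<pi> = {p. p permutes {1..m} \<and> (\<forall>i\<in>{1..m}. tableau_row \<pi> (p i) = tableau_row \<pi> i)}"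

definition col_group :: "nat \<Rightarrow> nat list \<Rightarrow> (nat \<Rightarrow> nat) set" where
  "col_group m \<pi> = {p. p permutes {1..m} \<and> (\<forall>i\<in>{1..m}. tableau_col \<pi> (p i) = tableau_col \<pi> i)}"

text \<open>The group algebra of \<open>S\<^sub>m\<close> consists of the complex functions supported on \<open>S\<^sub>m\<close>, with
  convolution as product.\<close>

type_synonym galg = "(nat \<Rightarrow> nat) \<Rightarrow> complex"

definition galg_scale :: "complex \<Rightarrow> galg \<Rightarrow> galg" where
  "galg_scale c f = (\<lambda>p. c * f p)"

global_interpretation galg: vector_space galg_scale
  by unfold_locales (simp_all add: galg_scale_def fun_eq_iff algebra_simps)

definition galg_carrier :: "nat \<Rightarrow> galg set" where
  "galg_carrier m = {f. \<forall>p. f p \<noteq> 0 \<longrightarrow> p permutes {1..m}}"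

definition galg_mult :: "nat \<Rightarrow> galg \<Rightarrow> galg \<Rightarrow> galg" where
  "galg_mult m f g = (\<lambda>p. \<Sum>q | q permutes {1..m}. f q * g (inv q \<circ> p))"

definition galg_of :: "(nat \<Rightarrow> nat) \<Rightarrow> galg" where
  "galg_of \<sigma> = (\<lambda>p. if p = \<sigma> then 1 else 0)"

definition young_symmetrizer :: "nat \<Rightarrow> nat list \<Rightarrow> galg" where
  "young_symmetrizer m \<pi> =
     galg_mult m (\<lambda>p. if p \<in> row_group m \<pi> then 1 else 0)
                 (\<lambda>p. if p \<in> col_group m \<pi> then of_int (sign p) else 0)"

definition specht_module :: "nat \<Rightarrow> nat list \<Rightarrow> galg set" where
  "specht_module m \<pi> = (\<lambda>f. galg_mult m f (young_symmetrizer m \<pi>)) ` galg_carrier m"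

text \<open>Trace of an endomorphism of a finite-dimensional subspace, computed in a basis.\<close>

definition (in vector_space) trace_on :: "'b set \<Rightarrow> ('b \<Rightarrow> 'b) \<Rightarrow> 'a" where
  "trace_on S f = (let B = (SOME B. independent B \<and> span B = S)
                   in \<Sum>b\<in>B. representation B (f b) b)"

text \<open>The irreducible character of \<open>S\<^sub>m\<close> belonging to \<open>\<pi>\<close>: the character of the left ideal
  generated by the Young symmetrizer.  The partition \<open>(m)\<close> gives the principal and
  \<open>(1, \<dots>, 1)\<close> the alternating character.\<close>

definition sym_char :: "nat \<Rightarrow> nat list \<Rightarrow> (nat \<Rightarrow> nat) \<Rightarrow> complex" where
  "sym_char m \<pi> \<sigma> =
     vector_space.trace_on galg_scale (specht_module m \<pi>) (galg_mult m (galg_of \<sigma>))"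

section \<open>Tensor powers and symmetry classes of tensors\<close>

text \<open>\<open>is_tensor_power m \<tau>\<close>: the whole space \<open>'w\<close> is the \<open>m\<close>-th tensor power of \<open>'v\<close>, with the
  decomposable tensor of \<open>v 1, \<dots>, v m\<close> given by \<open>\<tau> v\<close> (by the inner product formula, values of
  \<open>v\<close> outside \<open>{1..m}\<close> do not matter).  These conditions determine the pair of \<open>'w\<close> and \<open>\<tau>\<close> up to
  a unique isometric isomorphism.\<close>

definition is_tensor_power ::
    "nat \<Rightarrow> ((nat \<Rightarrow> 'v::complex_inner_space) \<Rightarrow> 'w::complex_inner_space) \<Rightarrow> bool" where
  "is_tensor_power m \<tau> \<longleftrightarrow>
     (\<forall>v. \<forall>i\<in>{1..m}. \<forall>x y. \<tau> (v(i := x + y)) = \<tau> (v(i := x)) + \<tau> (v(i := y))) \<and>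
     (\<forall>v. \<forall>i\<in>{1..m}. \<forall>c x. \<tau> (v(i := c *\<^sub>C x)) = c *\<^sub>C \<tau> (v(i := x))) \<and>
     (\<forall>v w. cinner (\<tau> v) (\<tau> w) = (\<Prod>i\<in>{1..m}. cinner (v i) (w i))) \<and>
     cspan (range \<tau>) = UNIV"

definition perm_op ::
    "((nat \<Rightarrow> 'v::complex_inner_space) \<Rightarrow> 'w::complex_inner_space) \<Rightarrow> (nat \<Rightarrow> nat) \<Rightarrow> 'w \<Rightarrow>\<^sub>L 'w" where
  "perm_op \<tau> \<sigma> = (THE A. A \<in> clinear_ops \<and> (\<forall>v. blinfun_apply A (\<tau> v) = \<tau> (\<lambda>i. v (inv \<sigma> i))))"

definition tensor_op ::
    "((nat \<Rightarrow> 'v::complex_inner_space) \<Rightarrow> 'w::complex_inner_space) \<Rightarrow> ('v \<Rightarrow>\<^sub>L 'v) \<Rightarrow> 'w \<Rightarrow>\<^sub>L 'w" where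
  "tensor_op \<tau> T = (THE A. A \<in> clinear_ops \<and>
     (\<forall>v. blinfun_apply A (\<tau> v) = \<tau> (\<lambda>i. blinfun_apply T (v i))))"

definition symmetrizer ::
    "nat \<Rightarrow> ((nat \<Rightarrow> 'v::complex_inner_space) \<Rightarrow> 'w::complex_inner_space) \<Rightarrow> nat list \<Rightarrow> 'w \<Rightarrow> 'w" where
  "symmetrizer m \<tau> \<pi> x =
     (sym_char m \<pi> id / fact m) *\<^sub>C
       (\<Sum>\<sigma> | \<sigma> permutes {1..m}. sym_char m \<pi> \<sigma> *\<^sub>C blinfun_apply (perm_op \<tau> \<sigma>) x)"

definition symmetry_class ::
    "nat \<Rightarrow> ((nat \<Rightarrow> 'v::complex_inner_space) \<Rightarrow> 'w::complex_inner_space) \<Rightarrow> nat list \<Rightarrow> 'w set" where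
  "symmetry_class m \<tau> \<pi> = range (symmetrizer m \<tau> \<pi>)"

text \<open>Operators on a subspace \<open>S\<close> are represented by their extension by zero on the orthogonal
  complement of \<open>S\<close>.  On operators mapping \<open>S\<close> into \<open>S\<close> this identifies \<open>L(S)\<close>, linearly and with
  its operator norm, with a subspace of the operators on the whole space.\<close>

definition restriction_op :: "'w::complex_inner_space set \<Rightarrow> ('w \<Rightarrow>\<^sub>L 'w) \<Rightarrow> 'w \<Rightarrow>\<^sub>L 'w" where
  "restriction_op S A = (THE B. (\<forall>x\<in>S. blinfun_apply B x = blinfun_apply A x) \<and>
     (\<forall>x. (\<forall>y\<in>S. cinner x y = 0) \<longrightarrow> blinfun_apply B x = 0))"

definition induced_op ::
    "nat \<Rightarrow> ((nat \<Rightarrow> 'v::complex_inner_space) \<Rightarrow> 'w::complex_inner_space) \<Rightarrow> nat list \<Rightarrow>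
     ('v \<Rightarrow>\<^sub>L 'v) \<Rightarrow> 'w \<Rightarrow>\<^sub>L 'w" where
  "induced_op m \<tau> \<pi> T = restriction_op (symmetry_class m \<tau> \<pi>) (tensor_op \<tau> T)"

section \<open>Higher derivatives, multilinear norms, elementary symmetric polynomials\<close>

definition partial_deriv ::
    "nat \<Rightarrow> ((nat \<Rightarrow> real) \<Rightarrow> 'b::real_normed_vector) \<Rightarrow> (nat \<Rightarrow> real) \<Rightarrow> 'b" where
  "partial_deriv j g t = vector_derivative (\<lambda>s. g (t(j := s))) (at (t j))"

primrec mixed_partial ::
    "nat \<Rightarrow> ((nat \<Rightarrow> real) \<Rightarrow> 'b::real_normed_vector) \<Rightarrow> (nat \<Rightarrow> real) \<Rightarrow> 'b" where
  "mixed_partial 0 g = g"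
| "mixed_partial (Suc k) g = mixed_partial k (partial_deriv (Suc k) g)"

text \<open>The directions are \<open>X 1, \<dots>, X k\<close>.\<close>

definition higher_deriv ::
    "nat \<Rightarrow> ('a::real_normed_vector \<Rightarrow> 'b::real_normed_vector) \<Rightarrow> 'a \<Rightarrow> (nat \<Rightarrow> 'a) \<Rightarrow> 'b" where
  "higher_deriv k f T X = mixed_partial k (\<lambda>t. f (T + (\<Sum>j\<in>{1..k}. t j *\<^sub>R X j))) (\<lambda>_. 0)"

definition multilinear_norm ::
    "nat \<Rightarrow> ((nat \<Rightarrow> ('v::complex_inner_space \<Rightarrow>\<^sub>L 'v)) \<Rightarrow> 'b::real_normed_vector) \<Rightarrow> real" where
  "multilinear_norm k \<Phi> =
     Sup {norm (\<Phi> X) | X. \<forall>j\<in>{1..k}. X j \<in> clinear_ops \<and> norm (X j) = 1}"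

definition elem_sym :: "nat \<Rightarrow> real list \<Rightarrow> real" where
  "elem_sym r xs = (\<Sum>S | S \<subseteq> {..<length xs} \<and> card S = r. \<Prod>i\<in>S. xs ! i)"

end

theory Submission
  imports Defs
begin

text \<open>
  By multilinear expansion the \<open>k\<close>-th derivative of \<open>\<otimes>\<^sup>m\<close> at \<open>T\<close> in the directions
  \<open>X 1, \<dots>, X k\<close> is the sum, over all ways to place the \<open>k\<close> directions at different tensor sites,
  of the tensor products with \<open>T\<close> at the \<open>m - k\<close> free sites (\<open>higher_deriv_tensor_op\<close>).  It commutes
  with the permutations of the sites, so it maps the symmetry class \<open>S\<close> into itself, and the
  derivative of the induced operator is this sum composed with the projection onto \<open>S\<close>.

  Let \<open>T e\<^sub>i = \<nu>\<^sub>i f\<^sub>i\<close> be a singular value decomposition.  If all directions are the isometry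
  \<open>U\<close> with \<open>U e\<^sub>i = f\<^sub>i\<close>, the derivative maps the basis tensor \<open>e\<^sub>\<alpha>\<close> to \<open>k! p(\<nu>\<^sub>\<alpha>) f\<^sub>\<alpha>\<close>, where
  \<open>p\<close> is the elementary symmetric polynomial of degree \<open>m - k\<close>: each set of free sites
  occurs for \<open>k!\<close> placements (\<open>sum_placements\<close>).  So on \<open>S\<close> it acts, up to an isometry, with the
  singular values \<open>k! p(\<nu>\<^sub>\<alpha>)\<close> of those \<open>\<alpha>\<close> that occur in \<open>S\<close>.

  No other contractions do better (\<open>norm_deriv_op_le\<close>).  After an isometry \<open>T\<close> is a
  nonnegative diagonal operator \<open>Q\<^sup>2\<close>, every summand of the derivative is \<open>Q\<^sub>\<phi> X\<^sub>\<phi> Q\<^sub>\<phi>\<close> with a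
  contraction \<open>X\<^sub>\<phi>\<close> and with \<open>Q\<^sub>\<phi>\<close> carrying \<open>Q\<close> at the free sites, and the Cauchy--Schwarz inequality
  bounds the sum on \<open>S\<close> by \<open>\<Sum>\<phi>. Q\<^sub>\<phi>\<^sup>2\<close>, the case just computed.

  It remains to find the largest \<open>p(\<nu>\<^sub>\<alpha>)\<close> among the \<open>\<alpha>\<close> that occur in \<open>S\<close>.  The character is
  the trace of the left action on the ideal generated by the Young symmetrizer.  If every
  arrangement of the labels \<open>\<alpha>\<close> in the tableau repeats a label within a column, the symmetrizer
  over the stabilizer of \<open>\<alpha>\<close> kills this ideal and the symmetrization of \<open>e\<^sub>\<alpha>\<close> is zero
  (\<open>symmetrizer_basis_tensor_eq_zero\<close>).  If some arrangement has no repetition, sorting the columns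
  puts a label at least \<open>r\<close> into each cell of row \<open>r\<close>, whence \<open>p(\<nu>\<^sub>\<alpha>) \<le> p(\<nu>\<^sub>\<omega>)\<close> because \<open>\<nu>\<close>
  decreases (\<open>elem_sym_fun_le_rows\<close>).  The tuple \<open>\<omega>\<close> of row numbers itself does occur
  (\<open>symmetrizer_row_index_nonzero\<close>): the coefficient of \<open>e\<^sub>\<omega>\<close> in its own symmetrization is, up to a
  nonzero factor, the trace of the symmetrizer over the row group, a multiple of an idempotent
  that does not kill the ideal.
\<close>


section \<open>Finite-dimensional complex inner product spaces\<close>

lemma cinner_add_right:
  fixes x y z :: "'a::complex_inner_space"
  shows "cinner x (y + z) = cinner x y + cinner x z"
  by (metis cinner_add_left cinner_commute complex_cnj_add)

lemma cinner_scaleC_right: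
  fixes x y :: "'a::complex_inner_space"
  shows "cinner x (a *\<^sub>C y) = cnj a * cinner x y"
  by (metis cinner_scaleC_left cinner_commute complex_cnj_mult)

lemma cinner_zero_left [simp]: "cinner (0::'a::complex_inner_space) x = 0"
  using cinner_add_left[of 0 0 x] by simp

lemma cinner_zero_right [simp]: "cinner x (0::'a::complex_inner_space) = 0"
  using cinner_add_right[of x 0 0] by simp

lemma cinner_diff_left:
  fixes x y z :: "'a::complex_inner_space"
  shows "cinner (x - y) z = cinner x z - cinner y z"
  using cinner_add_left[of "x - y" y z] by simp

lemma cinner_diff_right:
  fixes x y z :: "'a::complex_inner_space"
  shows "cinner x (y - z) = cinner x y - cinner x z"
  using cinner_add_right[of x "y - z" z] by simp

lemma cinner_sum_left:
  fixes f :: "'i \<Rightarrow> 'a::complex_inner_space"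
  shows "cinner (\<Sum>i\<in>I. f i) z = (\<Sum>i\<in>I. cinner (f i) z)"
  by (induction I rule: infinite_finite_induct) (auto simp: cinner_add_left)

lemma cinner_sum_right:
  fixes f :: "'i \<Rightarrow> 'a::complex_inner_space"
  shows "cinner z (\<Sum>i\<in>I. f i) = (\<Sum>i\<in>I. cinner z (f i))"
  by (induction I rule: infinite_finite_induct) (auto simp: cinner_add_right)

lemma cinner_self_eq_zero_iff:
  fixes x :: "'a::complex_inner_space"
  shows "cinner x x = 0 \<longleftrightarrow> x = 0"
  by (simp add: cinner_self)

lemma norm_sqr_eq_cinner:
  fixes x :: "'a::complex_inner_space"
  shows "(norm x)\<^sup>2 = Re (cinner x x)"
  by (simp add: cinner_self)

lemma norm_scaleC:
  fixes x :: "'a::complex_inner_space"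
  shows "norm (a *\<^sub>C x) = cmod a * norm x"
proof -
  have "complex_of_real ((norm (a *\<^sub>C x))\<^sup>2) = a * cnj a * cinner x x"
    by (simp only: cinner_self[symmetric] cinner_scaleC_left cinner_scaleC_right mult.assoc
      mult.left_commute)
  also have "\<dots> = complex_of_real ((cmod a * norm x)\<^sup>2)"
    by (simp only: complex_norm_square[symmetric] cinner_self of_real_mult[symmetric] power_mult_distrib)
  finally have "(norm (a *\<^sub>C x))\<^sup>2 = (cmod a * norm x)\<^sup>2"
    by (simp only: of_real_eq_iff)
  thus ?thesis by simp
qed

lemma cinner_left_eqI:
  fixes x y :: "'a::complex_inner_space"
  assumes "\<And>z. cinner x z = cinner y z"
  shows "x = y"
proof -
  have "cinner (x - y) (x - y) = 0" using assms by (simp add: cinner_diff_left)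
  thus ?thesis by (simp add: cinner_self_eq_zero_iff)
qed

lemma cinner_Cauchy_Schwarz:
  fixes x y :: "'a::complex_inner_space"
  shows "cmod (cinner x y) \<le> norm x * norm y"
proof (cases "y = 0")
  case False
  define c where "c = cinner x y / cinner y y"
  have yy: "cinner y y \<noteq> 0" using False by (simp add: cinner_self_eq_zero_iff)
  have "cinner (x - c *\<^sub>C y) y = 0"
    using yy by (simp add: cinner_diff_left cinner_scaleC_left c_def)
  hence "cinner (x - c *\<^sub>C y) (x - c *\<^sub>C y) = cinner (x - c *\<^sub>C y) x"
    by (simp add: cinner_diff_right cinner_scaleC_right)
  also have "\<dots> = cinner x x - c * cinner y x"
    by (simp add: cinner_diff_left cinner_scaleC_left)
  also have "c * cinner y x = cinner x y * cnj (cinner x y) / cinner y y"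
    by (simp add: c_def cinner_commute[of y x])
  also have "\<dots> = of_real ((cmod (cinner x y))\<^sup>2 / (norm y)\<^sup>2)"
    by (simp add: complex_norm_square[symmetric] cinner_self)
  finally have "Re (cinner (x - c *\<^sub>C y) (x - c *\<^sub>C y)) =
      (norm x)\<^sup>2 - (cmod (cinner x y))\<^sup>2 / (norm y)\<^sup>2"
    by (simp only: cinner_self minus_complex.simps Re_complex_of_real)
  hence "0 \<le> (norm x)\<^sup>2 - (cmod (cinner x y))\<^sup>2 / (norm y)\<^sup>2"
    by (metis norm_sqr_eq_cinner zero_le_power2)
  hence "(cmod (cinner x y))\<^sup>2 \<le> (norm x * norm y)\<^sup>2"
    using False by (simp add: field_simps power_mult_distrib)
  thus ?thesis by (rule power2_le_imp_le) simp
qed simp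

subsection \<open>Orthonormal families\<close>

definition orthonormal :: "'i set \<Rightarrow> ('i \<Rightarrow> 'a::complex_inner_space) \<Rightarrow> bool" where
  "orthonormal I e \<longleftrightarrow> (\<forall>i\<in>I. \<forall>j\<in>I. cinner (e i) (e j) = (if i = j then 1 else 0))"

definition onb :: "'i set \<Rightarrow> ('i \<Rightarrow> 'a::complex_inner_space) \<Rightarrow> bool" where
  "onb I e \<longleftrightarrow> finite I \<and> orthonormal I e \<and> cspan (e ` I) = UNIV"

lemma orthonormalD:
  "orthonormal I e \<Longrightarrow> i \<in> I \<Longrightarrow> j \<in> I \<Longrightarrow> cinner (e i) (e j) = (if i = j then 1 else 0)"
  by (auto simp: orthonormal_def)

lemma orthonormal_inj_on:
  assumes "orthonormal I e" shows "inj_on e I"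
  using assms by (auto simp: orthonormal_def inj_on_def split: if_splits) (metis zero_neq_one)

lemma cinner_orthonormal_sum:
  assumes "orthonormal I e" "finite I" "j \<in> I"
  shows "cinner (\<Sum>i\<in>I. c i *\<^sub>C e i) (e j) = c j"
proof -
  have "cinner (\<Sum>i\<in>I. c i *\<^sub>C e i) (e j) = (\<Sum>i\<in>I. if i = j then c i else 0)"
    using assms unfolding cinner_sum_left
    by (intro sum.cong) (auto simp: cinner_scaleC_left orthonormalD)
  thus ?thesis using assms by simp
qed

lemma orthonormal_independent:
  assumes "orthonormal I e" "finite I"
  shows "complex_space.independent (e ` I)"
proof (rule complex_space.independent_if_scalars_zero)
  show "finite (e ` I)" using assms by simp
next
  fix f x assume s: "(\<Sum>x\<in>e ` I. f x *\<^sub>C x) = 0" and "x \<in> e ` I"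
  then obtain j where j: "j \<in> I" "x = e j" by auto
  have "(\<Sum>i\<in>I. f (e i) *\<^sub>C e i) = 0"
    using s by (simp add: sum.reindex[OF orthonormal_inj_on[OF assms(1)]])
  with cinner_orthonormal_sum[OF assms j(1), of "\<lambda>i. f (e i)"] show "f x = 0"
    by (simp add: j)
qed

lemma orthonormal_norm_sqr_sum:
  assumes "orthonormal I e" "finite I"
  shows "(norm (\<Sum>i\<in>I. c i *\<^sub>C e i))\<^sup>2 = (\<Sum>i\<in>I. (cmod (c i))\<^sup>2)"
proof -
  have "cinner (\<Sum>i\<in>I. c i *\<^sub>C e i) (\<Sum>j\<in>I. c j *\<^sub>C e j) = (\<Sum>j\<in>I. cnj (c j) * c j)"
    using assms by (auto simp: cinner_sum_right cinner_scaleC_right cinner_orthonormal_sum)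
  also have "\<dots> = of_real (\<Sum>i\<in>I. (cmod (c i))\<^sup>2)"
    by (simp only: of_real_sum complex_norm_square mult.commute)
  finally show ?thesis by (simp only: cinner_self of_real_eq_iff)
qed

lemma onb_expansion:
  assumes "onb I e"
  shows "x = (\<Sum>i\<in>I. cinner x (e i) *\<^sub>C e i)"
proof -
  have I: "finite I" "orthonormal I e" "x \<in> cspan (e ` I)" using assms by (auto simp: onb_def)
  obtain u where "x = (\<Sum>v\<in>e ` I. u v *\<^sub>C v)"
    using I by (auto simp: complex_space.span_finite)
  hence x: "x = (\<Sum>i\<in>I. u (e i) *\<^sub>C e i)"
    by (simp add: sum.reindex[OF orthonormal_inj_on[OF I(2)]])
  have "cinner x (e j) = u (e j)" if "j \<in> I" for j
    using cinner_orthonormal_sum[OF I(2,1) that, of "\<lambda>i. u (e i)"] x by simp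
  thus ?thesis using x by (simp cong: sum.cong)
qed

lemma onb_norm_sqr:
  assumes "onb I e"
  shows "(norm x)\<^sup>2 = (\<Sum>i\<in>I. (cmod (cinner x (e i)))\<^sup>2)"
proof -
  have "(norm x)\<^sup>2 = (norm (\<Sum>i\<in>I. cinner x (e i) *\<^sub>C e i))\<^sup>2"
    using onb_expansion[OF assms, of x] by simp
  also have "\<dots> = (\<Sum>i\<in>I. (cmod (cinner x (e i)))\<^sup>2)"
    using assms by (intro orthonormal_norm_sqr_sum) (auto simp: onb_def)
  finally show ?thesis .
qed

text \<open>Gram--Schmidt, one step at a time: as long as an orthonormal family has fewer members than
  the dimension of the subspace, some vector of the subspace sticks out of its span, and subtracting
  its components along the family leaves a direction for a new member.\<close>

lemma orthonormal_extend:
  fixes E :: "'a::complex_inner_space set"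
  assumes E: "complex_space.subspace E" and G: "finite G" "card G = cdim E"
    and F: "F \<subseteq> G" "orthonormal F e" "e ` F \<subseteq> E"
  shows "\<exists>e'. orthonormal G e' \<and> e' ` G \<subseteq> E \<and> (\<forall>i\<in>F. e' i = e i)"
  using F
proof (induction "card (G - F)" arbitrary: F e)
  case 0
  hence "F = G" using G(1) by auto
  thus ?case using 0 by auto
next
  case (Suc d)
  have finF: "finite F" using Suc.prems(1) G(1) finite_subset by blast
  obtain a where a: "a \<in> G" "a \<notin> F"
    using Suc.hyps(2) by (metis Diff_eq_empty_iff card.empty nat.distinct(1) subsetI)
  have "card F < card G" using a Suc.prems(1) G(1) by (intro psubset_card_mono) auto
  moreover have "card (e ` F) = card F" using orthonormal_inj_on[OF Suc.prems(2)] by (rule card_image)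
  ultimately have "\<not> E \<subseteq> cspan (e ` F)"
    using complex_space.dim_le_card[of E "e ` F"] finF G(2) by fastforce
  then obtain x where x: "x \<in> E" "x \<notin> cspan (e ` F)" by auto
  define y where "y = x - (\<Sum>i\<in>F. cinner x (e i) *\<^sub>C e i)"
  have S: "(\<Sum>i\<in>F. cinner x (e i) *\<^sub>C e i) \<in> cspan (e ` F)"
    by (intro complex_space.span_sum complex_space.span_scale complex_space.span_base) auto
  have y0: "y \<noteq> 0" using x(2) S by (auto simp: y_def)
  have yE: "y \<in> E" unfolding y_def using Suc.prems(3) x(1) E
    by (intro complex_space.subspace_diff complex_space.subspace_sum complex_space.subspace_scale) auto
  have yo: "cinner y (e j) = 0" if "j \<in> F" for j
    using cinner_orthonormal_sum[OF Suc.prems(2) finF that, of "\<lambda>i. cinner x (e i)"]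
    by (simp add: y_def cinner_diff_left)
  define z where "z = complex_of_real (1 / norm y) *\<^sub>C y"
  have zE: "z \<in> E" unfolding z_def using yE E by (intro complex_space.subspace_scale)
  have "norm z = 1" using y0 by (simp add: z_def norm_scaleC norm_divide)
  hence zz: "cinner z z = 1" by (simp add: cinner_self)
  have zo: "cinner z (e j) = 0" "cinner (e j) z = 0" if "j \<in> F" for j
    using yo[OF that] cinner_commute[of "e j" z] by (simp_all add: z_def cinner_scaleC_left)
  have "orthonormal (insert a F) (e(a := z))"
    using Suc.prems(2) a zz zo by (auto simp: orthonormal_def)
  moreover have "(e(a := z)) ` insert a F \<subseteq> E" using Suc.prems(3) zE a by auto
  moreover have "d = card (G - insert a F)"
    using Suc.hyps(2) a G(1) by (metis Diff_insert card_Diff_singleton diff_Suc_1 DiffI)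
  moreover have "insert a F \<subseteq> G" using a Suc.prems(1) by auto
  ultimately obtain e' where "orthonormal G e'" "e' ` G \<subseteq> E"
      "\<forall>i\<in>insert a F. e' i = (e(a := z)) i"
    using Suc.hyps(1) by blast
  thus ?case using a by (intro exI[of _ e']) auto
qed

lemma orthonormal_spans_subspace:
  fixes E :: "'a::complex_inner_space set"
  assumes E: "complex_space.subspace E" and G: "finite G" "card G = cdim E"
    and e: "orthonormal G e" "e ` G \<subseteq> E"
    and fin: "finite B" "cspan B = (UNIV :: 'a set)"
  shows "cspan (e ` G) = E"
proof -
  obtain B' where B': "B' \<subseteq> B" "complex_space.independent B'" "cspan B' = UNIV"
    using complex_space.maximal_independent_subset[of B] fin(2)
    by (metis complex_space.span_span complex_space.span_mono top.extremum_uniqueI)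
  interpret fd: finite_dimensional_vector_space "scaleC :: complex \<Rightarrow> 'a \<Rightarrow> 'a" B'
    using B'(1,2) B'(3)[unfolded cspan_def] fin(1) finite_subset by unfold_locales auto
  have "E \<subseteq> cspan (e ` G)"
    using fd.card_ge_dim_independent[of "e ` G" E] e orthonormal_independent[OF e(1) G(1)] G
      card_image[OF orthonormal_inj_on[OF e(1)]] by (simp add: cspan_def cdim_def)
  thus ?thesis using complex_space.span_minimal[OF e(2) E] by auto
qed

lemma cdim_pos_finite_basis:
  assumes "cdim (UNIV :: 'a::complex_inner_space set) > 0"
  shows "\<exists>B :: 'a set. finite B \<and> cspan B = UNIV"
proof -
  obtain B :: "'a set" where "complex_space.independent B" "UNIV \<subseteq> cspan B" "card B = cdim (UNIV :: 'a set)"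
    using complex_space.basis_exists[of UNIV] by metis
  thus ?thesis using assms by (intro exI[of _ B]) (auto intro: card_ge_0_finite)
qed

subsection \<open>Complex-linear operators\<close>

lemma clinear_opsD:
  "A \<in> clinear_ops \<Longrightarrow> A (c *\<^sub>C x) = c *\<^sub>C A x"
  by (simp add: clinear_ops_def)

lemma clinear_ops_compose:
  "A \<in> clinear_ops \<Longrightarrow> B \<in> clinear_ops \<Longrightarrow> A o\<^sub>L B \<in> clinear_ops"
  by (simp add: clinear_ops_def)

lemma clinear_ops_id: "id_blinfun \<in> clinear_ops"
  by (simp add: clinear_ops_def)

lemma clinear_ops_add:
  fixes A B :: "'a::complex_inner_space \<Rightarrow>\<^sub>L 'b::complex_inner_space"
  shows "A \<in> clinear_ops \<Longrightarrow> B \<in> clinear_ops \<Longrightarrow> A + B \<in> clinear_ops"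
  by (simp add: clinear_ops_def blinfun.add_left scaleC_add_right)

lemma clinear_ops_scaleR:
  fixes A :: "'a::complex_inner_space \<Rightarrow>\<^sub>L 'b::complex_inner_space"
  shows "A \<in> clinear_ops \<Longrightarrow> r *\<^sub>R A \<in> clinear_ops"
  by (simp add: clinear_ops_def blinfun.scaleR_left scaleR_scaleC mult.commute scaleC_scaleC)

lemma clinear_ops_sum:
  fixes A :: "'i \<Rightarrow> 'a::complex_inner_space \<Rightarrow>\<^sub>L 'b::complex_inner_space"
  shows "(\<And>i. i \<in> I \<Longrightarrow> A i \<in> clinear_ops) \<Longrightarrow> (\<Sum>i\<in>I. A i) \<in> clinear_ops"
  by (induction I rule: infinite_finite_induct)
    (simp_all add: clinear_ops_add, simp_all add: clinear_ops_def)

lemma clinear_ops_eq_on_span: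
  fixes A B :: "'a::complex_inner_space \<Rightarrow>\<^sub>L 'b::complex_inner_space"
  assumes "A \<in> clinear_ops" "B \<in> clinear_ops" "x \<in> cspan X"
    "\<And>x. x \<in> X \<Longrightarrow> A x = B x"
  shows "A x = B x"
  using assms(3)
proof (induction rule: complex_space.span_induct_alt)
  case base show ?case by (simp add: blinfun.zero_right)
next
  case (step c x y)
  thus ?case using assms by (simp add: blinfun.add_right clinear_opsD)
qed

definition op_of_basis :: "'i set \<Rightarrow> ('i \<Rightarrow> 'a) \<Rightarrow> ('i \<Rightarrow> 'b) \<Rightarrow>
    'a::complex_inner_space \<Rightarrow>\<^sub>L 'b::complex_inner_space" where
  "op_of_basis I e g = Blinfun (\<lambda>x. \<Sum>i\<in>I. cinner x (e i) *\<^sub>C g i)"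

lemma op_of_basis_apply:
  "blinfun_apply (op_of_basis I e g) x = (\<Sum>i\<in>I. cinner x (e i) *\<^sub>C g i)"
proof -
  have "bounded_linear (\<lambda>x. \<Sum>i\<in>I. cinner x (e i) *\<^sub>C g i)"
  proof (rule bounded_linear_sum)
    fix i
    show "bounded_linear (\<lambda>x. cinner x (e i) *\<^sub>C g i)"
    proof (rule bounded_linear_intro)
      fix x y r
      show "cinner (x + y) (e i) *\<^sub>C g i = cinner x (e i) *\<^sub>C g i + cinner y (e i) *\<^sub>C g i"
        by (simp add: cinner_add_left scaleC_add_left)
      show "cinner (r *\<^sub>R x) (e i) *\<^sub>C g i = r *\<^sub>R (cinner x (e i) *\<^sub>C g i)"
        by (simp add: scaleR_scaleC cinner_scaleC_left scaleC_scaleC)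
      have "cmod (cinner x (e i)) * norm (g i) \<le> (norm x * norm (e i)) * norm (g i)"
        by (intro mult_right_mono cinner_Cauchy_Schwarz) auto
      thus "norm (cinner x (e i) *\<^sub>C g i) \<le> norm x * (norm (e i) * norm (g i))"
        by (simp add: norm_scaleC mult.assoc)
    qed
  qed
  thus ?thesis by (simp add: op_of_basis_def bounded_linear_Blinfun_apply)
qed

lemma op_of_basis_clinear: "op_of_basis I e g \<in> clinear_ops"
  by (simp add: clinear_ops_def op_of_basis_apply cinner_scaleC_left complex_space.scale_sum_right)

lemma op_of_basis_on_basis:
  assumes "orthonormal I e" "finite I" "j \<in> I"
  shows "blinfun_apply (op_of_basis I e g) (e j) = g j"
proof -
  have "blinfun_apply (op_of_basis I e g) (e j) = (\<Sum>i\<in>I. if i = j then g i else 0)"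
    unfolding op_of_basis_apply using assms
    by (intro sum.cong) (auto simp: orthonormalD scaleC_one)
  thus ?thesis using assms by simp
qed

lemma clinear_ops_eqI_onb:
  assumes "onb I e" "A \<in> clinear_ops" "B \<in> clinear_ops"
    "\<And>i. i \<in> I \<Longrightarrow> A (e i) = B (e i)"
  shows "A = B"
proof (rule blinfun_eqI)
  fix x
  show "A x = B x"
    using clinear_ops_eq_on_span[OF assms(2,3), of x "e ` I"] assms(1,4) by (auto simp: onb_def)
qed

lemma norm_preserving_if_onb_to_orthonormal:
  assumes "onb I e" "orthonormal I f" "A \<in> clinear_ops"
    "\<And>i. i \<in> I \<Longrightarrow> A (e i) = f i"
  shows "norm (A x) = norm x"
proof -
  have I: "finite I" using assms by (simp add: onb_def)
  have "A x = A (\<Sum>i\<in>I. cinner x (e i) *\<^sub>C e i)"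
    using onb_expansion[OF assms(1), of x] by simp
  also have "\<dots> = (\<Sum>i\<in>I. cinner x (e i) *\<^sub>C f i)"
    using assms by (simp add: blinfun.sum_right clinear_opsD)
  finally have "(norm (A x))\<^sup>2 = (norm x)\<^sup>2"
    by (simp add: orthonormal_norm_sqr_sum[OF assms(2) I] onb_norm_sqr[OF assms(1), of x])
  thus ?thesis by simp
qed

subsection \<open>Restriction to a subspace\<close>

text \<open>For an orthonormal family \<open>b\<close>, \<open>op_of_basis I b b\<close> is the orthogonal projection onto the
  span of \<open>b\<close>.  It turns the description of \<open>restriction_op\<close> by its values on \<open>S\<close> and on the
  orthogonal complement into a formula that depends linearly on \<open>A\<close> and can be
  differentiated.\<close>

lemma restriction_op_eq_compose_projection:
  assumes b: "orthonormal I b" "finite I" and S: "cspan (b ` I) = S"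
  shows "restriction_op S A = A o\<^sub>L op_of_basis I b b"
proof -
  let ?P = "op_of_basis I b b"
  have Pid: "?P x = x" if "x \<in> S" for x
    using clinear_ops_eq_on_span[OF op_of_basis_clinear clinear_ops_id, of x "b ` I" I b b] that
      op_of_basis_on_basis[OF b] by (auto simp: S)
  have bS: "b i \<in> S" if "i \<in> I" for i
    using that complex_space.span_base[of "b i" "b ` I"] S by auto
  have PS: "?P x \<in> S" for x
    unfolding op_of_basis_apply S[symmetric] by (rule complex_space.span_sum, rule complex_space.span_scale, rule complex_space.span_base) simp
  have P0: "?P x = 0" if "\<forall>y\<in>S. cinner x y = 0" for x
    unfolding op_of_basis_apply using that bS by (intro sum.neutral) auto
  have perp: "\<forall>y\<in>S. cinner (x - ?P x) y = 0" for x
  proof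
    fix y assume y: "y \<in> S"
    show "cinner (x - ?P x) y = 0"
      using y unfolding S[symmetric]
    proof (induction rule: complex_space.span_induct_alt)
      case base thus ?case by simp
    next
      case (step c u v)
      then obtain j where "j \<in> I" "u = b j" by auto
      hence "cinner (x - ?P x) u = 0"
        using cinner_orthonormal_sum[OF b, of j "\<lambda>i. cinner x (b i)"]
        by (simp add: cinner_diff_left op_of_basis_apply)
      thus ?case using step by (simp add: cinner_add_right cinner_scaleC_right)
    qed
  qed
  show ?thesis unfolding restriction_op_def
  proof (rule the_equality)
    show "(\<forall>x\<in>S. blinfun_apply (A o\<^sub>L ?P) x = A x) \<and>
      (\<forall>x. (\<forall>y\<in>S. cinner x y = 0) \<longrightarrow> blinfun_apply (A o\<^sub>L ?P) x = 0)"
      using Pid P0 by (auto simp: blinfun.zero_right)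
  next
    fix B assume B: "(\<forall>x\<in>S. blinfun_apply B x = blinfun_apply A x) \<and>
      (\<forall>x. (\<forall>y\<in>S. cinner x y = 0) \<longrightarrow> blinfun_apply B x = 0)"
    show "B = A o\<^sub>L ?P"
    proof (rule blinfun_eqI)
      fix x
      have "blinfun_apply B x = blinfun_apply B (blinfun_apply ?P x)"
        using B perp[of x] by (metis blinfun.diff_right eq_iff_diff_eq_0)
      thus "blinfun_apply B x = blinfun_apply (A o\<^sub>L ?P) x"
        using B PS[of x] by auto
    qed
  qed
qed

lemma norm_orthonormal_projection_le:
  assumes "orthonormal I b" "finite I"
  shows "norm (blinfun_apply (op_of_basis I b b) x) \<le> norm x"
proof -
  let ?p = "blinfun_apply (op_of_basis I b b) x"
  have "cinner x ?p = cinner ?p ?p"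
    using cinner_orthonormal_sum[OF assms, of _ "\<lambda>i. cinner x (b i)"]
    by (simp add: op_of_basis_apply cinner_sum_right cinner_scaleC_right)
  hence "(norm ?p)\<^sup>2 = cmod (cinner x ?p)"
    by (simp add: cinner_self norm_power)
  also have "\<dots> \<le> norm x * norm ?p" by (rule cinner_Cauchy_Schwarz)
  finally have "norm ?p * norm ?p \<le> norm x * norm ?p" by (simp add: power2_eq_square)
  thus ?thesis by (metis mult_le_cancel_right norm_ge_zero not_le order_trans less_le)
qed

lemma orthonormal_projection_fixes:
  assumes b: "orthonormal I b" "finite I" and x: "x \<in> cspan (b ` I)"
  shows "blinfun_apply (op_of_basis I b b) x = x"
  using clinear_ops_eq_on_span[OF op_of_basis_clinear clinear_ops_id x, of I b b]
      op_of_basis_on_basis[OF b] by auto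

lemma orthonormal_projection_in_span:
  "blinfun_apply (op_of_basis I b b) x \<in> cspan (b ` I)"
  unfolding op_of_basis_apply
  by (rule complex_space.span_sum, rule complex_space.span_scale, rule complex_space.span_base) simp

section \<open>Tensor powers\<close>

definition cmultilinear ::
    "nat \<Rightarrow> ((nat \<Rightarrow> 'v::complex_inner_space) \<Rightarrow> 'w::complex_inner_space) \<Rightarrow> bool" where
  "cmultilinear m g \<longleftrightarrow>
     (\<forall>v. \<forall>i\<in>{1..m}. \<forall>x y. g (v(i := x + y)) = g (v(i := x)) + g (v(i := y))) \<and>
     (\<forall>v. \<forall>i\<in>{1..m}. \<forall>c x. g (v(i := c *\<^sub>C x)) = c *\<^sub>C g (v(i := x))) \<and>
     (\<forall>v w. (\<forall>i\<in>{1..m}. v i = w i) \<longrightarrow> g v = g w)"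

lemma cmultilinear_add:
  "cmultilinear m g \<Longrightarrow> i \<in> {1..m} \<Longrightarrow> g (v(i := x + y)) = g (v(i := x)) + g (v(i := y))"
  by (simp add: cmultilinear_def)

lemma cmultilinear_scaleC:
  "cmultilinear m g \<Longrightarrow> i \<in> {1..m} \<Longrightarrow> g (v(i := c *\<^sub>C x)) = c *\<^sub>C g (v(i := x))"
  by (simp add: cmultilinear_def)

lemma cmultilinear_cong:
  assumes "cmultilinear m g" "\<And>i. i \<in> {1..m} \<Longrightarrow> v i = w i"
  shows "g v = g w"
  using assms unfolding cmultilinear_def by blast

lemma cmultilinear_zero:
  assumes "cmultilinear m g" "i \<in> {1..m}"
  shows "g (v(i := 0)) = 0"
  using cmultilinear_scaleC[OF assms, of v 0 0] by simp

lemma cmultilinear_sum: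
  assumes g: "cmultilinear m g" "i \<in> {1..m}"
  shows "g (v(i := \<Sum>j\<in>J. c j *\<^sub>C u j)) = (\<Sum>j\<in>J. c j *\<^sub>C g (v(i := u j)))"
proof (induction J rule: infinite_finite_induct)
  case (insert j J)
  have "g (v(i := \<Sum>j\<in>insert j J. c j *\<^sub>C u j)) = g (v(i := c j *\<^sub>C u j + (\<Sum>j\<in>J. c j *\<^sub>C u j)))"
    using insert by simp
  also have "\<dots> = c j *\<^sub>C g (v(i := u j)) + g (v(i := \<Sum>j\<in>J. c j *\<^sub>C u j))"
    by (simp only: cmultilinear_add[OF g] cmultilinear_scaleC[OF g])
  finally show ?case by (simp only: sum.insert[OF insert.hyps] insert.IH)
next
  case (infinite J)
  show ?case unfolding sum.infinite[OF infinite] by (rule cmultilinear_zero[OF g])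
next
  case empty
  show ?case unfolding sum.empty by (rule cmultilinear_zero[OF g])
qed

lemma cmultilinear_expand:
  assumes g: "cmultilinear m g" and "finite A" "A \<subseteq> {1..m}" "finite J"
  shows "g (\<lambda>i. if i \<in> A then \<Sum>j\<in>J. c i j *\<^sub>C u i j else v i) =
    (\<Sum>\<phi>\<in>PiE A (\<lambda>_. J). (\<Prod>i\<in>A. c i (\<phi> i)) *\<^sub>C g (\<lambda>i. if i \<in> A then u i (\<phi> i) else v i))"
  using assms(2,3)
proof (induction A arbitrary: v rule: finite_induct)
  case empty
  show ?case by (simp add: scaleC_one)
next
  case (insert a A)
  let ?w = "\<lambda>i. if i \<in> A then \<Sum>j\<in>J. c i j *\<^sub>C u i j else v i"
  let ?t = "\<lambda>\<phi>. (\<Prod>i\<in>insert a A. c i (\<phi> i)) *\<^sub>C g (\<lambda>i. if i \<in> insert a A then u i (\<phi> i) else v i)"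
  have a: "a \<in> {1..m}" "a \<notin> A" using insert by auto
  have IH: "g (?w(a := x)) =
     (\<Sum>\<phi>\<in>PiE A (\<lambda>_. J). (\<Prod>i\<in>A. c i (\<phi> i)) *\<^sub>C g (\<lambda>i. if i \<in> A then u i (\<phi> i) else (v(a := x)) i))" for x
  proof -
    have "?w(a := x) = (\<lambda>i. if i \<in> A then \<Sum>j\<in>J. c i j *\<^sub>C u i j else (v(a := x)) i)"
      using a by auto
    thus ?thesis using insert by simp
  qed
  have "(\<lambda>i. if i \<in> insert a A then \<Sum>j\<in>J. c i j *\<^sub>C u i j else v i)
      = ?w(a := \<Sum>j\<in>J. c a j *\<^sub>C u a j)" by auto
  hence "g (\<lambda>i. if i \<in> insert a A then \<Sum>j\<in>J. c i j *\<^sub>C u i j else v i)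
      = (\<Sum>j\<in>J. c a j *\<^sub>C g (?w(a := u a j)))"
    by (simp only: cmultilinear_sum[OF g a(1)])
  also have "\<dots> = (\<Sum>j\<in>J. \<Sum>\<phi>\<in>PiE A (\<lambda>_. J). ?t (\<phi>(a := j)))"
    unfolding IH complex_space.scale_sum_right
  proof (intro sum.cong refl)
    fix j \<phi>
    have "(\<Prod>i\<in>insert a A. c i ((\<phi>(a := j)) i)) = c a j * (\<Prod>i\<in>A. c i (\<phi> i))"
      using a insert.hyps by (auto intro!: prod.cong)
    moreover have "(\<lambda>i. if i \<in> insert a A then u i ((\<phi>(a := j)) i) else v i)
       = (\<lambda>i. if i \<in> A then u i (\<phi> i) else (v(a := u a j)) i)" using a by auto
    ultimately show "c a j *\<^sub>C (\<Prod>i\<in>A. c i (\<phi> i)) *\<^sub>C g (\<lambda>i. if i \<in> A then u i (\<phi> i) else (v(a := u a j)) i)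
       = ?t (\<phi>(a := j))" by (simp add: scaleC_scaleC)
  qed
  also have "\<dots> = (\<Sum>(j, \<phi>)\<in>J \<times> PiE A (\<lambda>_. J). ?t (\<phi>(a := j)))"
    by (rule sum.cartesian_product)
  also have "\<dots> = (\<Sum>\<phi>\<in>PiE (insert a A) (\<lambda>_. J). ?t \<phi>)"
    unfolding PiE_insert_eq
    by (subst sum.reindex[OF inj_combinator[OF a(2)]]) (simp add: case_prod_unfold)
  finally show ?case .
qed

lemma cmultilinear_prod_scaleC:
  assumes g: "cmultilinear m g"
  shows "g (\<lambda>i. c i *\<^sub>C v i) = (\<Prod>i\<in>{1..m}. c i) *\<^sub>C g v"
proof -
  have "g (\<lambda>i. if i \<in> A then c i *\<^sub>C v i else v i) = (\<Prod>i\<in>A. c i) *\<^sub>C g v"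
    if "finite A" "A \<subseteq> {1..m}" for A
    using that
  proof (induction A rule: finite_induct)
    case (insert a A)
    let ?w = "\<lambda>i. if i \<in> A then c i *\<^sub>C v i else v i"
    have "(\<lambda>i. if i \<in> insert a A then c i *\<^sub>C v i else v i) = ?w(a := c a *\<^sub>C v a)" by auto
    hence "g (\<lambda>i. if i \<in> insert a A then c i *\<^sub>C v i else v i) = c a *\<^sub>C g (?w(a := v a))"
      using cmultilinear_scaleC[OF g, of a ?w "c a" "v a"] insert by simp
    also have "?w(a := v a) = ?w" using insert by auto
    finally show ?case using insert by (simp add: scaleC_scaleC)
  qed (simp add: scaleC_one)
  from this[of "{1..m}"]
  have "g (\<lambda>i. if i \<in> {1..m} then c i *\<^sub>C v i else v i) = (\<Prod>i\<in>{1..m}. c i) *\<^sub>C g v" by simp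
  moreover have "g (\<lambda>i. if i \<in> {1..m} then c i *\<^sub>C v i else v i) = g (\<lambda>i. c i *\<^sub>C v i)"
    by (rule cmultilinear_cong[OF g]) auto
  ultimately show ?thesis by simp
qed

lemma tensor_power_cmultilinear:
  assumes "is_tensor_power m \<tau>"
  shows "cmultilinear m \<tau>"
proof -
  have "\<tau> v = \<tau> w" if "\<forall>i\<in>{1..m}. v i = w i" for v w
  proof -
    have *: "cinner (\<tau> v) (\<tau> w) = (\<Prod>i\<in>{1..m}. cinner (v i) (w i))" for v w
      using assms by (simp add: is_tensor_power_def)
    have "(\<Prod>i\<in>{1..m}. cinner (v i) (u i)) = (\<Prod>i\<in>{1..m}. cinner (w i) (u i))" for u
      using that by (intro prod.cong) auto
    hence "cinner (\<tau> v - \<tau> w) (\<tau> v - \<tau> w) = 0"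
      unfolding cinner_diff_left cinner_diff_right * by simp
    thus ?thesis by (simp add: cinner_self_eq_zero_iff)
  qed
  thus ?thesis using assms unfolding is_tensor_power_def cmultilinear_def by blast
qed

text \<open>The tensor product \<open>X 1 \<otimes> \<dots> \<otimes> X m\<close> of operators that may differ from one factor to the
  next; the derivatives of \<open>\<otimes>\<^sup>m T\<close> are sums of these.\<close>

definition tensor_ops ::
    "((nat \<Rightarrow> 'v::complex_inner_space) \<Rightarrow> 'w::complex_inner_space) \<Rightarrow> (nat \<Rightarrow> 'v \<Rightarrow>\<^sub>L 'v) \<Rightarrow> 'w \<Rightarrow>\<^sub>L 'w" where
  "tensor_ops \<tau> X = (THE A. A \<in> clinear_ops \<and>
     (\<forall>v. A (\<tau> v) = \<tau> (\<lambda>i. X i (v i))))"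

lemma tensor_op_eq_tensor_ops: "tensor_op \<tau> T = tensor_ops \<tau> (\<lambda>_. T)"
  by (simp add: tensor_op_def tensor_ops_def)

text \<open>The basis \<open>e\<close> is a parameter because the same tensor power is later seen through both
  orthonormal bases of a singular value decomposition.\<close>

locale based_tensor_power =
  fixes m n :: nat and \<tau> :: "(nat \<Rightarrow> 'v::complex_inner_space) \<Rightarrow> 'w::complex_inner_space"
    and e :: "nat \<Rightarrow> 'v"
  assumes tensor: "is_tensor_power m \<tau>" and onb_e: "onb {1..n} e"
begin

definition multi_index :: "(nat \<Rightarrow> nat) set" where
  "multi_index = PiE {1..m} (\<lambda>_. {1..n})"

definition basis_tensor :: "(nat \<Rightarrow> nat) \<Rightarrow> 'w" where
  "basis_tensor \<alpha> = \<tau> (\<lambda>i. e (\<alpha> i))"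

lemma finite_multi_index [simp]: "finite multi_index"
  by (simp add: multi_index_def finite_PiE)

lemma multi_index_range: "\<alpha> \<in> multi_index \<Longrightarrow> i \<in> {1..m} \<Longrightarrow> \<alpha> i \<in> {1..n}"
  by (auto simp: multi_index_def)

lemmas multilinear = tensor_power_cmultilinear[OF tensor]

lemma cinner_tensor: "cinner (\<tau> v) (\<tau> w) = (\<Prod>i\<in>{1..m}. cinner (v i) (w i))"
  using tensor by (simp add: is_tensor_power_def)

lemma orthonormal_e: "orthonormal {1..n} e"
  using onb_e by (simp add: onb_def)

lemma multilinear_basis_expansion:
  assumes g: "cmultilinear m g"
  shows "g v = (\<Sum>\<alpha>\<in>multi_index. (\<Prod>i\<in>{1..m}. cinner (v i) (e (\<alpha> i))) *\<^sub>C g (\<lambda>i. e (\<alpha> i)))"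
proof -
  have "g v = g (\<lambda>i. if i \<in> {1..m} then \<Sum>j\<in>{1..n}. cinner (v i) (e j) *\<^sub>C e j else v i)"
    using onb_expansion[OF onb_e] by (intro cmultilinear_cong[OF g]) auto
  also have "\<dots> = (\<Sum>\<alpha>\<in>multi_index. (\<Prod>i\<in>{1..m}. cinner (v i) (e (\<alpha> i))) *\<^sub>C
      g (\<lambda>i. if i \<in> {1..m} then e (\<alpha> i) else v i))"
    unfolding multi_index_def by (rule cmultilinear_expand[OF g]) auto
  also have "\<dots> = (\<Sum>\<alpha>\<in>multi_index. (\<Prod>i\<in>{1..m}. cinner (v i) (e (\<alpha> i))) *\<^sub>C g (\<lambda>i. e (\<alpha> i)))"
    by (intro sum.cong refl arg_cong2[where f = scaleC] cmultilinear_cong[OF g]) auto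
  finally show ?thesis .
qed

lemma onb_basis_tensor: "onb multi_index basis_tensor"
proof -
  have "orthonormal multi_index basis_tensor"
    unfolding orthonormal_def
  proof (intro ballI)
    fix \<alpha> \<beta> assume \<alpha>\<beta>: "\<alpha> \<in> multi_index" "\<beta> \<in> multi_index"
    have *: "cinner (basis_tensor \<alpha>) (basis_tensor \<beta>) = (\<Prod>i\<in>{1..m}. if \<alpha> i = \<beta> i then 1 else 0)"
      unfolding basis_tensor_def cinner_tensor using \<alpha>\<beta> multi_index_range
      by (intro prod.cong refl) (metis orthonormalD[OF orthonormal_e])
    show "cinner (basis_tensor \<alpha>) (basis_tensor \<beta>) = (if \<alpha> = \<beta> then 1 else 0)"
    proof (cases "\<alpha> = \<beta>")
      case False
      then obtain i where "i \<in> {1..m}" "\<alpha> i \<noteq> \<beta> i"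
        using \<alpha>\<beta> unfolding multi_index_def by (metis PiE_ext)
      hence "(\<Prod>i\<in>{1..m}. if \<alpha> i = \<beta> i then 1 else (0::complex)) = 0"
        by (intro prod_zero) auto
      thus ?thesis using * False by simp
    qed (use * in simp)
  qed
  moreover have "cspan (basis_tensor ` multi_index) = UNIV"
  proof -
    have "\<tau> v \<in> cspan (basis_tensor ` multi_index)" for v
      unfolding multilinear_basis_expansion[OF multilinear, of v] basis_tensor_def[symmetric]
      by (rule complex_space.span_sum, rule complex_space.span_scale, rule complex_space.span_base) simp
    hence "cspan (range \<tau>) \<subseteq> cspan (basis_tensor ` multi_index)"
      by (intro complex_space.span_minimal) auto
    thus ?thesis using tensor by (auto simp: is_tensor_power_def)
  qed
  ultimately show ?thesis by (simp add: onb_def)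
qed

lemma tensor_op_eqI:
  assumes "A \<in> clinear_ops" "B \<in> clinear_ops" "\<And>v. A (\<tau> v) = B (\<tau> v)"
  shows "A = B"
  by (rule clinear_ops_eqI_onb[OF onb_basis_tensor assms(1,2)]) (simp add: assms(3) basis_tensor_def)

text \<open>A multilinear map is determined by its values on tuples of basis vectors, and
  the basis tensors are a basis of the tensor power.  All operators on the tensor power
  arise from this property.\<close>

lemma tensor_universal_property:
  assumes g: "cmultilinear m g"
  shows "\<exists>!A. A \<in> clinear_ops \<and> (\<forall>v. A (\<tau> v) = g v)"
proof (rule ex_ex1I)
  let ?A = "op_of_basis multi_index basis_tensor (\<lambda>\<alpha>. g (\<lambda>i. e (\<alpha> i)))"
  have "blinfun_apply ?A (\<tau> v) = g v" for v
  proof -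
    have "blinfun_apply ?A (\<tau> v) = (\<Sum>\<alpha>\<in>multi_index. (\<Prod>i\<in>{1..m}. cinner (v i) (e (\<alpha> i))) *\<^sub>C
       g (\<lambda>i. e (\<alpha> i)))"
      unfolding op_of_basis_apply basis_tensor_def cinner_tensor ..
    thus ?thesis using multilinear_basis_expansion[OF g, of v] by simp
  qed
  thus "\<exists>A. A \<in> clinear_ops \<and> (\<forall>v. A (\<tau> v) = g v)"
    using op_of_basis_clinear by blast
next
  fix A B
  assume "A \<in> clinear_ops \<and> (\<forall>v. A (\<tau> v) = g v)"
    "B \<in> clinear_ops \<and> (\<forall>v. B (\<tau> v) = g v)"
  thus "A = B" by (intro tensor_op_eqI) auto
qed

lemma tensor_ops_props:
  assumes X: "\<And>i. X i \<in> clinear_ops"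
  shows "tensor_ops \<tau> X \<in> clinear_ops"
    and "tensor_ops \<tau> X (\<tau> v) = \<tau> (\<lambda>i. X i (v i))"
proof -
  have upd: "(\<lambda>i. X i ((v(a := x)) i)) = (\<lambda>i. X i (v i))(a := X a x)"
    for v a x by auto
  have "cmultilinear m (\<lambda>v. \<tau> (\<lambda>i. X i (v i)))"
    unfolding cmultilinear_def upd
    by (auto simp: blinfun.add_right clinear_opsD[OF X] cmultilinear_add[OF multilinear]
        cmultilinear_scaleC[OF multilinear] intro: cmultilinear_cong[OF multilinear])
  from theI'[OF tensor_universal_property[OF this]]
  show "tensor_ops \<tau> X \<in> clinear_ops"
    "tensor_ops \<tau> X (\<tau> v) = \<tau> (\<lambda>i. X i (v i))"
    unfolding tensor_ops_def by auto
qed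

lemma perm_op_props:
  assumes \<sigma>: "\<sigma> permutes {1..m}"
  shows "perm_op \<tau> \<sigma> \<in> clinear_ops"
    and "perm_op \<tau> \<sigma> (\<tau> v) = \<tau> (\<lambda>i. v (inv \<sigma> i))"
proof -
  have upd: "(\<lambda>i. (v(a := x)) (inv \<sigma> i)) = (\<lambda>i. v (inv \<sigma> i))(\<sigma> a := x)" for v :: "nat \<Rightarrow> 'v" and a x
    using permutes_inverses[OF \<sigma>] by (auto simp: fun_eq_iff)
  have mem: "\<sigma> a \<in> {1..m}" if "a \<in> {1..m}" for a using that permutes_in_image[OF \<sigma>] by blast
  have mem': "inv \<sigma> a \<in> {1..m}" if "a \<in> {1..m}" for a
    using that permutes_in_image[OF permutes_inv[OF \<sigma>]] by blast
  have "cmultilinear m (\<lambda>v. \<tau> (\<lambda>i. v (inv \<sigma> i)))"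
    unfolding cmultilinear_def upd
    using mem mem' by (auto simp: cmultilinear_add[OF multilinear]
        cmultilinear_scaleC[OF multilinear] intro!: cmultilinear_cong[OF multilinear])
  from theI'[OF tensor_universal_property[OF this]]
  show "perm_op \<tau> \<sigma> \<in> clinear_ops"
    "perm_op \<tau> \<sigma> (\<tau> v) = \<tau> (\<lambda>i. v (inv \<sigma> i))"
    unfolding perm_op_def by auto
qed

lemma tensor_ops_compose:
  assumes "\<And>i. X i \<in> clinear_ops" "\<And>i. Y i \<in> clinear_ops"
  shows "tensor_ops \<tau> X o\<^sub>L tensor_ops \<tau> Y = tensor_ops \<tau> (\<lambda>i. X i o\<^sub>L Y i)"
  using assms by (intro tensor_op_eqI) (simp_all add: tensor_ops_props clinear_ops_compose)

lemma tensor_ops_id: "tensor_ops \<tau> (\<lambda>_. id_blinfun) = id_blinfun"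
  by (intro tensor_op_eqI) (simp_all add: tensor_ops_props clinear_ops_id)

lemma tensor_ops_cong:
  assumes "\<And>i. X i \<in> clinear_ops" "\<And>i. Y i \<in> clinear_ops" "\<And>i. i \<in> {1..m} \<Longrightarrow> X i = Y i"
  shows "tensor_ops \<tau> X = tensor_ops \<tau> Y"
  using assms by (intro tensor_op_eqI) (auto simp: tensor_ops_props intro!: cmultilinear_cong[OF multilinear])

lemma perm_op_tensor_ops:
  assumes \<sigma>: "\<sigma> permutes {1..m}" and X: "\<And>i. X i \<in> clinear_ops"
  shows "perm_op \<tau> \<sigma> o\<^sub>L tensor_ops \<tau> X = tensor_ops \<tau> (\<lambda>i. X (inv \<sigma> i)) o\<^sub>L perm_op \<tau> \<sigma>"
  using X by (intro tensor_op_eqI) (simp_all add: tensor_ops_props perm_op_props[OF \<sigma>] clinear_ops_compose)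

lemma tensor_ops_diagonal:
  assumes X: "\<And>i. X i \<in> clinear_ops" and \<alpha>: "\<alpha> \<in> multi_index"
    and q: "\<And>i a. i \<in> {1..m} \<Longrightarrow> a \<in> {1..n} \<Longrightarrow> X i (e a) = q i a *\<^sub>C f a"
  shows "tensor_ops \<tau> X (basis_tensor \<alpha>) = (\<Prod>i\<in>{1..m}. q i (\<alpha> i)) *\<^sub>C \<tau> (\<lambda>i. f (\<alpha> i))"
proof -
  have "tensor_ops \<tau> X (basis_tensor \<alpha>) = \<tau> (\<lambda>i. q i (\<alpha> i) *\<^sub>C f (\<alpha> i))"
    unfolding basis_tensor_def tensor_ops_props[OF X]
    using q multi_index_range[OF \<alpha>] by (intro cmultilinear_cong[OF multilinear]) auto
  thus ?thesis by (simp add: cmultilinear_prod_scaleC[OF multilinear])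
qed

subsection \<open>Tensor products of contractions\<close>

text \<open>A tensor split along the site \<open>i\<close>: all other sites carry basis vectors \<open>e (\<gamma> j)\<close> and the
  site \<open>i\<close> an arbitrary vector.  Slices with different \<open>\<gamma>\<close> are orthogonal and an operator at the
  site \<open>i\<close> acts on each of them separately, so that it has no larger norm on the tensor power
  than on the factor.\<close>

lemma tensor_slice_decomposition:
  assumes i: "i \<in> {1..m}"
  shows "\<exists>u. x = (\<Sum>\<gamma>\<in>PiE ({1..m} - {i}) (\<lambda>_. {1..n}). \<tau> ((\<lambda>j. e (\<gamma> j))(i := u \<gamma>)))"
proof -
  let ?G = "PiE ({1..m} - {i}) (\<lambda>_. {1..n})"
  have "x \<in> cspan (range \<tau>)" using tensor by (simp add: is_tensor_power_def)
  thus ?thesis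
  proof (induction rule: complex_space.span_induct_alt)
    case base
    show ?case by (intro exI[of _ "\<lambda>_. 0"])
      (simp only: cmultilinear_zero[OF multilinear i] sum.neutral_const)
  next
    case (step c y z)
    then obtain u where u: "z = (\<Sum>\<gamma>\<in>?G. \<tau> ((\<lambda>j. e (\<gamma> j))(i := u \<gamma>)))" by blast
    from step obtain v where v: "y = \<tau> v" by auto
    let ?p = "\<lambda>\<gamma>. \<Prod>j\<in>{1..m} - {i}. cinner (v j) (e (\<gamma> j))"
    have "\<tau> v = \<tau> (\<lambda>j. if j \<in> {1..m} - {i} then \<Sum>a\<in>{1..n}. cinner (v j) (e a) *\<^sub>C e a else v j)"
      using onb_expansion[OF onb_e] by (intro cmultilinear_cong[OF multilinear]) auto
    also have "\<dots> = (\<Sum>\<gamma>\<in>?G. ?p \<gamma> *\<^sub>C \<tau> (\<lambda>j. if j \<in> {1..m} - {i} then e (\<gamma> j) else v j))"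
      by (rule cmultilinear_expand[OF multilinear]) auto
    also have "\<dots> = (\<Sum>\<gamma>\<in>?G. \<tau> ((\<lambda>j. e (\<gamma> j))(i := ?p \<gamma> *\<^sub>C v i)))"
      unfolding cmultilinear_scaleC[OF multilinear i]
      by (intro sum.cong refl arg_cong2[where f = scaleC] cmultilinear_cong[OF multilinear]) auto
    finally have "c *\<^sub>C \<tau> v + z =
       (\<Sum>\<gamma>\<in>?G. \<tau> ((\<lambda>j. e (\<gamma> j))(i := c *\<^sub>C ?p \<gamma> *\<^sub>C v i + u \<gamma>)))"
      unfolding u cmultilinear_add[OF multilinear i] sum.distrib
      by (simp only: cmultilinear_scaleC[OF multilinear i] complex_space.scale_sum_right)
    thus ?case unfolding v by (rule exI[of _ "\<lambda>\<gamma>. c *\<^sub>C ?p \<gamma> *\<^sub>C v i + u \<gamma>"])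
  qed
qed

lemma norm_sqr_slices:
  assumes i: "i \<in> {1..m}"
  shows "(norm (\<Sum>\<gamma>\<in>PiE ({1..m} - {i}) (\<lambda>_. {1..n}). \<tau> ((\<lambda>j. e (\<gamma> j))(i := u \<gamma>))))\<^sup>2
    = (\<Sum>\<gamma>\<in>PiE ({1..m} - {i}) (\<lambda>_. {1..n}). (norm (u \<gamma>))\<^sup>2)"
proof -
  let ?G = "PiE ({1..m} - {i}) (\<lambda>_. {1..n})"
  let ?t = "\<lambda>\<gamma>. \<tau> ((\<lambda>j. e (\<gamma> j))(i := u \<gamma>))"
  have fG: "finite ?G" by (simp add: finite_PiE)
  have in_n: "\<gamma> j \<in> {1..n}" if "\<gamma> \<in> ?G" "j \<in> {1..m} - {i}" for \<gamma> j
    using PiE_mem[OF that] by simp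
  have inner: "cinner (?t \<gamma>) (?t \<delta>) = (if \<gamma> = \<delta> then cinner (u \<gamma>) (u \<gamma>) else 0)"
    if gd: "\<gamma> \<in> ?G" "\<delta> \<in> ?G" for \<gamma> \<delta>
  proof -
    have "cinner (?t \<gamma>) (?t \<delta>) = cinner (u \<gamma>) (u \<delta>) * (\<Prod>j\<in>{1..m} - {i}. cinner (e (\<gamma> j)) (e (\<delta> j)))"
      unfolding cinner_tensor using i by (subst prod.remove[of _ i]) (auto intro!: prod.cong)
    also have "(\<Prod>j\<in>{1..m} - {i}. cinner (e (\<gamma> j)) (e (\<delta> j))) =
       (\<Prod>j\<in>{1..m} - {i}. if \<gamma> j = \<delta> j then 1 else 0)"
      using in_n[OF gd(1)] in_n[OF gd(2)]
      by (intro prod.cong refl) (metis orthonormalD[OF orthonormal_e])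
    finally have *: "cinner (?t \<gamma>) (?t \<delta>) = cinner (u \<gamma>) (u \<delta>) * (\<Prod>j\<in>{1..m} - {i}. if \<gamma> j = \<delta> j then 1 else 0)" .
    show ?thesis
    proof (cases "\<gamma> = \<delta>")
      case False
      then obtain j where "j \<in> {1..m} - {i}" "\<gamma> j \<noteq> \<delta> j"
        using gd by (metis PiE_ext)
      hence "(\<Prod>j\<in>{1..m} - {i}. if \<gamma> j = \<delta> j then 1 else (0::complex)) = 0"
        by (intro prod_zero) auto
      thus ?thesis using * False by simp
    qed (use * in simp)
  qed
  have "cinner (\<Sum>\<gamma>\<in>?G. ?t \<gamma>) (\<Sum>\<gamma>\<in>?G. ?t \<gamma>) = (\<Sum>\<gamma>\<in>?G. \<Sum>\<delta>\<in>?G. if \<gamma> = \<delta> then cinner (u \<gamma>) (u \<gamma>) else 0)"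
    unfolding cinner_sum_left unfolding cinner_sum_right by (intro sum.cong refl inner)
  also have "\<dots> = of_real (\<Sum>\<gamma>\<in>?G. (norm (u \<gamma>))\<^sup>2)"
    using fG by (simp add: cinner_self)
  finally show ?thesis by (simp only: cinner_self of_real_eq_iff)
qed

lemma norm_tensor_ops_one_site:
  assumes i: "i \<in> {1..m}" and A: "A \<in> clinear_ops" "norm A \<le> 1"
  shows "norm (blinfun_apply (tensor_ops \<tau> (\<lambda>j. if j = i then A else id_blinfun)) x) \<le> norm x"
proof -
  let ?G = "PiE ({1..m} - {i}) (\<lambda>_. {1..n})"
  let ?X = "\<lambda>j. if j = i then A else id_blinfun"
  obtain u where x: "x = (\<Sum>\<gamma>\<in>?G. \<tau> ((\<lambda>j. e (\<gamma> j))(i := u \<gamma>)))"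
    using tensor_slice_decomposition[OF i] by blast
  have X: "\<And>j. ?X j \<in> clinear_ops" using A by (simp add: clinear_ops_id)
  have "(\<lambda>j. blinfun_apply (?X j) (((\<lambda>j. e (\<gamma> j))(i := u \<gamma>)) j)) =
      (\<lambda>j. e (\<gamma> j))(i := A (u \<gamma>))" for \<gamma> by auto
  hence Ax: "tensor_ops \<tau> ?X x =
      (\<Sum>\<gamma>\<in>?G. \<tau> ((\<lambda>j. e (\<gamma> j))(i := A (u \<gamma>))))"
    unfolding x blinfun.sum_right by (simp only: tensor_ops_props(2)[OF X])
  have "norm (A y) \<le> norm y" for y
    using norm_blinfun[of A y] mult_right_mono[OF A(2), of "norm y"] by simp
  hence "(norm (tensor_ops \<tau> ?X x))\<^sup>2 \<le> (norm x)\<^sup>2"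
    unfolding Ax unfolding x norm_sqr_slices[OF i] by (intro sum_mono power_mono) auto
  thus ?thesis by (rule power2_le_imp_le) simp
qed

text \<open>The tensor product is the composition of the operators at the single sites.\<close>

lemma norm_tensor_ops_contraction:
  assumes X: "\<And>i. X i \<in> clinear_ops" "\<And>i. i \<in> {1..m} \<Longrightarrow> norm (X i) \<le> 1"
  shows "norm (tensor_ops \<tau> X x) \<le> norm x"
proof -
  have "norm (blinfun_apply (tensor_ops \<tau> (\<lambda>i. if i \<in> F then X i else id_blinfun)) x) \<le> norm x"
    if "finite F" "F \<subseteq> {1..m}" for F
    using that
  proof (induction F rule: finite_induct)
    case empty
    show ?case by (simp add: tensor_ops_id)
  next
    case (insert a F)
    let ?A = "\<lambda>i. if i = a then X a else id_blinfun"
    let ?B = "\<lambda>i. if i \<in> F then X i else id_blinfun"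
    have "(\<lambda>i. if i \<in> insert a F then X i else id_blinfun) = (\<lambda>i. ?A i o\<^sub>L ?B i)"
      using insert by (auto intro!: ext blinfun_eqI)
    moreover have "tensor_ops \<tau> ?A o\<^sub>L tensor_ops \<tau> ?B = tensor_ops \<tau> (\<lambda>i. ?A i o\<^sub>L ?B i)"
      by (rule tensor_ops_compose) (auto simp: X clinear_ops_id)
    ultimately have "norm (blinfun_apply (tensor_ops \<tau> (\<lambda>i. if i \<in> insert a F then X i else id_blinfun)) x)
       \<le> norm (blinfun_apply (tensor_ops \<tau> ?B) x)"
      using norm_tensor_ops_one_site[of a "X a" "blinfun_apply (tensor_ops \<tau> ?B) x"] insert X
      by (metis (no_types, lifting) blinfun_apply_blinfun_compose insert_subset)
    thus ?case using insert by auto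
  qed
  from this[of "{1..m}"] show ?thesis
    using tensor_ops_cong[of X "\<lambda>i. if i \<in> {1..m} then X i else id_blinfun"] X(1)
    by (simp add: clinear_ops_id)
qed

end

section \<open>The derivative of the tensor power\<close>

text \<open>Each of the variables \<open>1, \<dots>, k\<close> is differentiated exactly once and occurs in one factor
  only, so first derivatives of the factors suffice.\<close>

lemma mixed_partial_separated_sum:
  fixes C :: "'i \<Rightarrow> 'b::real_normed_vector"
  assumes "k \<le> N"
    and "\<And>\<phi> j s. j \<in> {1..k} \<Longrightarrow> (h \<phi> j has_real_derivative h' \<phi> j s) (at s)"
  shows "mixed_partial k (\<lambda>t. \<Sum>\<phi>\<in>\<Phi>. (\<Prod>j\<in>{1..N}. h \<phi> j (t j)) *\<^sub>R C \<phi>) =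
    (\<lambda>t. \<Sum>\<phi>\<in>\<Phi>. (\<Prod>j\<in>{1..N}. (if j \<le> k then h' \<phi> j (t j) else h \<phi> j (t j))) *\<^sub>R C \<phi>)"
  using assms
proof (induction k arbitrary: h)
  case 0
  have "(\<Prod>j\<in>{1..N}. (if j \<le> 0 then h' \<phi> j (t j) else h \<phi> j (t j))) = (\<Prod>j\<in>{1..N}. h \<phi> j (t j))" for \<phi> t
    by (rule prod.cong) auto
  thus ?case by simp
next
  case (Suc k)
  let ?K = "Suc k"
  let ?h = "\<lambda>\<phi>. (h \<phi>)(?K := h' \<phi> ?K)"
  have K: "?K \<in> {1..N}" using Suc.prems by simp
  have "partial_deriv ?K (\<lambda>t. \<Sum>\<phi>\<in>\<Phi>. (\<Prod>j\<in>{1..N}. h \<phi> j (t j)) *\<^sub>R C \<phi>) t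
      = (\<Sum>\<phi>\<in>\<Phi>. (\<Prod>j\<in>{1..N}. ?h \<phi> j (t j)) *\<^sub>R C \<phi>)" for t
  proof -
    have split: "(\<Prod>j\<in>{1..N}. f j) = f ?K * (\<Prod>j\<in>{1..N} - {?K}. f j)" for f :: "nat \<Rightarrow> real"
      using K by (simp add: prod.remove)
    have rest: "(\<Prod>j\<in>{1..N} - {?K}. h \<phi> j ((t(?K := s)) j)) = (\<Prod>j\<in>{1..N} - {?K}. h \<phi> j (t j))"
      "(\<Prod>j\<in>{1..N} - {?K}. ?h \<phi> j (t j)) = (\<Prod>j\<in>{1..N} - {?K}. h \<phi> j (t j))" for \<phi> s
      by (auto intro!: prod.cong)
    have "((\<lambda>s. \<Sum>\<phi>\<in>\<Phi>. (h \<phi> ?K s * (\<Prod>j\<in>{1..N} - {?K}. h \<phi> j (t j))) *\<^sub>R C \<phi>)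
       has_vector_derivative (\<Sum>\<phi>\<in>\<Phi>. (h' \<phi> ?K (t ?K) * (\<Prod>j\<in>{1..N} - {?K}. h \<phi> j (t j))) *\<^sub>R C \<phi>)) (at (t ?K))"
      using Suc.prems(2)[of ?K]
      by (intro has_vector_derivative_sum) (auto intro!: derivative_eq_intros)
    thus ?thesis unfolding partial_deriv_def split rest
      by (simp add: vector_derivative_at)
  qed
  hence "partial_deriv ?K (\<lambda>t. \<Sum>\<phi>\<in>\<Phi>. (\<Prod>j\<in>{1..N}. h \<phi> j (t j)) *\<^sub>R C \<phi>) =
     (\<lambda>t. \<Sum>\<phi>\<in>\<Phi>. (\<Prod>j\<in>{1..N}. ?h \<phi> j (t j)) *\<^sub>R C \<phi>)" by (rule ext)
  hence "mixed_partial ?K (\<lambda>t. \<Sum>\<phi>\<in>\<Phi>. (\<Prod>j\<in>{1..N}. h \<phi> j (t j)) *\<^sub>R C \<phi>) =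
     mixed_partial k (\<lambda>t. \<Sum>\<phi>\<in>\<Phi>. (\<Prod>j\<in>{1..N}. ?h \<phi> j (t j)) *\<^sub>R C \<phi>)"
    by (simp only: mixed_partial.simps)
  also have "\<dots> = (\<lambda>t. \<Sum>\<phi>\<in>\<Phi>. (\<Prod>j\<in>{1..N}. (if j \<le> k then h' \<phi> j (t j) else ?h \<phi> j (t j))) *\<^sub>R C \<phi>)"
    using Suc.prems by (intro Suc.IH) auto
  also have "\<dots> = (\<lambda>t. \<Sum>\<phi>\<in>\<Phi>. (\<Prod>j\<in>{1..N}. (if j \<le> ?K then h' \<phi> j (t j) else h \<phi> j (t j))) *\<^sub>R C \<phi>)"
    by (intro ext sum.cong refl arg_cong2[where f = scaleR] prod.cong) (auto simp: le_Suc_eq)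
  finally show ?case .
qed

text \<open>The summands of the derivative: \<open>\<phi> i = j\<close> puts the direction \<open>j\<close> at the site \<open>i\<close>, and the
  label \<open>0\<close> stands for the base point of the derivative.\<close>

definition placements :: "nat \<Rightarrow> nat \<Rightarrow> (nat \<Rightarrow> nat) set" where
  "placements m k =
     {\<phi> \<in> PiE {1..m} (\<lambda>_. {0..k}). \<forall>j\<in>{1..k}. card {i\<in>{1..m}. \<phi> i = j} = 1}"

lemma finite_placements [simp]: "finite (placements m k)"
  unfolding placements_def by (rule finite_subset[of _ "PiE {1..m} (\<lambda>_. {0..k})"]) (auto intro: finite_PiE)

definition elem_sym_fun :: "nat \<Rightarrow> nat \<Rightarrow> (nat \<Rightarrow> real) \<Rightarrow> real" where
  "elem_sym_fun m r q = (\<Sum>B | B \<subseteq> {1..m} \<and> card B = r. \<Prod>i\<in>B. q i)"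

lemma placements_bij_betw:
  assumes "\<phi> \<in> placements m k"
  shows "bij_betw \<phi> ({1..m} - {i\<in>{1..m}. \<phi> i = 0}) {1..k}"
proof -
  have \<phi>: "\<phi> \<in> PiE {1..m} (\<lambda>_. {0..k})" "\<And>j. j \<in> {1..k} \<Longrightarrow> card {i\<in>{1..m}. \<phi> i = j} = 1"
    using assms by (auto simp: placements_def)
  show ?thesis
  proof (rule bij_betw_imageI)
    show "inj_on \<phi> ({1..m} - {i\<in>{1..m}. \<phi> i = 0})"
    proof (rule inj_onI)
      fix x y assume xy: "x \<in> {1..m} - {i\<in>{1..m}. \<phi> i = 0}" "y \<in> {1..m} - {i\<in>{1..m}. \<phi> i = 0}" "\<phi> x = \<phi> y"
      hence "\<phi> x \<in> {0..k}" "\<phi> x \<noteq> 0" using PiE_mem[OF \<phi>(1), of x] by (blast, simp)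
      hence "\<phi> x \<in> {1..k}" by simp
      from \<phi>(2)[OF this] obtain z where "{i\<in>{1..m}. \<phi> i = \<phi> x} = {z}" by (rule card_1_singletonE)
      moreover have "x \<in> {i\<in>{1..m}. \<phi> i = \<phi> x}" using xy(1) by blast
      moreover have "y \<in> {i\<in>{1..m}. \<phi> i = \<phi> x}" using xy(2,3) by (simp only: Diff_iff mem_Collect_eq simp_thms)
      ultimately show "x = y" by (metis (no_types, lifting) singletonD)
    qed
    show "\<phi> ` ({1..m} - {i\<in>{1..m}. \<phi> i = 0}) = {1..k}"
    proof (intro equalityI subsetI)
      fix j assume "j \<in> \<phi> ` ({1..m} - {i\<in>{1..m}. \<phi> i = 0})"
      then obtain i where "i \<in> {1..m}" "\<phi> i \<noteq> 0" "j = \<phi> i" by blast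
      thus "j \<in> {1..k}" using PiE_mem[OF \<phi>(1), of i] by simp
    next
      fix j assume j: "j \<in> {1..k}"
      from \<phi>(2)[OF this] obtain z where "{i\<in>{1..m}. \<phi> i = j} = {z}" by (rule card_1_singletonE)
      hence "z \<in> {i\<in>{1..m}. \<phi> i = j}" by auto
      thus "j \<in> \<phi> ` ({1..m} - {i\<in>{1..m}. \<phi> i = 0})" using j by (intro image_eqI[of _ _ z]) auto
    qed
  qed
qed

lemma placementsI:
  assumes "\<phi> \<in> PiE {1..m} (\<lambda>_. {0..k})"
    and "bij_betw \<phi> ({1..m} - {i\<in>{1..m}. \<phi> i = 0}) {1..k}"
  shows "\<phi> \<in> placements m k"
  unfolding placements_def
proof (intro CollectI conjI ballI assms(1))
  fix j assume j: "j \<in> {1..k}"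
  then obtain z where z: "z \<in> {1..m} - {i\<in>{1..m}. \<phi> i = 0}" "\<phi> z = j"
    using bij_betw_imp_surj_on[OF assms(2)] by (metis (no_types, lifting) imageE)
  have "{i\<in>{1..m}. \<phi> i = j} = {z}"
  proof (intro equalityI subsetI)
    fix x assume "x \<in> {i\<in>{1..m}. \<phi> i = j}"
    hence "x \<in> {1..m} - {i\<in>{1..m}. \<phi> i = 0}" "\<phi> x = \<phi> z" using z j by auto
    hence "x = z" using inj_onD[OF bij_betw_imp_inj_on[OF assms(2)] _ _ z(1)] by blast
    thus "x \<in> {z}" by simp
  qed (use z in blast)
  thus "card {i\<in>{1..m}. \<phi> i = j} = 1" by simp
qed

text \<open>After the choice of one bijection \<open>h\<close> from the occupied sites to the directions the
  placements with free sites \<open>B\<close> are the permutations of the directions, composed with \<open>h\<close>.\<close>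

lemma card_placements_with_rest:
  assumes B: "B \<subseteq> {1..m}" "card B = m - k" and km: "k \<le> m"
  shows "card {\<phi> \<in> placements m k. {i\<in>{1..m}. \<phi> i = 0} = B} = fact k"
proof -
  let ?A = "{1..m} - B"
  let ?F = "{\<phi> \<in> placements m k. {i\<in>{1..m}. \<phi> i = 0} = B}"
  have finB: "finite B" using B finite_subset by blast
  have "card ?A = k" using B km finB by (simp add: card_Diff_subset)
  then obtain h where h: "bij_betw h ?A {1..k}"
    using finite_same_card_bij[of ?A "{1..k}"] by auto
  let ?G = "\<lambda>p i. if i \<in> ?A then p (h i) else if i \<in> B then 0 else undefined"
  have hA: "h i \<in> {1..k}" if "i \<in> ?A" for i using h that by (meson bij_betwE)
  have "bij_betw ?G {p. p permutes {1..k}} ?F"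
  proof (rule bij_betwI')
    fix p q assume p: "p \<in> {p. p permutes {1..k}}" and q: "q \<in> {p. p permutes {1..k}}"
    show "(?G p = ?G q) = (p = q)"
    proof
      assume eq: "?G p = ?G q"
      have "p j = q j" for j
      proof (cases "j \<in> {1..k}")
        case True
        then obtain i where i: "i \<in> ?A" "j = h i" using h by (metis bij_betw_imp_surj_on imageE)
        have "?G p i = ?G q i" using eq by (rule fun_cong)
        thus ?thesis using i by simp
      qed (use p q in \<open>simp add: permutes_def\<close>)
      thus "p = q" by blast
    qed (simp only:)
  next
    fix p assume "p \<in> {p. p permutes {1..k}}"
    hence p: "p permutes {1..k}" by simp
    have pk: "p (h i) \<in> {1..k}" if "i \<in> ?A" for i
      using hA[OF that] permutes_in_image[OF p] by blast
    have zero: "{i\<in>{1..m}. ?G p i = 0} = B"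
    proof (intro equalityI subsetI)
      fix i assume i: "i \<in> {i\<in>{1..m}. ?G p i = 0}"
      show "i \<in> B"
      proof (rule ccontr)
        assume "i \<notin> B"
        hence "i \<in> ?A" using i by blast
        thus False using i pk[of i] by simp
      qed
    qed (use B(1) in auto)
    have "bij_betw (p \<circ> h) ?A {1..k}"
      using h permutes_imp_bij[OF p] by (rule bij_betw_trans)
    hence "bij_betw (?G p) ?A {1..k}"
      by (rule iffD1[OF bij_betw_cong, rotated]) simp
    moreover have "?G p \<in> PiE {1..m} (\<lambda>_. {0..k})"
      using pk B(1) by (auto simp: PiE_iff extensional_def)
    ultimately have "?G p \<in> placements m k"
      by (intro placementsI) (simp_all only: zero)
    thus "?G p \<in> ?F" using zero by blast
  next
    fix \<phi> assume "\<phi> \<in> ?F"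
    hence \<phi>: "\<phi> \<in> placements m k" "{i\<in>{1..m}. \<phi> i = 0} = B" by auto
    have b: "bij_betw \<phi> ?A {1..k}" using placements_bij_betw[OF \<phi>(1)] by (simp only: \<phi>(2))
    define p where "p j = (if j \<in> {1..k} then \<phi> (inv_into ?A h j) else j)" for j
    have "bij_betw (\<phi> \<circ> inv_into ?A h) {1..k} {1..k}"
      using bij_betw_inv_into[OF h] b by (rule bij_betw_trans)
    hence "bij_betw p {1..k} {1..k}"
      by (rule iffD1[OF bij_betw_cong, rotated]) (simp add: p_def)
    hence p: "p permutes {1..k}" by (rule bij_imp_permutes) (auto simp: p_def)
    have "\<phi> i = ?G p i" for i
    proof -
      consider "i \<in> ?A" | "i \<in> B" | "i \<notin> {1..m}" by blast
      thus ?thesis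
      proof cases
        case 1
        thus ?thesis using hA[OF 1] bij_betw_inv_into_left[OF h 1] by (simp add: p_def)
      next
        case 2
        thus ?thesis using \<phi>(2) by auto
      next
        case 3
        thus ?thesis using \<phi>(1) B(1) by (auto simp: placements_def PiE_iff extensional_def)
      qed
    qed
    hence "\<phi> = ?G p" by blast
    thus "\<exists>p\<in>{p. p permutes {1..k}}. \<phi> = ?G p" using p by blast
  qed
  hence "card ?F = card {p. p permutes {1..k}}" by (rule bij_betw_same_card[symmetric])
  thus ?thesis by (simp add: card_permutations)
qed

lemma sum_placements:
  assumes km: "k \<le> m"
  shows "(\<Sum>\<phi>\<in>placements m k. \<Prod>i | i \<in> {1..m} \<and> \<phi> i = 0. q i) = fact k * elem_sym_fun m (m - k) q"
proof -
  let ?B = "\<lambda>\<phi>. {i\<in>{1..m}. \<phi> i = 0}"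
  let ?S = "{B. B \<subseteq> {1..m} \<and> card B = m - k}"
  have sub: "?B ` placements m k \<subseteq> ?S"
  proof
    fix B assume "B \<in> ?B ` placements m k"
    then obtain \<phi> where \<phi>: "\<phi> \<in> placements m k" "B = ?B \<phi>" by auto
    have "card ({1..m} - B) = k" using bij_betw_same_card[OF placements_bij_betw[OF \<phi>(1)]] \<phi>(2) by simp
    moreover have "card ({1..m} - B) = m - card B" "card B \<le> m"
      using \<phi>(2) card_mono[of "{1..m}" B] card_Diff_subset[of B "{1..m}"] finite_subset[of B "{1..m}"]
      by force+
    ultimately show "B \<in> ?S" using \<phi>(2) by auto
  qed
  have fS: "finite ?S" by (rule finite_subset[of _ "Pow {1..m}"]) auto
  have "(\<Sum>\<phi>\<in>placements m k. prod q (?B \<phi>)) =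
      (\<Sum>B\<in>?S. \<Sum>\<phi> | \<phi> \<in> placements m k \<and> ?B \<phi> = B. prod q (?B \<phi>))"
    using sum.group[OF finite_placements fS sub, of "\<lambda>\<phi>. prod q (?B \<phi>)"] by simp
  also have "\<dots> = (\<Sum>B\<in>?S. fact k * prod q B)"
  proof (rule sum.cong[OF refl])
    fix B assume B: "B \<in> ?S"
    have "(\<Sum>\<phi> | \<phi> \<in> placements m k \<and> ?B \<phi> = B. prod q (?B \<phi>)) =
       (\<Sum>\<phi> | \<phi> \<in> placements m k \<and> ?B \<phi> = B. prod q B)"
      by (rule sum.cong) auto
    also have "\<dots> = real (card {\<phi> \<in> placements m k. ?B \<phi> = B}) * prod q B" by simp
    finally show "(\<Sum>\<phi> | \<phi> \<in> placements m k \<and> ?B \<phi> = B. prod q (?B \<phi>)) = fact k * prod q B"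
      using B km by (simp only: card_placements_with_rest mem_Collect_eq of_nat_fact)
  qed
  finally show ?thesis by (simp add: elem_sym_fun_def sum_distrib_left)
qed

lemma placements_permute:
  assumes \<sigma>: "\<sigma> permutes {1..m}"
  shows "bij_betw (\<lambda>\<phi>. \<phi> \<circ> \<sigma>) (placements m k) (placements m k)"
proof -
  have *: "\<phi> \<circ> \<rho> \<in> placements m k" if "\<phi> \<in> placements m k" and \<rho>: "\<rho> permutes {1..m}" for \<phi> \<rho>
  proof -
    have \<phi>: "\<phi> \<in> PiE {1..m} (\<lambda>_. {0..k})" "\<And>j. j \<in> {1..k} \<Longrightarrow> card {i\<in>{1..m}. \<phi> i = j} = 1"
      using that by (auto simp: placements_def)
    have "\<phi> \<circ> \<rho> \<in> PiE {1..m} (\<lambda>_. {0..k})"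
    proof (rule PiE_I)
      fix x assume "x \<in> {1..m}"
      hence "\<rho> x \<in> {1..m}" using permutes_in_image[OF \<rho>] by blast
      thus "(\<phi> \<circ> \<rho>) x \<in> {0..k}" using PiE_mem[OF \<phi>(1)] by simp
    next
      fix x assume "x \<notin> {1..m}"
      thus "(\<phi> \<circ> \<rho>) x = undefined" using permutes_not_in[OF \<rho>] PiE_arb[OF \<phi>(1)] by simp
    qed
    moreover have "card {i\<in>{1..m}. (\<phi> \<circ> \<rho>) i = j} = 1" if j: "j \<in> {1..k}" for j
    proof -
      have "\<rho> ` {i\<in>{1..m}. (\<phi> \<circ> \<rho>) i = j} = {i\<in>{1..m}. \<phi> i = j}"
      proof (intro equalityI subsetI)
        fix x assume "x \<in> {i\<in>{1..m}. \<phi> i = j}"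
        thus "x \<in> \<rho> ` {i\<in>{1..m}. (\<phi> \<circ> \<rho>) i = j}"
          using permutes_inverses(1)[OF \<rho>] permutes_in_image[OF permutes_inv[OF \<rho>], of x]
          by (intro image_eqI[of _ _ "inv \<rho> x"]) auto
      qed (use permutes_in_image[OF \<rho>] in auto)
      thus ?thesis using \<phi>(2)[OF j] card_image[OF inj_on_subset[OF permutes_inj[OF \<rho>] subset_UNIV]] by metis
    qed
    ultimately show ?thesis by (simp add: placements_def)
  qed
  show ?thesis
  proof (rule bij_betwI[where g = "\<lambda>\<phi>. \<phi> \<circ> inv \<sigma>"])
    show "(\<lambda>\<phi>. \<phi> \<circ> \<sigma>) \<in> placements m k \<rightarrow> placements m k" using * \<sigma> by auto
    show "(\<lambda>\<phi>. \<phi> \<circ> inv \<sigma>) \<in> placements m k \<rightarrow> placements m k" using * permutes_inv[OF \<sigma>] by auto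
  qed (simp_all add: comp_assoc permutes_inv_o[OF \<sigma>])
qed

context based_tensor_power
begin

lemma tensor_ops_pencil_expansion:
  fixes Y :: "nat \<Rightarrow> 'v \<Rightarrow>\<^sub>L 'v"
  assumes Y: "\<And>j. Y j \<in> clinear_ops"
  shows "tensor_op \<tau> (Y 0 + (\<Sum>j\<in>{1..k}. t j *\<^sub>R Y j)) =
    (\<Sum>\<phi>\<in>PiE {1..m} (\<lambda>_. {0..k}). (\<Prod>j\<in>{1..k}. t j ^ card {i\<in>{1..m}. \<phi> i = j}) *\<^sub>R
       tensor_ops \<tau> (\<lambda>i. Y (\<phi> i)))"
proof -
  let ?\<Phi> = "PiE {1..m} (\<lambda>_. {0..k})"
  let ?T = "Y 0 + (\<Sum>j\<in>{1..k}. t j *\<^sub>R Y j)"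
  let ?c = "\<lambda>j. if j = 0 then 1 else t j"
  have T: "?T \<in> clinear_ops" by (intro clinear_ops_add clinear_ops_sum clinear_ops_scaleR Y)
  have T_eq: "blinfun_apply ?T x = (\<Sum>j\<in>{0..k}. complex_of_real (?c j) *\<^sub>C Y j x)" for x
  proof -
    have "{0..k} = insert 0 {1..k}" by auto
    hence "(\<Sum>j\<in>{0..k}. complex_of_real (?c j) *\<^sub>C Y j x) =
        Y 0 x + (\<Sum>j\<in>{1..k}. complex_of_real (?c j) *\<^sub>C Y j x)"
      by (simp add: scaleC_one)
    also have "(\<Sum>j\<in>{1..k}. complex_of_real (?c j) *\<^sub>C Y j x) =
        (\<Sum>j\<in>{1..k}. complex_of_real (t j) *\<^sub>C Y j x)"
      by (rule sum.cong) auto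
    finally show ?thesis
      by (simp add: blinfun.add_left blinfun.sum_left blinfun.scaleR_left scaleR_scaleC)
  qed
  have pow: "(\<Prod>i\<in>{1..m}. ?c (\<phi> i)) = (\<Prod>j\<in>{1..k}. t j ^ card {i\<in>{1..m}. \<phi> i = j})"
    if "\<phi> \<in> ?\<Phi>" for \<phi>
  proof -
    have "(\<Prod>i\<in>{1..m}. ?c (\<phi> i)) = (\<Prod>j\<in>{0..k}. \<Prod>i\<in>{i\<in>{1..m}. \<phi> i = j}. ?c (\<phi> i))"
      using PiE_mem[OF that] by (intro prod.group[symmetric]) auto
    also have "\<dots> = (\<Prod>j\<in>{0..k}. ?c j ^ card {i\<in>{1..m}. \<phi> i = j})"
      by (rule prod.cong) auto
    also have "\<dots> = (\<Prod>j\<in>{1..k}. ?c j ^ card {i\<in>{1..m}. \<phi> i = j})"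
      by (rule prod.mono_neutral_right) auto
    also have "\<dots> = (\<Prod>j\<in>{1..k}. t j ^ card {i\<in>{1..m}. \<phi> i = j})"
      by (rule prod.cong) auto
    finally show ?thesis .
  qed
  have R: "(\<Sum>\<phi>\<in>?\<Phi>. (\<Prod>j\<in>{1..k}. t j ^ card {i\<in>{1..m}. \<phi> i = j}) *\<^sub>R tensor_ops \<tau> (\<lambda>i. Y (\<phi> i))) \<in> clinear_ops"
    by (intro clinear_ops_sum clinear_ops_scaleR tensor_ops_props Y)
  show ?thesis
  proof (rule tensor_op_eqI)
    show "tensor_op \<tau> ?T \<in> clinear_ops"
      unfolding tensor_op_eq_tensor_ops by (intro tensor_ops_props T)
    fix v
    have "blinfun_apply (tensor_op \<tau> ?T) (\<tau> v) = \<tau> (\<lambda>i. blinfun_apply ?T (v i))"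
      unfolding tensor_op_eq_tensor_ops by (intro tensor_ops_props T)
    also have "\<dots> = \<tau> (\<lambda>i. if i \<in> {1..m} then
        \<Sum>j\<in>{0..k}. complex_of_real (?c j) *\<^sub>C Y j (v i) else v i)"
      by (rule cmultilinear_cong[OF multilinear]) (simp only: T_eq if_True)
    also have "\<dots> = (\<Sum>\<phi>\<in>?\<Phi>. (\<Prod>i\<in>{1..m}. complex_of_real (?c (\<phi> i))) *\<^sub>C
        \<tau> (\<lambda>i. if i \<in> {1..m} then Y (\<phi> i) (v i) else v i))"
      by (rule cmultilinear_expand[OF multilinear]) auto
    also have "\<dots> = (\<Sum>\<phi>\<in>?\<Phi>. (\<Prod>j\<in>{1..k}. t j ^ card {i\<in>{1..m}. \<phi> i = j}) *\<^sub>R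
        blinfun_apply (tensor_ops \<tau> (\<lambda>i. Y (\<phi> i))) (\<tau> v))"
    proof (rule sum.cong[OF refl])
      fix \<phi> assume \<phi>: "\<phi> \<in> ?\<Phi>"
      have "\<tau> (\<lambda>i. if i \<in> {1..m} then Y (\<phi> i) (v i) else v i) =
          blinfun_apply (tensor_ops \<tau> (\<lambda>i. Y (\<phi> i))) (\<tau> v)"
        unfolding tensor_ops_props(2)[of "\<lambda>i. Y (\<phi> i)", OF Y]
        by (rule cmultilinear_cong[OF multilinear]) auto
      thus "(\<Prod>i\<in>{1..m}. complex_of_real (?c (\<phi> i))) *\<^sub>C
          \<tau> (\<lambda>i. if i \<in> {1..m} then Y (\<phi> i) (v i) else v i) =
        (\<Prod>j\<in>{1..k}. t j ^ card {i\<in>{1..m}. \<phi> i = j}) *\<^sub>R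
          blinfun_apply (tensor_ops \<tau> (\<lambda>i. Y (\<phi> i))) (\<tau> v)"
        by (simp only: of_real_prod[symmetric] pow[OF \<phi>] scaleR_scaleC)
    qed
    also have "\<dots> = blinfun_apply (\<Sum>\<phi>\<in>?\<Phi>. (\<Prod>j\<in>{1..k}. t j ^ card {i\<in>{1..m}. \<phi> i = j}) *\<^sub>R
        tensor_ops \<tau> (\<lambda>i. Y (\<phi> i))) (\<tau> v)"
      by (simp only: blinfun.sum_left blinfun.scaleR_left)
    finally show "blinfun_apply (tensor_op \<tau> ?T) (\<tau> v) =
      blinfun_apply (\<Sum>\<phi>\<in>?\<Phi>. (\<Prod>j\<in>{1..k}. t j ^ card {i\<in>{1..m}. \<phi> i = j}) *\<^sub>R
        tensor_ops \<tau> (\<lambda>i. Y (\<phi> i))) (\<tau> v)" .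
  qed (rule R)
qed

text \<open>The pencil \<open>Y 0 + \<Sum>j. t j *\<^sub>R Y j\<close> is mapped to a polynomial in \<open>t\<close>, and the mixed
  partial derivative at \<open>0\<close> is its coefficient at the monomial \<open>t 1 * \<dots> * t k\<close>.\<close>

lemma higher_deriv_tensor_op:
  assumes Y: "\<And>j. Y j \<in> clinear_ops"
  shows "higher_deriv k (\<lambda>A. tensor_op \<tau> A o\<^sub>L P) (Y 0) Y =
    (\<Sum>\<phi>\<in>placements m k. tensor_ops \<tau> (\<lambda>i. Y (\<phi> i))) o\<^sub>L P"
proof -
  let ?\<Phi> = "PiE {1..m} (\<lambda>_. {0..k})"
  let ?a = "\<lambda>\<phi> j. card {i\<in>{1..m}. \<phi> i = j}"
  let ?C = "\<lambda>\<phi>. tensor_ops \<tau> (\<lambda>i. Y (\<phi> i)) o\<^sub>L P"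
  have fin: "finite ?\<Phi>" by (simp add: finite_PiE)
  have "(\<lambda>t. tensor_op \<tau> (Y 0 + (\<Sum>j\<in>{1..k}. t j *\<^sub>R Y j)) o\<^sub>L P) =
     (\<lambda>t. \<Sum>\<phi>\<in>?\<Phi>. (\<Prod>j\<in>{1..k}. t j ^ ?a \<phi> j) *\<^sub>R ?C \<phi>)"
    by (intro ext blinfun_eqI) (simp only: tensor_ops_pencil_expansion[of Y, OF Y] blinfun.sum_left
        blinfun.scaleR_left blinfun_apply_blinfun_compose)
  hence "higher_deriv k (\<lambda>A. tensor_op \<tau> A o\<^sub>L P) (Y 0) Y =
     mixed_partial k (\<lambda>t. \<Sum>\<phi>\<in>?\<Phi>. (\<Prod>j\<in>{1..k}. t j ^ ?a \<phi> j) *\<^sub>R ?C \<phi>) (\<lambda>_. 0)"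
    by (simp add: higher_deriv_def)
  also have "\<dots> = (\<Sum>\<phi>\<in>?\<Phi>. (\<Prod>j\<in>{1..k}. if j \<le> k then real (?a \<phi> j) * 0 ^ (?a \<phi> j - 1) else 0 ^ ?a \<phi> j) *\<^sub>R ?C \<phi>)"
    by (subst mixed_partial_separated_sum[where h = "\<lambda>\<phi> j s. s ^ ?a \<phi> j"
          and h' = "\<lambda>\<phi> j s. real (?a \<phi> j) * s ^ (?a \<phi> j - 1)"])
      (auto intro!: derivative_eq_intros)
  also have "\<dots> = (\<Sum>\<phi>\<in>?\<Phi>. if \<forall>j\<in>{1..k}. ?a \<phi> j = 1 then ?C \<phi> else 0)"
  proof (rule sum.cong[OF refl])
    fix \<phi>
    \<comment> \<open>The derivative of \<open>s ^ a\<close> at \<open>0\<close>; for \<open>a = 0\<close> the first factor vanishes.\<close>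
    have z: "real a * 0 ^ (a - 1) = (if a = 1 then 1 else 0)" for a :: nat
      by (cases a) auto
    have "(\<Prod>j\<in>{1..k}. if j \<le> k then real (?a \<phi> j) * 0 ^ (?a \<phi> j - 1) else 0 ^ ?a \<phi> j) =
       (\<Prod>j\<in>{1..k}. if ?a \<phi> j = 1 then 1 else (0::real))"
    proof (rule prod.cong[OF refl])
      fix j assume "j \<in> {1..k}"
      hence "(j \<le> k) = True" by simp
      thus "(if j \<le> k then real (?a \<phi> j) * 0 ^ (?a \<phi> j - 1) else 0 ^ ?a \<phi> j) =
        (if ?a \<phi> j = 1 then 1 else (0::real))" by (simp only: if_True z)
    qed
    also have "\<dots> = (if \<forall>j\<in>{1..k}. ?a \<phi> j = 1 then 1 else 0)"
    proof (cases "\<forall>j\<in>{1..k}. ?a \<phi> j = 1")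
      case True
      hence "(\<Prod>j\<in>{1..k}. if ?a \<phi> j = 1 then 1 else (0::real)) = 1" by (intro prod.neutral) auto
      thus ?thesis unfolding if_P[OF True] .
    next
      case False
      hence "\<exists>j\<in>{1..k}. (if ?a \<phi> j = 1 then 1 else (0::real)) = 0" by auto
      hence "(\<Prod>j\<in>{1..k}. if ?a \<phi> j = 1 then 1 else (0::real)) = 0" by (intro prod_zero) auto
      thus ?thesis unfolding if_not_P[OF False] .
    qed
    finally have "(\<Prod>j\<in>{1..k}. if j \<le> k then real (?a \<phi> j) * 0 ^ (?a \<phi> j - 1) else 0 ^ ?a \<phi> j) =
      (if \<forall>j\<in>{1..k}. ?a \<phi> j = 1 then 1 else 0)" .
    thus "(\<Prod>j\<in>{1..k}. if j \<le> k then real (?a \<phi> j) * 0 ^ (?a \<phi> j - 1) else 0 ^ ?a \<phi> j) *\<^sub>R ?C \<phi> =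
      (if \<forall>j\<in>{1..k}. ?a \<phi> j = 1 then ?C \<phi> else 0)" by (simp only: if_distrib[of "\<lambda>x. x *\<^sub>R _"] scaleR_one scaleR_zero_left)
  qed
  also have "\<dots> = (\<Sum>\<phi>\<in>placements m k. ?C \<phi>)"
    unfolding placements_def using fin by (simp only: sum.inter_filter)
  also have "\<dots> = (\<Sum>\<phi>\<in>placements m k. tensor_ops \<tau> (\<lambda>i. Y (\<phi> i))) o\<^sub>L P"
    by (intro blinfun_eqI) (simp add: blinfun.sum_left)
  finally show ?thesis .
qed

end

section \<open>Traces on subspaces\<close>

context vector_space
begin

text \<open>The trace is defined in a basis that is chosen once, but it does not depend on it: in a
  pair of bases both traces are equal to the same double sum of products of coefficients.\<close>

lemma trace_on_basis:
  assumes B: "independent B" "span B = S" "finite B"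
    and f: "Vector_Spaces.linear scale scale f" "\<And>x. x \<in> S \<Longrightarrow> f x \<in> S"
  shows "trace_on S f = (\<Sum>b\<in>B. representation B (f b) b)"
proof -
  interpret f: Vector_Spaces.linear scale scale f by (rule f(1))
  define D where "D = (SOME B. independent B \<and> span B = S)"
  have D: "independent D" "span D = S"
    using someI[of "\<lambda>B. independent B \<and> span B = S" B] B by (auto simp: D_def)
  have finD: "finite D"
    using independent_span_bound[OF B(3) D(1)] D(2) B(2) span_superset[of D] by auto
  have BS: "b \<in> S" if "b \<in> B" for b using that B(2) span_superset[of B] by auto
  have DS: "d \<in> S" if "d \<in> D" for d using that D(2) span_superset[of D] by auto
  have expand: "representation B' (f x) y = (\<Sum>a\<in>A. representation A x a * representation B' (f a) y)"
    if A: "independent A" "span A = S" "finite A" and B': "independent B'" "span B' = S" and x: "x \<in> S"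
    for A B' x y
  proof -
    have AS: "a \<in> S" if "a \<in> A" for a using that A(2) span_superset[of A] by auto
    have "f x = f (\<Sum>a\<in>A. scale (representation A x a) a)"
      using sum_representation_eq[OF A(1) _ A(3) subset_refl] x A(2) by simp
    also have "\<dots> = (\<Sum>a\<in>A. scale (representation A x a) (f a))"
      by (simp add: f.sum f.scale)
    moreover have mem: "scale (representation A x a) (f a) \<in> span B'" if "a \<in> A" for a
      using f(2)[OF AS[OF that]] B'(2) by (blast intro: span_scale)
    ultimately have "representation B' (f x) y =
       (\<Sum>a\<in>A. representation B' (scale (representation A x a) (f a)) y)"
      by (simp add: representation_sum[OF B'(1) mem])
    also have "\<dots> = (\<Sum>a\<in>A. representation A x a * representation B' (f a) y)"
      using AS f(2) B' by (intro sum.cong refl) (simp add: representation_scale)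
    finally show ?thesis .
  qed
  have diag: "(\<Sum>a\<in>A. representation A (f a) a) =
      (\<Sum>a\<in>A. \<Sum>b\<in>B'. representation B' (f a) b * representation A b a)"
    if A: "independent A" "span A = S" and B': "independent B'" "span B' = S" "finite B'"
    for A B'
  proof (rule sum.cong[OF refl])
    fix a assume "a \<in> A"
    hence fa: "f a \<in> S" using A(2) span_superset[of A] f(2) by auto
    have B'S: "b \<in> S" if "b \<in> B'" for b using that B'(2) span_superset[of B'] by auto
    have "f a = (\<Sum>b\<in>B'. scale (representation B' (f a) b) b)"
      using sum_representation_eq[OF B'(1) _ B'(3) subset_refl] fa B'(2) by simp
    hence "representation A (f a) a = representation A (\<Sum>b\<in>B'. scale (representation B' (f a) b) b) a"
      by (rule arg_cong)
    also have "\<dots> = (\<Sum>b\<in>B'. representation A (scale (representation B' (f a) b) b) a)"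
      using B'S A by (subst representation_sum) (auto intro!: span_scale)
    also have "\<dots> = (\<Sum>b\<in>B'. representation B' (f a) b * representation A b a)"
      using B'S A by (intro sum.cong refl) (simp add: representation_scale)
    finally show "representation A (f a) a = (\<Sum>b\<in>B'. representation B' (f a) b * representation A b a)" .
  qed
  have "(\<Sum>b\<in>B. representation B (f b) b) = (\<Sum>b\<in>B. \<Sum>d\<in>D. representation D (f b) d * representation B d b)"
    by (rule diag[OF B(1,2) D finD])
  also have "\<dots> = (\<Sum>d\<in>D. \<Sum>b\<in>B. representation B d b * representation D (f b) d)"
    by (subst sum.swap) (simp add: mult.commute)
  also have "\<dots> = (\<Sum>d\<in>D. representation D (f d) d)"
    by (intro sum.cong refl expand[OF B D, symmetric] DS)
  finally show ?thesis by (simp add: trace_on_def D_def[symmetric])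
qed

lemma subspace_finite_basis:
  assumes "subspace S" "S \<subseteq> span F" "finite F" "A \<subseteq> S" "independent A"
  shows "\<exists>B. A \<subseteq> B \<and> independent B \<and> span B = S \<and> finite B"
proof -
  obtain B where B: "A \<subseteq> B" "B \<subseteq> S" "independent B" "S \<subseteq> span B"
    using maximal_independent_subset_extend[OF assms(4,5)] by metis
  moreover have "span B = S" using B(2,4) assms(1) span_minimal by blast
  moreover have "finite B" using independent_span_bound[OF assms(3) B(3)] B(2) assms(2) by auto
  ultimately show ?thesis by blast
qed

lemma trace_on_sum:
  assumes S: "subspace S" "S \<subseteq> span F" "finite F"
    and f: "\<And>h. h \<in> H \<Longrightarrow> Vector_Spaces.linear scale scale (f h)"
      "\<And>h x. h \<in> H \<Longrightarrow> x \<in> S \<Longrightarrow> f h x \<in> S"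
    and g: "Vector_Spaces.linear scale scale g" "\<And>x. x \<in> S \<Longrightarrow> g x = (\<Sum>h\<in>H. f h x)"
  shows "(\<Sum>h\<in>H. trace_on S (f h)) = trace_on S g"
proof -
  obtain B where B: "independent B" "span B = S" "finite B"
    using subspace_finite_basis[OF S empty_subsetI independent_empty] by blast
  have BS: "b \<in> S" if "b \<in> B" for b using that B(2) span_superset[of B] by auto
  have "(\<Sum>h\<in>H. trace_on S (f h)) = (\<Sum>h\<in>H. \<Sum>b\<in>B. representation B (f h b) b)"
    by (intro sum.cong refl trace_on_basis[OF B] f)
  also have "\<dots> = (\<Sum>b\<in>B. \<Sum>h\<in>H. representation B (f h b) b)"
    by (rule sum.swap)
  also have "\<dots> = (\<Sum>b\<in>B. representation B (g b) b)"
    using BS f(2) B by (intro sum.cong refl) (simp add: g(2) representation_sum)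
  also have "\<dots> = trace_on S g"
    using g f(2) S(1) by (intro trace_on_basis[OF B, symmetric]) (auto intro!: subspace_sum)
  finally show ?thesis .
qed

lemma trace_on_eq_zero:
  assumes S: "subspace S" "S \<subseteq> span F" "finite F"
    and f: "Vector_Spaces.linear scale scale f" "\<And>x. x \<in> S \<Longrightarrow> f x = 0"
  shows "trace_on S f = 0"
proof -
  obtain B where B: "independent B" "span B = S" "finite B"
    using subspace_finite_basis[OF S empty_subsetI independent_empty] by blast
  have "b \<in> S" if "b \<in> B" for b using that B(2) span_superset[of B] by auto
  thus ?thesis
    using trace_on_basis[OF B f(1)] f(2) subspace_0[OF S(1)] by (simp add: representation_zero)
qed

text \<open>In a basis of \<open>S\<close> extending one of \<open>f ` S\<close>, a scaled idempotent \<open>f\<close> has diagonal entry \<open>c\<close> at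
  the vectors of \<open>f ` S\<close> and \<open>0\<close> at the others, so its trace is \<open>c\<close> times its rank.\<close>

lemma trace_on_scaled_idempotent:
  assumes S: "subspace S" "S \<subseteq> span F" "finite F"
    and f: "Vector_Spaces.linear scale scale f" "\<And>x. x \<in> S \<Longrightarrow> f x \<in> S"
      "\<And>x. x \<in> S \<Longrightarrow> f (f x) = scale c (f x)"
    and x: "x \<in> S" "f x \<noteq> 0"
  shows "\<exists>d>0. trace_on S f = of_nat d * c"
proof -
  interpret f: Vector_Spaces.linear scale scale f by (rule f(1))
  have E: "subspace (f ` S)" by (rule f.subspace_image[OF S(1)])
  have ES: "f ` S \<subseteq> S" using f(2) by auto
  obtain A where A: "independent A" "span A = f ` S"
    using subspace_finite_basis[OF E _ S(3) empty_subsetI independent_empty] ES S(2) by blast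
  have AE: "A \<subseteq> f ` S" using A(2) span_superset[of A] by auto
  obtain B where B: "A \<subseteq> B" "independent B" "span B = S" "finite B"
    using subspace_finite_basis[OF S _ A(1)] AE ES by blast
  have diag: "representation B (f b) b = (if b \<in> A then c else 0)" if b: "b \<in> B" for b
  proof (cases "b \<in> A")
    case True
    then obtain y where "y \<in> S" "b = f y" using AE by auto
    hence "f b = scale c b" using f(3) by simp
    thus ?thesis using True b B span_superset[of B]
      by (auto simp: representation_scale representation_basis)
  next
    case False
    have "b \<in> S" using b B(3) span_superset[of B] by auto
    hence "representation B (f b) = representation A (f b)"
      using A B by (intro representation_extend) auto
    thus ?thesis using False representation_ne_zero[of A "f b" b] by auto
  qed
  have "A \<noteq> {}" using A(2) x by auto
  hence "card A > 0" using B(1,4) finite_subset[of A B] by (auto simp: card_gt_0_iff)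
  moreover have "trace_on S f = of_nat (card A) * c"
    using trace_on_basis[OF B(2-4) f(1,2)] diag B(1,4) by (simp add: sum.If_cases Int_absorb1)
  ultimately show ?thesis by blast
qed

end

section \<open>Row and column groups\<close>

lemma tableau_row_col_inj:
  assumes i: "i \<in> {1..m}" and j: "j \<in> {1..m}"
    and eq: "tableau_row \<pi> i = tableau_row \<pi> j" "tableau_col \<pi> i = tableau_col \<pi> j"
  shows "i = j"
proof -
  have less: "tableau_col \<pi> i < tableau_col \<pi> j" if "i < j" "1 \<le> j" "tableau_row \<pi> i = tableau_row \<pi> j" for i j
  proof -
    have "j \<in> {k\<in>{1..j}. tableau_row \<pi> k = tableau_row \<pi> j}"
      "j \<notin> {k\<in>{1..i}. tableau_row \<pi> k = tableau_row \<pi> i}" using that by auto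
    moreover have "{k\<in>{1..i}. tableau_row \<pi> k = tableau_row \<pi> i} \<subseteq>
        {k\<in>{1..j}. tableau_row \<pi> k = tableau_row \<pi> j}" using that by auto
    ultimately show ?thesis
      unfolding tableau_col_def by (intro psubset_card_mono psubsetI) (simp, assumption, blast)
  qed
  show ?thesis using less[of i j] less[of j i] i j eq by (cases i j rule: linorder_cases) auto
qed

lemma row_group_col_group_trivial:
  assumes "p \<in> row_group m \<pi>" "p \<in> col_group m \<pi>"
  shows "p = id"
proof
  fix i
  have p: "p permutes {1..m}" using assms by (simp add: row_group_def)
  show "p i = id i"
  proof (cases "i \<in> {1..m}")
    case True
    hence "p i \<in> {1..m}" using permutes_in_image[OF p] by blast
    thus ?thesis using True assms tableau_row_col_inj[of "p i" m i \<pi>]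
      by (auto simp: row_group_def col_group_def)
  qed (use permutes_not_in[OF p] in auto)
qed

text \<open>The row group, the column group and the stabilizers of multi-indices are all of this form.\<close>

definition label_stabilizer :: "nat \<Rightarrow> (nat \<Rightarrow> nat) \<Rightarrow> (nat \<Rightarrow> nat) set" where
  "label_stabilizer m \<alpha> = {p. p permutes {1..m} \<and> (\<forall>i\<in>{1..m}. \<alpha> (p i) = \<alpha> i)}"

lemma row_group_eq: "row_group m \<pi> = label_stabilizer m (tableau_row \<pi>)"
  by (simp add: row_group_def label_stabilizer_def)

lemma col_group_eq: "col_group m \<pi> = label_stabilizer m (tableau_col \<pi>)"
  by (simp add: col_group_def label_stabilizer_def)

lemma label_stabilizer_permutes: "p \<in> label_stabilizer m \<alpha> \<Longrightarrow> p permutes {1..m}"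
  by (simp add: label_stabilizer_def)

lemma finite_label_stabilizer [simp]: "finite (label_stabilizer m \<alpha>)"
  by (rule finite_subset[of _ "{p. p permutes {1..m}}"]) (auto simp: label_stabilizer_def finite_permutations)

lemma id_label_stabilizer [simp]: "id \<in> label_stabilizer m \<alpha>"
  by (simp add: label_stabilizer_def permutes_id)

lemma label_stabilizer_comp:
  assumes "p \<in> label_stabilizer m \<alpha>" "q \<in> label_stabilizer m \<alpha>"
  shows "p \<circ> q \<in> label_stabilizer m \<alpha>"
  using assms permutes_in_image[of q "{1..m}"] unfolding label_stabilizer_def
  by (auto intro: permutes_compose simp del: atLeastAtMost_iff)

lemma label_stabilizer_inv:
  assumes p: "p \<in> label_stabilizer m \<alpha>"
  shows "inv p \<in> label_stabilizer m \<alpha>"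
proof -
  have p': "p permutes {1..m}" using p by (rule label_stabilizer_permutes)
  have "\<alpha> (inv p i) = \<alpha> i" if "i \<in> {1..m}" for i
  proof -
    have "inv p i \<in> {1..m}" using permutes_in_image[OF permutes_inv[OF p']] that by blast
    hence "\<alpha> (p (inv p i)) = \<alpha> (inv p i)" using p by (simp add: label_stabilizer_def)
    thus ?thesis by (simp add: permutes_inverses[OF p'])
  qed
  thus ?thesis using permutes_inv[OF p'] by (simp add: label_stabilizer_def)
qed

lemma label_stabilizer_transpose:
  assumes "i \<in> {1..m}" "j \<in> {1..m}" "\<alpha> i = \<alpha> j"
  shows "Transposition.transpose i j \<in> label_stabilizer m \<alpha>"
  using assms permutes_swap_id[of i "{1..m}" j] by (auto simp: label_stabilizer_def Transposition.transpose_def)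

lemma label_stabilizer_comp_iff:
  assumes t: "t \<in> label_stabilizer m \<alpha>"
  shows "t \<circ> u \<in> label_stabilizer m \<alpha> \<longleftrightarrow> u \<in> label_stabilizer m \<alpha>"
proof
  assume "t \<circ> u \<in> label_stabilizer m \<alpha>"
  hence "inv t \<circ> (t \<circ> u) \<in> label_stabilizer m \<alpha>"
    by (rule label_stabilizer_comp[OF label_stabilizer_inv[OF t]])
  moreover have "inv t \<circ> (t \<circ> u) = u"
    by (simp add: fun_eq_iff permutes_inverses[OF label_stabilizer_permutes[OF t]])
  ultimately show "u \<in> label_stabilizer m \<alpha>" by (simp only:)
qed (rule label_stabilizer_comp[OF t])

lemma sum_label_stabilizer_comp_right:
  assumes "s \<in> label_stabilizer m \<alpha>"
  shows "(\<Sum>h\<in>label_stabilizer m \<alpha>. f (h \<circ> s)) = (\<Sum>h\<in>label_stabilizer m \<alpha>. f h)"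
proof (rule sum.reindex_bij_witness[of _ "\<lambda>h. h \<circ> inv s" "\<lambda>h. h \<circ> s"])
  fix h assume "h \<in> label_stabilizer m \<alpha>"
  thus "h \<circ> s \<in> label_stabilizer m \<alpha>" "h \<circ> inv s \<in> label_stabilizer m \<alpha>"
    using assms by (auto intro: label_stabilizer_comp label_stabilizer_inv)
qed (simp_all add: comp_assoc permutes_inv_o[OF label_stabilizer_permutes[OF assms]])

section \<open>Characters of the symmetric group\<close>

lemma sum_galg_apply: "(\<Sum>i\<in>I. (F i :: galg)) p = (\<Sum>i\<in>I. F i p)"
  by (induction I rule: infinite_finite_induct) auto

lemma galg_mult_of:
  assumes "\<sigma> permutes {1..m}"
  shows "galg_mult m (galg_of \<sigma>) f = (\<lambda>p. f (inv \<sigma> \<circ> p))"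
proof
  fix p
  have "galg_mult m (galg_of \<sigma>) f p = (\<Sum>q\<in>{q. q permutes {1..m}}. if q = \<sigma> then f (inv q \<circ> p) else 0)"
    unfolding galg_mult_def galg_of_def by (intro sum.cong) auto
  thus "galg_mult m (galg_of \<sigma>) f p = f (inv \<sigma> \<circ> p)"
    using assms by (simp add: finite_permutations)
qed

lemma galg_mult_assoc: "galg_mult m (galg_mult m f g) h = galg_mult m f (galg_mult m g h)"
proof
  fix p
  let ?S = "{q. q permutes {1..m}}"
  have "galg_mult m (galg_mult m f g) h p = (\<Sum>r\<in>?S. \<Sum>q\<in>?S. f r * g (inv r \<circ> q) * h (inv q \<circ> p))"
    unfolding galg_mult_def by (subst sum.swap) (simp add: sum_distrib_right)
  also have "\<dots> = (\<Sum>r\<in>?S. f r * (\<Sum>s\<in>?S. g s * h (inv s \<circ> (inv r \<circ> p))))"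
  proof (rule sum.cong[OF refl])
    fix r assume "r \<in> ?S"
    hence r: "r permutes {1..m}" by simp
    have "(\<Sum>q\<in>?S. f r * g (inv r \<circ> q) * h (inv q \<circ> p)) =
       (\<Sum>s\<in>?S. f r * g (inv r \<circ> (r \<circ> s)) * h (inv (r \<circ> s) \<circ> p))"
      by (rule setum_permutations_compose_left[OF r])
    also have "\<dots> = (\<Sum>s\<in>?S. f r * (g s * h (inv s \<circ> (inv r \<circ> p))))"
    proof (rule sum.cong[OF refl])
      fix s assume "s \<in> ?S"
      hence s: "s permutes {1..m}" by simp
      have "inv (r \<circ> s) = inv s \<circ> inv r"
        by (rule o_inv_distrib) (use permutes_bij[OF r] permutes_bij[OF s] in auto)
      moreover have "inv r \<circ> (r \<circ> s) = s"
        by (simp add: comp_assoc[symmetric] permutes_inv_o[OF r])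
      ultimately show "f r * g (inv r \<circ> (r \<circ> s)) * h (inv (r \<circ> s) \<circ> p) = f r * (g s * h (inv s \<circ> (inv r \<circ> p)))"
        by (simp add: comp_assoc)
    qed
    finally show "(\<Sum>q\<in>?S. f r * g (inv r \<circ> q) * h (inv q \<circ> p)) =
       f r * (\<Sum>s\<in>?S. g s * h (inv s \<circ> (inv r \<circ> p)))"
      by (simp add: sum_distrib_left)
  qed
  finally show "galg_mult m (galg_mult m f g) h p = galg_mult m f (galg_mult m g h) p"
    by (simp add: galg_mult_def)
qed

lemma galg_mult_carrier:
  assumes "f \<in> galg_carrier m" "g \<in> galg_carrier m"
  shows "galg_mult m f g \<in> galg_carrier m"
  unfolding galg_carrier_def
proof (intro CollectI allI impI)
  fix p assume "galg_mult m f g p \<noteq> 0"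
  then obtain q where q: "q permutes {1..m}" "g (inv q \<circ> p) \<noteq> 0"
    unfolding galg_mult_def by (metis (mono_tags, lifting) mem_Collect_eq mult_zero_right sum.neutral)
  hence "inv q \<circ> p permutes {1..m}" using assms by (simp add: galg_carrier_def)
  from permutes_compose[OF this q(1)] show "p permutes {1..m}"
    by (simp add: comp_assoc[symmetric] permutes_inv_o[OF q(1)])
qed

lemma galg_of_carrier: "\<sigma> permutes {1..m} \<Longrightarrow> galg_of \<sigma> \<in> galg_carrier m"
  by (auto simp: galg_carrier_def galg_of_def)

lemma galg_mult_linear_right: "Vector_Spaces.linear galg_scale galg_scale (galg_mult m f)"
  by unfold_locales
    (simp_all add: galg_mult_def galg_scale_def fun_eq_iff algebra_simps sum.distrib sum_distrib_left)

lemma galg_mult_linear_left: "Vector_Spaces.linear galg_scale galg_scale (\<lambda>f. galg_mult m f g)"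
  by unfold_locales
    (simp_all add: galg_mult_def galg_scale_def fun_eq_iff algebra_simps sum.distrib sum_distrib_left)

lemma galg_carrier_subspace: "galg.subspace (galg_carrier m)"
  unfolding galg.subspace_def galg_carrier_def galg_scale_def
  by (auto, metis add.right_neutral add_0)

lemma galg_carrier_span:
  "galg_carrier m \<subseteq> galg.span (galg_of ` {p. p permutes {1..m}})"
proof
  fix f assume f: "f \<in> galg_carrier m"
  have "f = (\<Sum>q\<in>{q. q permutes {1..m}}. galg_scale (f q) (galg_of q))"
  proof
    fix p
    have "(\<Sum>q\<in>{q. q permutes {1..m}}. galg_scale (f q) (galg_of q)) p =
       (\<Sum>q\<in>{q. q permutes {1..m}}. if q = p then f q else 0)"
      unfolding sum_galg_apply by (rule sum.cong) (auto simp: galg_scale_def galg_of_def)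
    also have "\<dots> = f p" using f by (auto simp: finite_permutations galg_carrier_def)
    finally show "f p = (\<Sum>q\<in>{q. q permutes {1..m}}. galg_scale (f q) (galg_of q)) p" ..
  qed
  moreover have "(\<Sum>q\<in>{q. q permutes {1..m}}. galg_scale (f q) (galg_of q)) \<in> galg.span (galg_of ` {p. p permutes {1..m}})"
    by (rule galg.span_sum, rule galg.span_scale, rule galg.span_base) simp
  ultimately show "f \<in> galg.span (galg_of ` {p. p permutes {1..m}})" by simp
qed

lemma young_symmetrizer_carrier: "young_symmetrizer m \<pi> \<in> galg_carrier m"
  unfolding young_symmetrizer_def
  by (rule galg_mult_carrier) (auto simp: galg_carrier_def row_group_def col_group_def)

lemma specht_module_finite_dim:
  "galg.subspace (specht_module m \<pi>)"
  "specht_module m \<pi> \<subseteq> galg.span (galg_of ` {p. p permutes {1..m}})"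
proof -
  interpret l: Vector_Spaces.linear galg_scale galg_scale "\<lambda>f. galg_mult m f (young_symmetrizer m \<pi>)"
    by (rule galg_mult_linear_left)
  show "galg.subspace (specht_module m \<pi>)"
    unfolding specht_module_def by (rule l.subspace_image[OF galg_carrier_subspace])
  have "specht_module m \<pi> \<subseteq> galg_carrier m"
    unfolding specht_module_def by (auto intro: galg_mult_carrier young_symmetrizer_carrier)
  thus "specht_module m \<pi> \<subseteq> galg.span (galg_of ` {p. p permutes {1..m}})"
    using galg_carrier_span by blast
qed

lemma specht_module_left_ideal:
  assumes "f \<in> galg_carrier m" "x \<in> specht_module m \<pi>"
  shows "galg_mult m f x \<in> specht_module m \<pi>"
  using assms unfolding specht_module_def
  by (auto simp: galg_mult_assoc[symmetric] intro!: imageI galg_mult_carrier)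

lemma young_symmetrizer_in_specht_module: "young_symmetrizer m \<pi> \<in> specht_module m \<pi>"
proof -
  have "young_symmetrizer m \<pi> = galg_mult m (galg_of id) (young_symmetrizer m \<pi>)"
    by (simp add: galg_mult_of permutes_id)
  moreover have "galg_of id \<in> galg_carrier m" by (simp add: galg_of_carrier permutes_id)
  ultimately show ?thesis unfolding specht_module_def by blast
qed

definition galg_indicator :: "(nat \<Rightarrow> nat) set \<Rightarrow> galg" where
  "galg_indicator H = (\<lambda>p. if p \<in> H then 1 else 0)"

lemma galg_indicator_mult:
  assumes "H \<subseteq> {p. p permutes {1..m}}"
  shows "galg_mult m (galg_indicator H) x = (\<lambda>p. \<Sum>h\<in>H. x (inv h \<circ> p))"
proof
  fix p
  have "galg_mult m (galg_indicator H) x p = (\<Sum>h\<in>{p. p permutes {1..m}}. if h \<in> H then x (inv h \<circ> p) else 0)"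
    unfolding galg_mult_def galg_indicator_def by (intro sum.cong) auto
  also have "\<dots> = (\<Sum>h\<in>H. x (inv h \<circ> p))"
    using assms by (simp add: sum.inter_restrict[symmetric] finite_permutations Int_absorb1)
  finally show "galg_mult m (galg_indicator H) x p = (\<Sum>h\<in>H. x (inv h \<circ> p))" .
qed

lemma galg_indicator_carrier:
  "H \<subseteq> {p. p permutes {1..m}} \<Longrightarrow> galg_indicator H \<in> galg_carrier m"
  by (auto simp: galg_carrier_def galg_indicator_def)

text \<open>Sums of character values are traces of elements of the group algebra.  This reduces
  their vanishing or non-vanishing to the action of these elements on the Specht module.\<close>

lemma sum_sym_char_coset:
  assumes H: "H \<subseteq> {p. p permutes {1..m}}" and \<sigma>: "\<sigma> permutes {1..m}"
  shows "(\<Sum>h\<in>H. sym_char m \<pi> (\<sigma> \<circ> h)) =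
    galg.trace_on (specht_module m \<pi>) (galg_mult m (galg_mult m (galg_of \<sigma>) (galg_indicator H)))"
  unfolding sym_char_def
proof (rule galg.trace_on_sum[OF specht_module_finite_dim])
  have perm: "\<sigma> \<circ> h permutes {1..m}" if "h \<in> H" for h using that H \<sigma> by (auto intro: permutes_compose)
  show "finite (galg_of ` {p. p permutes {1..m}})" by (simp add: finite_permutations)
  show "galg_mult m (galg_of (\<sigma> \<circ> h)) x \<in> specht_module m \<pi>" if "h \<in> H" "x \<in> specht_module m \<pi>" for h x
    using that perm by (intro specht_module_left_ideal galg_of_carrier) auto
  show "galg_mult m (galg_mult m (galg_of \<sigma>) (galg_indicator H)) x =
      (\<Sum>h\<in>H. galg_mult m (galg_of (\<sigma> \<circ> h)) x)" for x
  proof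
    fix p
    have "inv (\<sigma> \<circ> h) = inv h \<circ> inv \<sigma>" if "h \<in> H" for h
      using that H permutes_bij[OF \<sigma>] by (intro o_inv_distrib) (auto intro: permutes_bij)
    thus "galg_mult m (galg_mult m (galg_of \<sigma>) (galg_indicator H)) x p =
      (\<Sum>h\<in>H. galg_mult m (galg_of (\<sigma> \<circ> h)) x) p"
      unfolding galg_mult_assoc unfolding galg_indicator_mult[OF H] galg_mult_of[OF \<sigma>] sum_galg_apply
      by (intro sum.cong refl) (simp add: galg_mult_of[OF perm] comp_assoc)
  qed
qed (rule galg_mult_linear_right)+

text \<open>The symmetrizer over the labels \<open>\<alpha>\<close> kills the Specht module as soon as every rearrangement
  of the labels repeats a label within a column: a transposition of the two equal labels
  is absorbed by the symmetrizer on the left and changes the sign of the column antisymmetrizer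
  on the right.\<close>

lemma sum_sym_char_stabilizer_eq_zero:
  assumes \<sigma>: "\<sigma> permutes {1..m}"
    and rep: "\<And>r. r permutes {1..m} \<Longrightarrow>
      \<exists>i\<in>{1..m}. \<exists>j\<in>{1..m}. i \<noteq> j \<and> tableau_col \<pi> i = tableau_col \<pi> j \<and> \<alpha> (r i) = \<alpha> (r j)"
  shows "(\<Sum>h\<in>label_stabilizer m \<alpha>. sym_char m \<pi> (\<sigma> \<circ> h)) = 0"
proof -
  let ?H = "label_stabilizer m \<alpha>"
  let ?R = "\<lambda>p. if p \<in> row_group m \<pi> then 1 else 0 :: complex"
  let ?C = "\<lambda>p. if p \<in> col_group m \<pi> then of_int (sign p) else 0 :: complex"
  have H: "?H \<subseteq> {p. p permutes {1..m}}" using label_stabilizer_permutes by auto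
  have kill: "(\<Sum>h\<in>?H. ?C (inv r \<circ> (inv h \<circ> p))) = 0" if r: "r permutes {1..m}" for r p
  proof -
    obtain i j where ij: "i \<in> {1..m}" "j \<in> {1..m}" "i \<noteq> j"
      "tableau_col \<pi> i = tableau_col \<pi> j" "\<alpha> (r i) = \<alpha> (r j)" using rep[OF r] by blast
    define s where "s = Transposition.transpose (r i) (r j)"
    define t where "t = Transposition.transpose i j"
    have s: "s \<in> ?H" unfolding s_def
      using ij permutes_in_image[OF r] by (intro label_stabilizer_transpose) auto
    have t: "t \<in> label_stabilizer m (tableau_col \<pi>)" unfolding t_def
      using ij by (intro label_stabilizer_transpose) auto
    have invs: "inv s = s" unfolding s_def by simp
    have "s \<circ> r = r \<circ> t"
    proof
      fix x
      show "(s \<circ> r) x = (r \<circ> t) x"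
        by (simp add: s_def t_def Transposition.transpose_def inj_eq[OF permutes_inj[OF r]])
    qed
    hence "inv r \<circ> (s \<circ> r) \<circ> inv r = inv r \<circ> (r \<circ> t) \<circ> inv r" by simp
    \<comment> \<open>Moved past \<open>r\<close>, the exchange of two equal labels is the exchange of two entries of a
      column.\<close>
    hence conj: "inv r \<circ> s = t \<circ> inv r"
      by (simp add: comp_assoc permutes_inv_o[OF r]) (simp add: comp_assoc[symmetric] permutes_inv_o[OF r])
    have sgn: "?C (t \<circ> u) = - ?C u" for u
    proof (cases "u \<in> col_group m \<pi>")
      case True
      have "permutation t" "permutation u"
        using label_stabilizer_permutes[OF t] label_stabilizer_permutes True
        by (auto simp: permutation_permutes col_group_eq)
      hence "sign (t \<circ> u) = - sign u" using ij(3) by (simp add: sign_compose t_def sign_swap_id)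
      moreover have "t \<circ> u \<in> col_group m \<pi>" using label_stabilizer_comp_iff[OF t, of u] True by (simp add: col_group_eq)
      ultimately show ?thesis using True by simp
    next
      case False
      moreover have "t \<circ> u \<notin> col_group m \<pi>" using label_stabilizer_comp_iff[OF t, of u] False by (simp add: col_group_eq)
      ultimately show ?thesis by simp
    qed
    have "(\<Sum>h\<in>?H. ?C (inv r \<circ> (inv h \<circ> p))) = (\<Sum>h\<in>?H. ?C (inv r \<circ> (inv (h \<circ> s) \<circ> p)))"
      by (rule sum_label_stabilizer_comp_right[OF s, symmetric])
    also have "\<dots> = (\<Sum>h\<in>?H. - ?C (inv r \<circ> (inv h \<circ> p)))"
    proof (rule sum.cong[OF refl])
      fix h assume h: "h \<in> ?H"
      have "inv (h \<circ> s) = inv s \<circ> inv h"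
        using permutes_bij[OF label_stabilizer_permutes[OF h]] permutes_bij[OF label_stabilizer_permutes[OF s]]
        by (rule o_inv_distrib)
      hence "inv r \<circ> (inv (h \<circ> s) \<circ> p) = t \<circ> (inv r \<circ> (inv h \<circ> p))"
        using conj invs by (metis comp_assoc)
      thus "?C (inv r \<circ> (inv (h \<circ> s) \<circ> p)) = - ?C (inv r \<circ> (inv h \<circ> p))" using sgn by metis
    qed
    finally have "(\<Sum>h\<in>?H. ?C (inv r \<circ> (inv h \<circ> p))) = - (\<Sum>h\<in>?H. ?C (inv r \<circ> (inv h \<circ> p)))"
      by (simp add: sum_negf)
    moreover have "z = 0" if "z = - z" for z :: complex using that by (simp add: complex_eq_iff)
    ultimately show ?thesis by blast
  qed
  have zero: "galg_mult m (galg_mult m (galg_of \<sigma>) (galg_indicator ?H)) x = 0" if x: "x \<in> specht_module m \<pi>" for x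
  proof -
    from x obtain y where "x = galg_mult m y (galg_mult m ?R ?C)"
      by (auto simp: specht_module_def young_symmetrizer_def)
    hence x': "x = galg_mult m (galg_mult m y ?R) ?C" by (simp only: galg_mult_assoc)
    have "galg_mult m (galg_indicator ?H) x = 0"
    proof
      fix p
      have "galg_mult m (galg_indicator ?H) x p = (\<Sum>h\<in>?H. x (inv h \<circ> p))"
        by (simp only: galg_indicator_mult[OF H])
      also have "\<dots> = (\<Sum>h\<in>?H. \<Sum>r | r permutes {1..m}. galg_mult m y ?R r * ?C (inv r \<circ> (inv h \<circ> p)))"
        unfolding x' galg_mult_def[of m "galg_mult m y ?R"] ..
      also have "\<dots> = (\<Sum>r | r permutes {1..m}. galg_mult m y ?R r * (\<Sum>h\<in>?H. ?C (inv r \<circ> (inv h \<circ> p))))"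
        unfolding sum_distrib_left by (rule sum.swap)
      also have "\<dots> = 0" using kill by (intro sum.neutral) auto
      finally show "galg_mult m (galg_indicator ?H) x p = 0 p" by simp
    qed
    thus ?thesis unfolding galg_mult_assoc unfolding galg_mult_of[OF \<sigma>] by (simp add: fun_eq_iff)
  qed
  show ?thesis unfolding sum_sym_char_coset[OF H \<sigma>]
    by (rule galg.trace_on_eq_zero[OF specht_module_finite_dim _ galg_mult_linear_right zero])
      (simp_all add: finite_permutations)
qed

text \<open>The Young symmetrizer has coefficient \<open>1\<close> at each element of the row group, since only the
  identity is both a row and a column permutation.\<close>

lemma sum_young_symmetrizer_row_group:
  assumes H: "id \<in> H" "H \<subseteq> row_group m \<pi>"
  shows "galg_mult m (galg_indicator H) (young_symmetrizer m \<pi>) id = of_nat (card H)"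
proof -
  let ?L = "label_stabilizer m (tableau_row \<pi>)"
  let ?C = "\<lambda>p. if p \<in> col_group m \<pi> then of_int (sign p) else 0 :: complex"
  have HR: "H \<subseteq> {p. p permutes {1..m}}" "?L \<subseteq> {p. p permutes {1..m}}"
    using H(2) label_stabilizer_permutes by (auto simp: row_group_eq)
  have Y: "young_symmetrizer m \<pi> = galg_mult m (galg_indicator ?L) ?C"
    unfolding young_symmetrizer_def galg_indicator_def row_group_eq ..
  have "galg_mult m (galg_indicator H) (young_symmetrizer m \<pi>) id = (\<Sum>h\<in>H. \<Sum>r\<in>?L. ?C (inv r \<circ> (inv h \<circ> id)))"
    unfolding Y galg_indicator_mult[OF HR(1)] galg_indicator_mult[OF HR(2)] ..
  also have "\<dots> = (\<Sum>h\<in>H. 1)"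
  proof (rule sum.cong[OF refl])
    fix h assume "h \<in> H"
    hence h: "h \<in> ?L" using H(2) by (auto simp: row_group_eq)
    have "(\<Sum>r\<in>?L. ?C (inv r \<circ> (inv h \<circ> id))) = (\<Sum>r\<in>?L. if r = inv h then 1 else 0)"
    proof (rule sum.cong[OF refl])
      fix r assume r: "r \<in> ?L"
      note p = label_stabilizer_permutes[OF h] label_stabilizer_permutes[OF r]
      have in_row: "inv r \<circ> inv h \<in> row_group m \<pi>"
        using h r by (auto simp: row_group_eq intro: label_stabilizer_comp label_stabilizer_inv)
      show "?C (inv r \<circ> (inv h \<circ> id)) = (if r = inv h then 1 else 0)"
      proof (cases "r = inv h")
        case True
        hence "inv r \<circ> inv h = id" using permutes_inv_o(2)[OF p(2)] by simp
        thus ?thesis using True by (simp add: col_group_eq)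
      next
        case False
        have "inv r \<circ> inv h \<noteq> id"
        proof
          assume "inv r \<circ> inv h = id"
          hence "r \<circ> (inv r \<circ> inv h) = r \<circ> id" by simp
          thus False using False by (simp add: comp_assoc[symmetric] permutes_inv_o[OF p(2)])
        qed
        hence "inv r \<circ> inv h \<notin> col_group m \<pi>" using row_group_col_group_trivial[OF in_row] by blast
        thus ?thesis using False by simp
      qed
    qed
    also have "\<dots> = 1" using label_stabilizer_inv[OF h] by simp
    finally show "(\<Sum>r\<in>?L. ?C (inv r \<circ> (inv h \<circ> id))) = 1" .
  qed
  finally show ?thesis by simp
qed

text \<open>The formal sum of a subgroup \<open>H\<close> of the row group is a scaled idempotent that does not
  kill the Young symmetrizer, so its trace on the Specht module does not vanish.  The trivial
  subgroup gives the degree of the character, the row group the sum that decides which tensors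
  survive.\<close>

lemma sum_sym_char_row_subgroup_nonzero:
  assumes H: "id \<in> H" "H \<subseteq> row_group m \<pi>" and closed: "\<And>g h. g \<in> H \<Longrightarrow> h \<in> H \<Longrightarrow> g \<circ> h \<in> H"
    and inv: "\<And>h. h \<in> H \<Longrightarrow> inv h \<in> H"
  shows "(\<Sum>h\<in>H. sym_char m \<pi> h) \<noteq> 0"
proof -
  have HP: "H \<subseteq> {p. p permutes {1..m}}" using H(2) by (auto simp: row_group_def)
  have finH: "finite H" using HP finite_subset finite_permutations by blast
  have cH: "card H > 0" using H(1) finH by (auto simp: card_gt_0_iff)
  let ?f = "galg_mult m (galg_indicator H)"
  have id: "galg_mult m (galg_of id) g = g" for g by (simp add: galg_mult_of permutes_id)
  have "(\<Sum>h\<in>H. sym_char m \<pi> (id \<circ> h)) = galg.trace_on (specht_module m \<pi>) ?f"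
    unfolding sum_sym_char_coset[OF HP permutes_id] id ..
  hence tr: "(\<Sum>h\<in>H. sym_char m \<pi> h) = galg.trace_on (specht_module m \<pi>) ?f" by simp
  have idem: "?f (?f x) = galg_scale (of_nat (card H)) (?f x)" for x
  proof
    fix p
    have "?f (?f x) p = (\<Sum>h\<in>H. \<Sum>g\<in>H. x (inv g \<circ> (inv h \<circ> p)))"
      unfolding galg_indicator_mult[OF HP] ..
    also have "\<dots> = (\<Sum>h\<in>H. \<Sum>g\<in>H. x (inv g \<circ> p))"
    proof (rule sum.cong[OF refl])
      fix h assume h: "h \<in> H"
      hence hp: "h permutes {1..m}" using HP by auto
      show "(\<Sum>g\<in>H. x (inv g \<circ> (inv h \<circ> p))) = (\<Sum>g\<in>H. x (inv g \<circ> p))"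
      proof (rule sum.reindex_bij_witness[of _ "\<lambda>g. inv h \<circ> g" "\<lambda>g. h \<circ> g"])
        fix g assume g: "g \<in> H"
        hence gp: "g permutes {1..m}" using HP by auto
        show "h \<circ> g \<in> H" "inv h \<circ> g \<in> H" using g h closed inv by auto
        show "inv h \<circ> (h \<circ> g) = g" "h \<circ> (inv h \<circ> g) = g"
          by (simp_all add: comp_assoc[symmetric] permutes_inv_o[OF hp])
        have "inv (h \<circ> g) = inv g \<circ> inv h"
          using permutes_bij[OF hp] permutes_bij[OF gp] by (rule o_inv_distrib)
        thus "x (inv (h \<circ> g) \<circ> p) = x (inv g \<circ> (inv h \<circ> p))" by (simp add: comp_assoc)
      qed
    qed
    also have "\<dots> = galg_scale (of_nat (card H)) (?f x) p"
      by (simp add: galg_scale_def galg_indicator_mult[OF HP])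
    finally show "?f (?f x) p = galg_scale (of_nat (card H)) (?f x) p" .
  qed
  have "?f (young_symmetrizer m \<pi>) id \<noteq> 0" using sum_young_symmetrizer_row_group[OF H] cH by simp
  hence ne: "?f (young_symmetrizer m \<pi>) \<noteq> 0" by (metis zero_fun_apply)
  have "\<exists>d>0. galg.trace_on (specht_module m \<pi>) ?f = of_nat d * of_nat (card H)"
  proof (rule galg.trace_on_scaled_idempotent[OF specht_module_finite_dim])
    show "?f x \<in> specht_module m \<pi>" if "x \<in> specht_module m \<pi>" for x
      using that by (intro specht_module_left_ideal galg_indicator_carrier HP)
    show "?f (young_symmetrizer m \<pi>) \<noteq> 0" by (rule ne)
  qed (simp_all add: finite_permutations galg_mult_linear_right idem young_symmetrizer_in_specht_module)
  then obtain d where "d > 0" "galg.trace_on (specht_module m \<pi>) ?f = of_nat d * of_nat (card H)"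
    by blast
  thus ?thesis using tr cH by simp
qed

lemma sym_char_id_nonzero: "sym_char m \<pi> id \<noteq> 0"
  using sum_sym_char_row_subgroup_nonzero[of "{id}" m \<pi>] by (simp add: row_group_eq)

lemma sum_sym_char_row_group_nonzero: "(\<Sum>h\<in>row_group m \<pi>. sym_char m \<pi> h) \<noteq> 0"
  by (rule sum_sym_char_row_subgroup_nonzero)
    (auto simp: row_group_eq intro: label_stabilizer_comp label_stabilizer_inv)

section \<open>Elementary symmetric polynomials\<close>

lemma elem_sym_eq_elem_sym_fun:
  assumes "length xs = m"
  shows "elem_sym r xs = elem_sym_fun m r (\<lambda>i. xs ! (i - 1))"
  unfolding elem_sym_def elem_sym_fun_def
proof (rule sum.reindex_bij_witness[of _ "\<lambda>B. (\<lambda>i. i - 1) ` B" "\<lambda>S. Suc ` S"])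
  fix S assume S: "S \<in> {S. S \<subseteq> {..<length xs} \<and> card S = r}"
  show "(\<lambda>i. i - 1) ` Suc ` S = S" by (simp add: image_image)
  show "Suc ` S \<in> {B. B \<subseteq> {1..m} \<and> card B = r}"
    using S assms by (auto simp: card_image)
  show "(\<Prod>i\<in>Suc ` S. xs ! (i - 1)) = (\<Prod>i\<in>S. xs ! i)"
    by (subst prod.reindex) auto
next
  fix B assume B: "B \<in> {B. B \<subseteq> {1..m} \<and> card B = r}"
  have id: "Suc (i - 1) = i" if "i \<in> B" for i using that B by force
  have inj: "inj_on (\<lambda>i. i - 1) B" by (rule inj_onI) (metis id)
  show "Suc ` (\<lambda>i. i - 1) ` B = B" using id by (simp add: image_image cong: image_cong)
  show "(\<lambda>i. i - 1) ` B \<in> {S. S \<subseteq> {..<length xs} \<and> card S = r}"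
    using B assms inj by (force simp: card_image)
qed

lemma elem_sym_fun_permute:
  assumes "\<sigma> permutes {1..m}"
  shows "elem_sym_fun m r (\<lambda>i. q (\<sigma> i)) = elem_sym_fun m r q"
  unfolding elem_sym_fun_def
proof (rule sum.reindex_bij_witness[of _ "\<lambda>B. inv \<sigma> ` B" "\<lambda>B. \<sigma> ` B"])
  fix B assume B: "B \<in> {B. B \<subseteq> {1..m} \<and> card B = r}"
  have inj: "inj_on \<sigma> B" "inj_on (inv \<sigma>) B"
    using permutes_inj[OF assms] permutes_inj[OF permutes_inv[OF assms]] by (auto intro: inj_on_subset)
  show "inv \<sigma> ` \<sigma> ` B = B" "\<sigma> ` inv \<sigma> ` B = B"
    by (simp_all add: image_image permutes_inverses[OF assms])
  have "\<sigma> ` B \<subseteq> {1..m}" "inv \<sigma> ` B \<subseteq> {1..m}"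
    using B permutes_image[OF assms] permutes_image[OF permutes_inv[OF assms]] by blast+
  thus "\<sigma> ` B \<in> {B. B \<subseteq> {1..m} \<and> card B = r}" "inv \<sigma> ` B \<in> {B. B \<subseteq> {1..m} \<and> card B = r}"
    using B inj by (simp_all add: card_image)
  show "prod q (\<sigma> ` B) = (\<Prod>i\<in>B. q (\<sigma> i))" by (simp add: prod.reindex[OF inj(1)])
qed

lemma elem_sym_fun_mono:
  assumes "\<And>i. i \<in> {1..m} \<Longrightarrow> 0 \<le> q i" "\<And>i. i \<in> {1..m} \<Longrightarrow> q i \<le> q' i"
  shows "elem_sym_fun m r q \<le> elem_sym_fun m r q'"
  unfolding elem_sym_fun_def using assms by (intro sum_mono prod_mono) blast

lemma elem_sym_fun_nonneg:
  assumes "\<And>i. i \<in> {1..m} \<Longrightarrow> 0 \<le> q i"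
  shows "0 \<le> elem_sym_fun m r q"
  unfolding elem_sym_fun_def using assms by (intro sum_nonneg prod_nonneg) blast

lemma elem_sym_fun_cong:
  assumes "\<And>i. i \<in> {1..m} \<Longrightarrow> q i = q' i"
  shows "elem_sym_fun m r q = elem_sym_fun m r q'"
  unfolding elem_sym_fun_def using assms by (intro sum.cong prod.cong refl) blast

section \<open>Tableaux\<close>

lemma length_omega: "length (omega \<pi>) = sum_list \<pi>"
proof -
  have "length (omega \<pi>) = (\<Sum>i\<leftarrow>[0..<length \<pi>]. \<pi> ! i)"
    by (simp add: omega_def length_concat comp_def)
  also have "\<dots> = (\<Sum>i = 0..<length \<pi>. \<pi> ! i)" by (simp add: interv_sum_list_conv_sum_set_nat)
  also have "\<dots> = sum_list \<pi>" by (rule sum_list_sum_nth[symmetric])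
  finally show ?thesis .
qed

lemma set_omega: "set (omega \<pi>) \<subseteq> {1..length \<pi>}"
  by (auto simp: omega_def)

lemma tableau_row_range:
  assumes "is_partition m \<pi>" "i \<in> {1..m}"
  shows "tableau_row \<pi> i \<in> {1..length \<pi>}"
proof -
  have "i - 1 < length (omega \<pi>)" using assms by (simp add: length_omega is_partition_def) linarith
  hence "omega \<pi> ! (i - 1) \<in> set (omega \<pi>)" by (rule nth_mem)
  thus ?thesis using set_omega unfolding tableau_row_def by blast
qed

lemma length_partition_le:
  assumes "is_partition m \<pi>"
  shows "length \<pi> \<le> m"
proof -
  have "length \<pi> \<le> sum_list \<pi>" if "0 \<notin> set \<pi>" for \<pi> :: "nat list"
    using that by (induction \<pi>) auto
  thus ?thesis using assms by (auto simp: is_partition_def)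
qed

lemma card_tableau_row:
  assumes "is_partition m \<pi>" "r \<in> {1..length \<pi>}"
  shows "card {j\<in>{1..m}. tableau_row \<pi> j = r} = \<pi> ! (r - 1)"
proof -
  have m: "length (omega \<pi>) = m" using assms by (simp add: length_omega is_partition_def)
  have "{j\<in>{1..m}. tableau_row \<pi> j = r} = Suc ` {i. i < length (omega \<pi>) \<and> omega \<pi> ! i = r}"
  proof (intro equalityI subsetI)
    fix j assume "j \<in> {j\<in>{1..m}. tableau_row \<pi> j = r}"
    thus "j \<in> Suc ` {i. i < length (omega \<pi>) \<and> omega \<pi> ! i = r}"
      using m by (intro image_eqI[of _ _ "j - 1"]) (auto simp: tableau_row_def)
  qed (use m in \<open>auto simp: tableau_row_def\<close>)
  hence "card {j\<in>{1..m}. tableau_row \<pi> j = r} = card {i. i < length (omega \<pi>) \<and> omega \<pi> ! i = r}"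
    by (simp add: card_image)
  also have "\<dots> = length (filter (\<lambda>x. x = r) (omega \<pi>))" by (simp add: length_filter_conv_card)
  also have "\<dots> = (\<Sum>i\<leftarrow>[0..<length \<pi>]. if Suc i = r then \<pi> ! i else 0)"
  proof -
    have *: "length (filter (\<lambda>x. x = r) (replicate k a)) = (if a = r then k else 0)" for k a
      by (induction k) auto
    show ?thesis by (simp add: omega_def filter_concat length_concat comp_def *)
  qed
  also have "\<dots> = (\<Sum>i = 0..<length \<pi>. if Suc i = r then \<pi> ! i else 0)"
    by (simp add: interv_sum_list_conv_sum_set_nat)
  also have "\<dots> = (\<Sum>i = 0..<length \<pi>. if i = r - 1 then \<pi> ! i else 0)"
    using assms(2) by (intro sum.cong) auto
  also have "\<dots> = \<pi> ! (r - 1)" using assms(2) by auto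
  finally show ?thesis .
qed

text \<open>Row and column numbers separate the entries, and there are as many cells in the diagram
  as entries.\<close>

lemma tableau_cells_bij:
  assumes \<pi>: "is_partition m \<pi>"
  shows "bij_betw (\<lambda>i. (tableau_row \<pi> i, tableau_col \<pi> i)) {1..m}
    (SIGMA r:{1..length \<pi>}. {1..\<pi> ! (r - 1)})"
proof -
  let ?c = "\<lambda>i. (tableau_row \<pi> i, tableau_col \<pi> i)"
  let ?D = "SIGMA r:{1..length \<pi>}. {1..\<pi> ! (r - 1)}"
  have inj: "inj_on ?c {1..m}"
  proof (rule inj_onI)
    fix i j assume "i \<in> {1..m}" "j \<in> {1..m}" "?c i = ?c j"
    thus "i = j" using tableau_row_col_inj[of i m j \<pi>] by simp
  qed
  have sub: "?c ` {1..m} \<subseteq> ?D"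
  proof
    fix x assume "x \<in> ?c ` {1..m}"
    then obtain i where i: "i \<in> {1..m}" "x = ?c i" by auto
    have "tableau_col \<pi> i \<le> card {j\<in>{1..m}. tableau_row \<pi> j = tableau_row \<pi> i}"
      unfolding tableau_col_def using i by (intro card_mono) auto
    also have "\<dots> = \<pi> ! (tableau_row \<pi> i - 1)"
      by (rule card_tableau_row[OF \<pi> tableau_row_range[OF \<pi> i(1)]])
    finally have "tableau_col \<pi> i \<le> \<pi> ! (tableau_row \<pi> i - 1)" .
    moreover have "i \<in> {j\<in>{1..i}. tableau_row \<pi> j = tableau_row \<pi> i}" using i by auto
    hence "tableau_col \<pi> i > 0"
      unfolding tableau_col_def by (subst card_gt_0_iff) auto
    ultimately show "x \<in> ?D" using tableau_row_range[OF \<pi> i(1)] i(2) by simp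
  qed
  have "card ?D = (\<Sum>r\<in>{1..length \<pi>}. \<pi> ! (r - 1))" by simp
  also have "\<dots> = (\<Sum>i = 0..<length \<pi>. \<pi> ! i)"
    by (rule sum.reindex_bij_witness[of _ Suc "\<lambda>r. r - 1"]) auto
  also have "\<dots> = m" using \<pi> by (simp add: sum_list_sum_nth[symmetric] is_partition_def)
  finally have "?c ` {1..m} = ?D"
    using sub card_image[OF inj] by (intro card_subset_eq) auto
  thus ?thesis using inj by (simp add: bij_betw_def)
qed

text \<open>Sort each column by \<open>\<beta>\<close>: since the entries of a column are distinct positive integers,
  the entry moved to row \<open>r\<close> is at least \<open>r\<close>.  The target cell exists because the columns of a
  Young diagram have no gaps.\<close>

lemma column_sorting:
  assumes \<pi>: "is_partition m \<pi>"
    and \<beta>: "\<And>i. i \<in> {1..m} \<Longrightarrow> 1 \<le> \<beta> i"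
    and col: "\<And>i j. i \<in> {1..m} \<Longrightarrow> j \<in> {1..m} \<Longrightarrow> tableau_col \<pi> i = tableau_col \<pi> j \<Longrightarrow> \<beta> i = \<beta> j \<Longrightarrow> i = j"
  shows "\<exists>\<psi>. \<psi> permutes {1..m} \<and> (\<forall>i\<in>{1..m}. tableau_row \<pi> (\<psi> i) \<le> (\<beta> i :: nat))"
proof -
  let ?c = "\<lambda>i. (tableau_row \<pi> i, tableau_col \<pi> i)"
  let ?D = "SIGMA r:{1..length \<pi>}. {1..\<pi> ! (r - 1)}"
  define below where "below i = {j\<in>{1..m}. tableau_col \<pi> j = tableau_col \<pi> i \<and> \<beta> j \<le> \<beta> i}" for i
  define rank where "rank i = card (below i)" for i
  have fin: "finite (below i)" for i by (simp add: below_def)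
  have pos: "1 \<le> rank i" if "i \<in> {1..m}" for i
  proof -
    have "i \<in> below i" using that by (simp add: below_def)
    hence "card (below i) > 0" using fin by (auto simp: card_gt_0_iff)
    thus ?thesis by (simp add: rank_def)
  qed
  have le: "rank i \<le> \<beta> i" for i
  proof -
    have "inj_on \<beta> (below i)" by (rule inj_onI) (auto simp: below_def intro: col)
    moreover have "\<beta> ` below i \<subseteq> {1..\<beta> i}" using \<beta> by (auto simp: below_def)
    ultimately have "card (below i) \<le> card {1..\<beta> i}" by (intro card_inj_on_le) auto
    thus ?thesis by (simp add: rank_def)
  qed
  have cell: "(rank i, tableau_col \<pi> i) \<in> ?D" if i: "i \<in> {1..m}" for i
  proof (rule ccontr)
    assume out: "(rank i, tableau_col \<pi> i) \<notin> ?D"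
    have ci: "?c i \<in> ?D" using tableau_cells_bij[OF \<pi>] i by (rule bij_betwE[THEN bspec])
    have "tableau_row \<pi> ` below i \<subseteq> {1..<rank i}"
    proof
      fix r assume "r \<in> tableau_row \<pi> ` below i"
      then obtain j where j: "j \<in> {1..m}" "tableau_col \<pi> j = tableau_col \<pi> i" "r = tableau_row \<pi> j"
        by (auto simp: below_def)
      have cj: "?c j \<in> ?D" using tableau_cells_bij[OF \<pi>] j(1) by (rule bij_betwE[THEN bspec])
      hence r: "1 \<le> r" "r \<le> length \<pi>" "tableau_col \<pi> i \<le> \<pi> ! (r - 1)" using j by auto
      have "r < rank i"
      proof (rule ccontr)
        assume "\<not> r < rank i"
        hence rr: "rank i \<le> r" by simp
        have "\<pi> ! (r - 1) \<le> \<pi> ! (rank i - 1)"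
        proof (cases "rank i = r")
          case False
          hence "rank i - 1 < r - 1" "r - 1 < length \<pi>" using rr pos[OF i] r(1,2) by linarith+
          thus ?thesis using \<pi> by (auto simp: is_partition_def sorted_wrt_iff_nth_less)
        qed simp
        hence "tableau_col \<pi> i \<le> \<pi> ! (rank i - 1)" using r(3) by simp
        hence "(rank i, tableau_col \<pi> i) \<in> ?D" using pos[OF i] rr r(2) ci by auto
        thus False using out by simp
      qed
      thus "r \<in> {1..<rank i}" using r by simp
    qed
    moreover have "inj_on (tableau_row \<pi>) (below i)"
    proof (rule inj_onI)
      fix a b assume "a \<in> below i" "b \<in> below i" "tableau_row \<pi> a = tableau_row \<pi> b"
      thus "a = b" using tableau_row_col_inj[of a m b \<pi>] by (simp add: below_def)
    qed
    ultimately have "card (below i) \<le> card {1..<rank i}" by (intro card_inj_on_le) auto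
    thus False using pos[OF i] by (simp add: rank_def)
  qed
  define g where "g i = inv_into {1..m} ?c (rank i, tableau_col \<pi> i)" for i
  have im: "?c ` {1..m} = ?D" using tableau_cells_bij[OF \<pi>] by (rule bij_betw_imp_surj_on)
  have g: "g i \<in> {1..m}" "?c (g i) = (rank i, tableau_col \<pi> i)" if "i \<in> {1..m}" for i
    using cell[OF that] inv_into_into[of "(rank i, tableau_col \<pi> i)" ?c "{1..m}"]
      f_inv_into_f[of "(rank i, tableau_col \<pi> i)" ?c "{1..m}"] unfolding im g_def by blast+
  have rank_less: "rank i < rank j"
    if "i \<in> {1..m}" "j \<in> {1..m}" "tableau_col \<pi> i = tableau_col \<pi> j" "\<beta> i < \<beta> j" for i j
  proof -
    have "below i \<subseteq> below j" "j \<in> below j" "j \<notin> below i" using that by (auto simp: below_def)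
    thus ?thesis unfolding rank_def by (intro psubset_card_mono[OF fin] psubsetI) auto
  qed
  have inj: "inj_on g {1..m}"
  proof (rule inj_onI)
    fix i j assume ij: "i \<in> {1..m}" "j \<in> {1..m}" "g i = g j"
    hence *: "rank i = rank j" "tableau_col \<pi> i = tableau_col \<pi> j" using g(2)[OF ij(1)] g(2)[OF ij(2)] by auto
    hence "\<beta> i = \<beta> j" using rank_less[of i j] rank_less[of j i] ij by (cases "\<beta> i" "\<beta> j" rule: linorder_cases) auto
    thus "i = j" using col ij * by blast
  qed
  define \<psi> where "\<psi> i = (if i \<in> {1..m} then g i else i)" for i
  have "inj_on \<psi> {1..m}" using inj by (rule inj_on_cong[THEN iffD1, rotated]) (simp add: \<psi>_def)
  moreover have "\<psi> ` {1..m} \<subseteq> {1..m}" using g(1) by (auto simp: \<psi>_def)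
  ultimately have "bij_betw \<psi> {1..m} {1..m}"
    by (simp add: bij_betw_def endo_inj_surj)
  hence "\<psi> permutes {1..m}" by (rule bij_imp_permutes) (auto simp: \<psi>_def)
  moreover have "tableau_row \<pi> (\<psi> i) \<le> \<beta> i" if "i \<in> {1..m}" for i
    using g(2)[OF that] le[of i] that by (simp add: \<psi>_def)
  ultimately show ?thesis by blast
qed

text \<open>An entry that \<open>column_sorting\<close> moves to row \<open>r\<close> has a label at least \<open>r\<close>, hence a value of \<open>\<nu>\<close>
  at most \<open>\<nu> r\<close>.\<close>

lemma elem_sym_fun_le_rows:
  assumes \<pi>: "is_partition m \<pi>"
    and r: "r permutes {1..m}"
    and \<alpha>: "\<And>i. i \<in> {1..m} \<Longrightarrow> \<alpha> i \<in> {1..n}"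
    and col: "\<And>i j. i \<in> {1..m} \<Longrightarrow> j \<in> {1..m} \<Longrightarrow> tableau_col \<pi> i = tableau_col \<pi> j \<Longrightarrow>
      \<alpha> (r i) = \<alpha> (r j) \<Longrightarrow> i = j"
    and \<nu>: "\<And>i. i \<in> {1..n} \<Longrightarrow> 0 \<le> \<nu> i"
      "\<And>i j. i \<in> {1..n} \<Longrightarrow> j \<in> {1..n} \<Longrightarrow> i \<le> j \<Longrightarrow> \<nu> j \<le> \<nu> i"
  shows "elem_sym_fun m d (\<lambda>i. \<nu> (\<alpha> i)) \<le> elem_sym_fun m d (\<lambda>i. \<nu> (tableau_row \<pi> i))"
proof -
  have rm: "r i \<in> {1..m}" if "i \<in> {1..m}" for i using that permutes_in_image[OF r] by blast
  have pos: "1 \<le> \<alpha> (r i)" if "i \<in> {1..m}" for i using \<alpha>[OF rm[OF that]] by simp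
  have "\<exists>\<psi>. \<psi> permutes {1..m} \<and> (\<forall>i\<in>{1..m}. tableau_row \<pi> (\<psi> i) \<le> \<alpha> (r i))"
    using column_sorting[OF \<pi>, of "\<lambda>i. \<alpha> (r i)", OF pos col] .
  then obtain \<psi> where \<psi>: "\<psi> permutes {1..m}" "\<And>i. i \<in> {1..m} \<Longrightarrow> tableau_row \<pi> (\<psi> i) \<le> \<alpha> (r i)"
    by blast
  have \<psi>m: "\<psi> i \<in> {1..m}" if "i \<in> {1..m}" for i using that permutes_in_image[OF \<psi>(1)] by blast
  have "elem_sym_fun m d (\<lambda>i. \<nu> (\<alpha> i)) = elem_sym_fun m d (\<lambda>i. \<nu> (\<alpha> (r i)))"
    by (rule elem_sym_fun_permute[OF r, symmetric])
  also have "\<dots> \<le> elem_sym_fun m d (\<lambda>i. \<nu> (tableau_row \<pi> (\<psi> i)))"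
  proof (rule elem_sym_fun_mono)
    fix i assume i: "i \<in> {1..m}"
    have a: "\<alpha> (r i) \<in> {1..n}" using \<alpha> rm i by blast
    thus "0 \<le> \<nu> (\<alpha> (r i))" by (rule \<nu>)
    have "1 \<le> tableau_row \<pi> (\<psi> i)" using tableau_row_range[OF \<pi> \<psi>m[OF i]] by simp
    thus "\<nu> (\<alpha> (r i)) \<le> \<nu> (tableau_row \<pi> (\<psi> i))" using \<psi>(2)[OF i] a by (intro \<nu>(2)) auto
  qed
  also have "\<dots> = elem_sym_fun m d (\<lambda>i. \<nu> (tableau_row \<pi> i))"
    by (rule elem_sym_fun_permute[OF \<psi>(1)])
  finally show ?thesis .
qed

lemma elem_sym_fun_rows_nonneg:
  assumes "is_partition m \<pi>" "m \<le> n" "\<And>i. i \<in> {1..n} \<Longrightarrow> 0 \<le> \<nu> i"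
  shows "0 \<le> elem_sym_fun m d (\<lambda>i. \<nu> (tableau_row \<pi> i))"
proof (rule elem_sym_fun_nonneg)
  fix i assume "i \<in> {1..m}"
  thus "0 \<le> \<nu> (tableau_row \<pi> i)"
    using tableau_row_range[OF assms(1)] length_partition_le[OF assms(1)] assms(2)
    by (intro assms(3)) fastforce
qed

section \<open>Symmetry classes of tensors\<close>

context based_tensor_power
begin

lemma symmetrizer_add: "symmetrizer m \<tau> \<pi> (x + y) = symmetrizer m \<tau> \<pi> x + symmetrizer m \<tau> \<pi> y"
  by (simp add: symmetrizer_def blinfun.add_right scaleC_add_right sum.distrib)

lemma symmetrizer_scaleC: "symmetrizer m \<tau> \<pi> (c *\<^sub>C x) = c *\<^sub>C symmetrizer m \<tau> \<pi> x"
proof -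
  have "symmetrizer m \<tau> \<pi> (c *\<^sub>C x) = (sym_char m \<pi> id / fact m) *\<^sub>C
      (\<Sum>\<sigma> | \<sigma> permutes {1..m}. sym_char m \<pi> \<sigma> *\<^sub>C c *\<^sub>C perm_op \<tau> \<sigma> x)"
    unfolding symmetrizer_def by (simp add: clinear_opsD[OF perm_op_props(1)])
  also have "\<dots> = c *\<^sub>C symmetrizer m \<tau> \<pi> x"
    unfolding symmetrizer_def complex_space.scale_sum_right scaleC_scaleC by (simp add: mult_ac)
  finally show ?thesis .
qed

lemma symmetrizer_sum: "symmetrizer m \<tau> \<pi> (\<Sum>i\<in>I. c i *\<^sub>C x i) = (\<Sum>i\<in>I. c i *\<^sub>C symmetrizer m \<tau> \<pi> (x i))"
proof (induction I rule: infinite_finite_induct)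
  case (insert i I)
  thus ?case by (simp add: symmetrizer_add symmetrizer_scaleC)
qed (use symmetrizer_scaleC[of \<pi> 0 0] in simp_all)

lemma symmetry_class_subspace: "complex_space.subspace (symmetry_class m \<tau> \<pi>)"
proof (rule complex_space.subspaceI)
  show "0 \<in> symmetry_class m \<tau> \<pi>"
    using symmetrizer_scaleC[of \<pi> 0 0] by (auto simp: symmetry_class_def intro!: image_eqI[of _ _ 0])
qed (auto simp: symmetry_class_def symmetrizer_add[symmetric] symmetrizer_scaleC[symmetric])

lemma symmetry_class_invariant:
  assumes A: "A \<in> clinear_ops"
    and comm: "\<And>\<sigma>. \<sigma> permutes {1..m} \<Longrightarrow> perm_op \<tau> \<sigma> o\<^sub>L A = A o\<^sub>L perm_op \<tau> \<sigma>"
    and x: "x \<in> symmetry_class m \<tau> \<pi>"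
  shows "A x \<in> symmetry_class m \<tau> \<pi>"
proof -
  obtain w where w: "x = symmetrizer m \<tau> \<pi> w" using x by (auto simp: symmetry_class_def)
  have *: "perm_op \<tau> \<sigma> (A w) = A (perm_op \<tau> \<sigma> w)"
    if "\<sigma> permutes {1..m}" for \<sigma>
    using arg_cong[OF comm[OF that], of "\<lambda>B. B w"] by simp
  have "A x = symmetrizer m \<tau> \<pi> (A w)"
    unfolding w symmetrizer_def
    by (simp add: clinear_opsD[OF A] blinfun.sum_right *)
  thus ?thesis by (simp add: symmetry_class_def)
qed

lemma orthonormal_basis_tensor: "orthonormal multi_index basis_tensor"
  using onb_basis_tensor by (simp add: onb_def)

lemma multi_index_permute:
  assumes "\<alpha> \<in> multi_index" "\<sigma> permutes {1..m}"
  shows "\<alpha> \<circ> \<sigma> \<in> multi_index"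
  unfolding multi_index_def
proof (rule PiE_I)
  fix x assume "x \<in> {1..m}"
  hence "\<sigma> x \<in> {1..m}" using permutes_in_image[OF assms(2)] by blast
  thus "(\<alpha> \<circ> \<sigma>) x \<in> {1..n}" using multi_index_range[OF assms(1)] by simp
next
  fix x assume "x \<notin> {1..m}"
  thus "(\<alpha> \<circ> \<sigma>) x = undefined"
    using permutes_not_in[OF assms(2)] PiE_arb[OF assms(1)[unfolded multi_index_def]] by simp
qed

lemma perm_op_basis_tensor:
  assumes "\<sigma> permutes {1..m}"
  shows "perm_op \<tau> \<sigma> (basis_tensor \<alpha>) = basis_tensor (\<alpha> \<circ> inv \<sigma>)"
  by (simp add: basis_tensor_def perm_op_props[OF assms])

lemma symmetrizer_basis_tensor:
  "symmetrizer m \<tau> \<pi> (basis_tensor \<alpha>) = (sym_char m \<pi> id / fact m) *\<^sub>C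
     (\<Sum>\<sigma> | \<sigma> permutes {1..m}. sym_char m \<pi> \<sigma> *\<^sub>C basis_tensor (\<alpha> \<circ> inv \<sigma>))"
  unfolding symmetrizer_def by (simp add: perm_op_basis_tensor)

lemma multi_index_stabilizer:
  assumes \<alpha>: "\<alpha> \<in> multi_index" and h: "h permutes {1..m}"
  shows "h \<in> label_stabilizer m \<alpha> \<longleftrightarrow> \<alpha> \<circ> h = \<alpha>"
proof
  assume "h \<in> label_stabilizer m \<alpha>"
  thus "\<alpha> \<circ> h = \<alpha>"
    using permutes_not_in[OF h] unfolding label_stabilizer_def fun_eq_iff by (metis (mono_tags, lifting) comp_apply mem_Collect_eq)
next
  assume "\<alpha> \<circ> h = \<alpha>"
  thus "h \<in> label_stabilizer m \<alpha>" using h by (auto simp: label_stabilizer_def fun_eq_iff)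
qed

text \<open>The stabilizer of \<open>\<alpha>\<close> fixes the tensor, so the character in the symmetrizer may be replaced by
  its averages over the cosets of the stabilizer.\<close>

lemma symmetrizer_basis_tensor_eq_zero:
  assumes \<alpha>: "\<alpha> \<in> multi_index"
    and rep: "\<And>r. r permutes {1..m} \<Longrightarrow>
      \<exists>i\<in>{1..m}. \<exists>j\<in>{1..m}. i \<noteq> j \<and> tableau_col \<pi> i = tableau_col \<pi> j \<and> \<alpha> (r i) = \<alpha> (r j)"
  shows "symmetrizer m \<tau> \<pi> (basis_tensor \<alpha>) = 0"
proof -
  let ?H = "label_stabilizer m \<alpha>" and ?S = "{\<sigma>. \<sigma> permutes {1..m}}"
  let ?X = "\<Sum>\<sigma>\<in>?S. sym_char m \<pi> \<sigma> *\<^sub>C basis_tensor (\<alpha> \<circ> inv \<sigma>)"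
  have shift: "(\<Sum>\<sigma>\<in>?S. sym_char m \<pi> (\<sigma> \<circ> h) *\<^sub>C basis_tensor (\<alpha> \<circ> inv \<sigma>)) = ?X" if h: "h \<in> ?H" for h
  proof -
    have hp: "h permutes {1..m}" using h by (rule label_stabilizer_permutes)
    have "?X = (\<Sum>\<sigma>\<in>?S. sym_char m \<pi> (\<sigma> \<circ> h) *\<^sub>C basis_tensor (\<alpha> \<circ> inv (\<sigma> \<circ> h)))"
      by (rule sum_permutations_compose_right[OF hp])
    also have "\<dots> = (\<Sum>\<sigma>\<in>?S. sym_char m \<pi> (\<sigma> \<circ> h) *\<^sub>C basis_tensor (\<alpha> \<circ> inv \<sigma>))"
    proof (rule sum.cong[OF refl])
      fix \<sigma> assume "\<sigma> \<in> ?S"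
      hence "inv (\<sigma> \<circ> h) = inv h \<circ> inv \<sigma>"
        using permutes_bij[OF hp] by (intro o_inv_distrib) (auto intro: permutes_bij)
      moreover have "\<alpha> \<circ> inv h = \<alpha>"
        using multi_index_stabilizer[OF \<alpha> permutes_inv[OF hp]] label_stabilizer_inv[OF h] by blast
      ultimately have "\<alpha> \<circ> inv (\<sigma> \<circ> h) = \<alpha> \<circ> inv \<sigma>" by (metis comp_assoc)
      thus "sym_char m \<pi> (\<sigma> \<circ> h) *\<^sub>C basis_tensor (\<alpha> \<circ> inv (\<sigma> \<circ> h)) =
          sym_char m \<pi> (\<sigma> \<circ> h) *\<^sub>C basis_tensor (\<alpha> \<circ> inv \<sigma>)" by simp
    qed
    finally show ?thesis ..
  qed
  have "of_nat (card ?H) *\<^sub>C ?X = (\<Sum>h\<in>?H. ?X)"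
    by (rule complex_space.sum_constant_scale[symmetric])
  also have "\<dots> = (\<Sum>h\<in>?H. \<Sum>\<sigma>\<in>?S. sym_char m \<pi> (\<sigma> \<circ> h) *\<^sub>C basis_tensor (\<alpha> \<circ> inv \<sigma>))"
    by (intro sum.cong refl shift[symmetric])
  also have "\<dots> = (\<Sum>\<sigma>\<in>?S. (\<Sum>h\<in>?H. sym_char m \<pi> (\<sigma> \<circ> h)) *\<^sub>C basis_tensor (\<alpha> \<circ> inv \<sigma>))"
    by (subst sum.swap) (simp add: complex_space.scale_sum_left)
  also have "\<dots> = 0"
  proof (rule sum.neutral, rule ballI)
    fix \<sigma> assume "\<sigma> \<in> ?S"
    hence "(\<Sum>h\<in>?H. sym_char m \<pi> (\<sigma> \<circ> h)) = 0"
      using sum_sym_char_stabilizer_eq_zero[of \<sigma> m \<pi> \<alpha>] rep by blast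
    thus "(\<Sum>h\<in>?H. sym_char m \<pi> (\<sigma> \<circ> h)) *\<^sub>C basis_tensor (\<alpha> \<circ> inv \<sigma>) = 0" by simp
  qed
  finally have "of_nat (card ?H) *\<^sub>C ?X = 0" .
  moreover have "card ?H \<noteq> 0" 
    by (metis card_eq_0_iff empty_iff finite_label_stabilizer id_label_stabilizer)
  ultimately have "?X = 0" by simp
  thus ?thesis unfolding symmetrizer_basis_tensor by simp
qed

text \<open>The tuple \<open>\<omega>(\<pi>)\<close> of the row numbers, made extensional to be a multi-index.\<close>

definition row_index :: "nat list \<Rightarrow> nat \<Rightarrow> nat" where
  "row_index \<pi> = restrict (tableau_row \<pi>) {1..m}"

lemma row_index_multi_index:
  assumes "is_partition m \<pi>" "m \<le> n"
  shows "row_index \<pi> \<in> multi_index"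
  unfolding multi_index_def row_index_def
proof (rule restrict_PiE_iff[THEN iffD2], rule ballI)
  fix i assume "i \<in> {1..m}"
  thus "tableau_row \<pi> i \<in> {1..n}"
    using tableau_row_range[OF assms(1)] length_partition_le[OF assms(1)] assms(2) by fastforce
qed

text \<open>The coefficient of the basis tensor in its own symmetrization is, up to the
  normalizing factor, the sum of the character over the stabilizer of the multi-index, which
  here is the row group.\<close>

lemma symmetrizer_row_index_nonzero:
  assumes \<pi>: "is_partition m \<pi>" "m \<le> n"
  shows "symmetrizer m \<tau> \<pi> (basis_tensor (row_index \<pi>)) \<noteq> 0"
proof -
  let ?w = "row_index \<pi>" and ?S = "{\<sigma>. \<sigma> permutes {1..m}}"
  have w: "?w \<in> multi_index" by (rule row_index_multi_index[OF \<pi>])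
  have "label_stabilizer m ?w = row_group m \<pi>"
    unfolding row_group_eq label_stabilizer_def row_index_def
    using permutes_in_image[of _ "{1..m}"] by (auto simp: restrict_def simp del: atLeastAtMost_iff)
  hence row_group: "row_group m \<pi> = label_stabilizer m ?w" ..
  have R: "row_group m \<pi> \<subseteq> ?S" by (auto simp: row_group_def)
  have stab: "(?w \<circ> inv \<sigma> = ?w) = (\<sigma> \<in> row_group m \<pi>)" if "\<sigma> \<in> ?S" for \<sigma>
  proof -
    have \<sigma>: "\<sigma> permutes {1..m}" using that by simp
    have "(?w \<circ> inv \<sigma> = ?w) = (inv \<sigma> \<in> label_stabilizer m ?w)"
      by (rule multi_index_stabilizer[OF w permutes_inv[OF \<sigma>], symmetric])
    also have "\<dots> = (\<sigma> \<in> label_stabilizer m ?w)"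
      using label_stabilizer_inv[of \<sigma> m ?w] label_stabilizer_inv[of "inv \<sigma>" m ?w]
        permutes_inv_inv[OF \<sigma>] by auto
    finally show ?thesis unfolding row_group .
  qed
  have "cinner (\<Sum>\<sigma>\<in>?S. sym_char m \<pi> \<sigma> *\<^sub>C basis_tensor (?w \<circ> inv \<sigma>)) (basis_tensor ?w) =
      (\<Sum>\<sigma>\<in>?S. if \<sigma> \<in> row_group m \<pi> then sym_char m \<pi> \<sigma> else 0)"
    unfolding cinner_sum_left
  proof (rule sum.cong[OF refl])
    fix \<sigma> assume \<sigma>: "\<sigma> \<in> ?S"
    hence "?w \<circ> inv \<sigma> \<in> multi_index" using w by (intro multi_index_permute permutes_inv) auto
    hence "cinner (basis_tensor (?w \<circ> inv \<sigma>)) (basis_tensor ?w) = (if ?w \<circ> inv \<sigma> = ?w then 1 else 0)"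
      using w by (rule orthonormalD[OF orthonormal_basis_tensor])
    thus "cinner (sym_char m \<pi> \<sigma> *\<^sub>C basis_tensor (?w \<circ> inv \<sigma>)) (basis_tensor ?w) =
        (if \<sigma> \<in> row_group m \<pi> then sym_char m \<pi> \<sigma> else 0)"
      using stab[OF \<sigma>] by (simp add: cinner_scaleC_left)
  qed
  also have "\<dots> = (\<Sum>\<sigma>\<in>row_group m \<pi>. sym_char m \<pi> \<sigma>)"
    using R by (simp add: sum.inter_restrict[symmetric] finite_permutations Int_absorb1)
  also have "\<dots> \<noteq> 0" by (rule sum_sym_char_row_group_nonzero)
  finally have "(\<Sum>\<sigma>\<in>?S. sym_char m \<pi> \<sigma> *\<^sub>C basis_tensor (?w \<circ> inv \<sigma>)) \<noteq> 0" by auto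
  thus ?thesis unfolding symmetrizer_basis_tensor using sym_char_id_nonzero[of m \<pi>] by simp
qed

lemma cinner_symmetrizer_basis_tensor_nonzero:
  assumes \<beta>: "\<beta> \<in> multi_index" and \<alpha>: "\<alpha> \<in> multi_index"
    and ne: "cinner (symmetrizer m \<tau> \<pi> (basis_tensor \<beta>)) (basis_tensor \<alpha>) \<noteq> 0"
  shows "\<exists>\<sigma>. \<sigma> permutes {1..m} \<and> \<alpha> = \<beta> \<circ> inv \<sigma>"
proof (rule ccontr)
  assume no: "\<not> ?thesis"
  have "cinner (basis_tensor (\<beta> \<circ> inv \<sigma>)) (basis_tensor \<alpha>) = 0" if \<sigma>: "\<sigma> permutes {1..m}" for \<sigma>
  proof -
    have "\<beta> \<circ> inv \<sigma> \<in> multi_index" using \<beta> \<sigma> by (intro multi_index_permute permutes_inv)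
    hence "cinner (basis_tensor (\<beta> \<circ> inv \<sigma>)) (basis_tensor \<alpha>) = (if \<beta> \<circ> inv \<sigma> = \<alpha> then 1 else 0)"
      using \<alpha> by (rule orthonormalD[OF orthonormal_basis_tensor])
    thus ?thesis using no \<sigma> by auto
  qed
  hence "cinner (symmetrizer m \<tau> \<pi> (basis_tensor \<beta>)) (basis_tensor \<alpha>) = 0"
    unfolding symmetrizer_basis_tensor cinner_scaleC_left cinner_sum_left by simp
  thus False using ne by simp
qed

text \<open>Expanding a preimage of \<open>x\<close> in basis tensors leaves only multi-indices that are not killed by
  the symmetrizer, and symmetrizing permutes their entries.\<close>

lemma symmetry_class_support:
  assumes x: "x \<in> symmetry_class m \<tau> \<pi>" and \<alpha>: "\<alpha> \<in> multi_index" and ne: "cinner x (basis_tensor \<alpha>) \<noteq> 0"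
  shows "\<exists>r. r permutes {1..m} \<and> (\<forall>i\<in>{1..m}. \<forall>j\<in>{1..m}.
    tableau_col \<pi> i = tableau_col \<pi> j \<longrightarrow> \<alpha> (r i) = \<alpha> (r j) \<longrightarrow> i = j)"
proof -
  obtain w where w: "x = symmetrizer m \<tau> \<pi> w" using x by (auto simp: symmetry_class_def)
  have "x = symmetrizer m \<tau> \<pi> (\<Sum>\<beta>\<in>multi_index. cinner w (basis_tensor \<beta>) *\<^sub>C basis_tensor \<beta>)"
    using w onb_expansion[OF onb_basis_tensor, of w] by simp
  also have "\<dots> = (\<Sum>\<beta>\<in>multi_index. cinner w (basis_tensor \<beta>) *\<^sub>C symmetrizer m \<tau> \<pi> (basis_tensor \<beta>))"
    by (rule symmetrizer_sum)
  finally have "cinner x (basis_tensor \<alpha>) = (\<Sum>\<beta>\<in>multi_index. cinner w (basis_tensor \<beta>) *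
      cinner (symmetrizer m \<tau> \<pi> (basis_tensor \<beta>)) (basis_tensor \<alpha>))"
    by (simp add: cinner_sum_left cinner_scaleC_left)
  with ne have "(\<Sum>\<beta>\<in>multi_index. cinner w (basis_tensor \<beta>) *
      cinner (symmetrizer m \<tau> \<pi> (basis_tensor \<beta>)) (basis_tensor \<alpha>)) \<noteq> 0" by simp
  then obtain \<beta> where \<beta>: "\<beta> \<in> multi_index"
    "cinner w (basis_tensor \<beta>) * cinner (symmetrizer m \<tau> \<pi> (basis_tensor \<beta>)) (basis_tensor \<alpha>) \<noteq> 0"
    by (rule sum.not_neutral_contains_not_neutral)
  hence ne': "cinner (symmetrizer m \<tau> \<pi> (basis_tensor \<beta>)) (basis_tensor \<alpha>) \<noteq> 0" by simp
  then obtain \<sigma> where \<sigma>: "\<sigma> permutes {1..m}" "\<alpha> = \<beta> \<circ> inv \<sigma>"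
    using cinner_symmetrizer_basis_tensor_nonzero[OF \<beta>(1) \<alpha>] by blast
  have "symmetrizer m \<tau> \<pi> (basis_tensor \<beta>) \<noteq> 0" using ne' by auto
  then obtain r where r: "r permutes {1..m}" "\<forall>i\<in>{1..m}. \<forall>j\<in>{1..m}.
    tableau_col \<pi> i = tableau_col \<pi> j \<longrightarrow> \<beta> (r i) = \<beta> (r j) \<longrightarrow> i = j"
    using symmetrizer_basis_tensor_eq_zero[OF \<beta>(1)] by blast
  have "\<alpha> ((\<sigma> \<circ> r) i) = \<beta> (r i)" for i by (simp add: \<sigma>(2) permutes_inverses[OF \<sigma>(1)])
  hence "\<forall>i\<in>{1..m}. \<forall>j\<in>{1..m}. tableau_col \<pi> i = tableau_col \<pi> j \<longrightarrow>
      \<alpha> ((\<sigma> \<circ> r) i) = \<alpha> ((\<sigma> \<circ> r) j) \<longrightarrow> i = j"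
    using r(2) by (simp only:)
  thus ?thesis using permutes_compose[OF r(1) \<sigma>(1)] by blast
qed

end

section \<open>Singular value decomposition\<close>

lemma onb_if_card_eq_cdim:
  fixes e :: "nat \<Rightarrow> 'a::complex_inner_space"
  assumes "cdim (UNIV :: 'a set) = n" "1 \<le> n" "orthonormal {1..n} e"
  shows "onb {1..n} e"
proof -
  obtain B :: "'a set" where "finite B" "cspan B = UNIV"
    using cdim_pos_finite_basis assms(1,2) by (metis less_le_trans zero_less_one)
  thus ?thesis
    using orthonormal_spans_subspace[OF complex_space.subspace_UNIV, of "{1..n}" e B] assms
    by (simp add: onb_def)
qed

lemma adjoint_op_props:
  fixes T :: "'a::complex_inner_space \<Rightarrow>\<^sub>L 'a" and b :: "'i \<Rightarrow> 'a"
  assumes b: "onb I b" and T: "T \<in> clinear_ops"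
  shows "adjoint_op T \<in> clinear_ops"
    and "cinner (blinfun_apply (adjoint_op T) x) y = cinner x (blinfun_apply T y)"
proof -
  let ?B = "op_of_basis I (\<lambda>i. blinfun_apply T (b i)) b"
  have B: "cinner (blinfun_apply ?B x) y = cinner x (blinfun_apply T y)" for x y
  proof -
    have "cinner x (blinfun_apply T y) = cinner x (blinfun_apply T (\<Sum>i\<in>I. cinner y (b i) *\<^sub>C b i))"
      using onb_expansion[OF b, of y] by simp
    also have "\<dots> = (\<Sum>i\<in>I. cnj (cinner y (b i)) * cinner x (blinfun_apply T (b i)))"
      by (simp add: blinfun.sum_right clinear_opsD[OF T] cinner_sum_right cinner_scaleC_right)
    also have "\<dots> = (\<Sum>i\<in>I. cinner x (blinfun_apply T (b i)) * cinner (b i) y)"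
      by (rule sum.cong[OF refl]) (metis cinner_commute mult.commute)
    also have "\<dots> = cinner (blinfun_apply ?B x) y"
      by (simp add: op_of_basis_apply cinner_sum_left cinner_scaleC_left)
    finally show ?thesis ..
  qed
  have "adjoint_op T = ?B"
    unfolding adjoint_op_def
  proof (rule the_equality)
    fix C assume "\<forall>x y. cinner (blinfun_apply C x) y = cinner x (blinfun_apply T y)"
    thus "C = ?B" by (intro blinfun_eqI cinner_left_eqI) (simp add: B)
  qed (simp add: B)
  thus "adjoint_op T \<in> clinear_ops"
    "cinner (blinfun_apply (adjoint_op T) x) y = cinner x (blinfun_apply T y)"
    using B op_of_basis_clinear by simp_all
qed

text \<open>The multiplicities prescribed by \<open>singular_values\<close> add up to the dimension, so orthonormal
  bases of the eigenspaces of \<open>T\<^sup>*T\<close>, which are mutually orthogonal, together form an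
  orthonormal basis \<open>e\<close> of the whole space.  The vectors \<open>T (e i)\<close> are orthogonal of length \<open>\<nu> i\<close>;
  the nonzero ones are scaled and completed to the basis \<open>f\<close>.\<close>

lemma singular_value_decomposition:
  fixes T :: "'a::complex_inner_space \<Rightarrow>\<^sub>L 'a"
  assumes n: "cdim (UNIV :: 'a set) = n" "1 \<le> n" and T: "T \<in> clinear_ops"
    and \<nu>: "singular_values n T \<nu>"
  shows "\<exists>e f. onb {1..n} e \<and> onb {1..n} f \<and>
    (\<forall>i\<in>{1..n}. T (e i) = complex_of_real (\<nu> i) *\<^sub>C f i)"
proof -
  obtain b :: "nat \<Rightarrow> 'a" where "orthonormal {1..n} b"
    using orthonormal_extend[OF complex_space.subspace_UNIV, of "{1..n}" "{}"] n(1)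
    by (auto simp: orthonormal_def)
  hence b: "onb {1..n} b" by (rule onb_if_card_eq_cdim[OF n])
  note adj = adjoint_op_props[OF b T]
  define E where "E s = {x. blinfun_apply (adjoint_op T o\<^sub>L T) x = complex_of_real (s\<^sup>2) *\<^sub>C x}" for s
  have TT: "cinner (T x) (T y) = of_real (s\<^sup>2) * cinner x y" if "x \<in> E s" for x y s
    using that adj(2)[of "T x" y] by (simp add: E_def cinner_scaleC_left)
  have E: "complex_space.subspace (E s)" for s
    by (rule complex_space.subspaceI)
      (auto simp: E_def blinfun.zero_right blinfun.add_right scaleC_add_right clinear_opsD[OF adj(1)]
        clinear_opsD[OF T] scaleC_scaleC mult.commute)
  have "\<exists>e. orthonormal {i\<in>{1..n}. \<nu> i = s} e \<and> e ` {i\<in>{1..n}. \<nu> i = s} \<subseteq> E s" if "s \<ge> 0" for s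
    using orthonormal_extend[OF E, of "{i\<in>{1..n}. \<nu> i = s}" s "{}"] \<nu> that
    by (auto simp: singular_values_def E_def orthonormal_def)
  hence "\<forall>s. \<exists>e. s \<ge> 0 \<longrightarrow> orthonormal {i\<in>{1..n}. \<nu> i = s} e \<and> e ` {i\<in>{1..n}. \<nu> i = s} \<subseteq> E s" by blast
  from choice[OF this] obtain ee where ee: "\<And>s. s \<ge> 0 \<Longrightarrow> orthonormal {i\<in>{1..n}. \<nu> i = s} (ee s)"
    "\<And>s. s \<ge> 0 \<Longrightarrow> ee s ` {i\<in>{1..n}. \<nu> i = s} \<subseteq> E s" by blast
  have \<nu>0: "0 \<le> \<nu> i" if "i \<in> {1..n}" for i using \<nu> that by (simp add: singular_values_def)
  define e where "e i = ee (\<nu> i) i" for i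
  have eE: "e i \<in> E (\<nu> i)" if "i \<in> {1..n}" for i using ee(2)[OF \<nu>0[OF that]] that by (auto simp: e_def)
  have "orthonormal {1..n} e"
    unfolding orthonormal_def
  proof (intro ballI)
    fix i j assume ij: "i \<in> {1..n}" "j \<in> {1..n}"
    show "cinner (e i) (e j) = (if i = j then 1 else 0)"
    proof (cases "\<nu> i = \<nu> j")
      case True
      thus ?thesis using orthonormalD[OF ee(1)[OF \<nu>0[OF ij(1)]], of i j] ij by (simp add: e_def)
    next
      case False
      have "of_real ((\<nu> i)\<^sup>2) * cinner (e i) (e j) = cinner (T (e i)) (T (e j))"
        using TT[OF eE[OF ij(1)]] by simp
      also have "\<dots> = cnj (cinner (T (e j)) (T (e i)))" by (rule cinner_commute)
      also have "\<dots> = of_real ((\<nu> j)\<^sup>2) * cinner (e i) (e j)"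
        unfolding TT[OF eE[OF ij(2)]] by (simp add: cinner_commute[of "e i" "e j"])
      finally have "of_real ((\<nu> i)\<^sup>2 - (\<nu> j)\<^sup>2) * cinner (e i) (e j) = 0" by (simp add: algebra_simps)
      moreover have "(\<nu> i)\<^sup>2 - (\<nu> j)\<^sup>2 \<noteq> 0" using False \<nu>0[OF ij(1)] \<nu>0[OF ij(2)] by simp
      ultimately have "cinner (e i) (e j) = 0" by (metis mult_eq_0_iff of_real_eq_0_iff)
      thus ?thesis using False by auto
    qed
  qed
  hence e: "onb {1..n} e" "orthonormal {1..n} e" using onb_if_card_eq_cdim[OF n] by auto
  let ?F = "{i\<in>{1..n}. \<nu> i \<noteq> 0}"
  define f0 where "f0 i = complex_of_real (1 / \<nu> i) *\<^sub>C T (e i)" for i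
  have "orthonormal ?F f0"
    unfolding orthonormal_def
  proof (intro ballI)
    fix i j assume ij: "i \<in> ?F" "j \<in> ?F"
    have "cinner (f0 i) (f0 j) = of_real (1 / \<nu> i) * of_real (1 / \<nu> j) * (of_real ((\<nu> i)\<^sup>2) * cinner (e i) (e j))"
      using TT[OF eE[of i], of "e j"] ij by (simp add: f0_def cinner_scaleC_left cinner_scaleC_right)
    thus "cinner (f0 i) (f0 j) = (if i = j then 1 else 0)"
      using ij orthonormalD[OF e(2), of i j] by (auto simp: power2_eq_square)
  qed
  then obtain f where f: "orthonormal {1..n} f" "\<forall>i\<in>?F. f i = f0 i"
    using orthonormal_extend[OF complex_space.subspace_UNIV _ _ Collect_restrict _ subset_UNIV,
        of "{1..n}" "\<lambda>i. \<nu> i \<noteq> 0" f0] n(1) by force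
  have "T (e i) = complex_of_real (\<nu> i) *\<^sub>C f i" if i: "i \<in> {1..n}" for i
  proof (cases "\<nu> i = 0")
    case True
    hence "cinner (T (e i)) (T (e i)) = 0" using TT[OF eE[OF i], of "e i"] by simp
    thus ?thesis using True by (simp add: cinner_self_eq_zero_iff)
  next
    case False
    thus ?thesis using f(2) i by (simp add: f0_def scaleC_one)
  qed
  thus ?thesis using e(1) onb_if_card_eq_cdim[OF n f(1)] by blast
qed

section \<open>The norm of the derivative on a symmetry class\<close>

context based_tensor_power
begin

text \<open>The value of the \<open>k\<close>-th derivative of \<open>\<otimes>\<^sup>m\<close> at \<open>Y 0\<close> in the directions
  \<open>Y 1, \<dots>, Y k\<close>.\<close>

definition deriv_op :: "nat \<Rightarrow> (nat \<Rightarrow> 'v \<Rightarrow>\<^sub>L 'v) \<Rightarrow> 'w \<Rightarrow>\<^sub>L 'w" where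
  "deriv_op k Y = (\<Sum>\<phi>\<in>placements m k. tensor_ops \<tau> (\<lambda>i. Y (\<phi> i)))"

lemma deriv_op_clinear:
  assumes Y: "\<And>j. Y j \<in> clinear_ops"
  shows "deriv_op k Y \<in> clinear_ops"
  unfolding deriv_op_def by (intro clinear_ops_sum tensor_ops_props Y)

text \<open>Permuting the sites merely permutes the placements, so the derivative commutes with the
  permutation operators.\<close>

lemma deriv_op_symmetry_class:
  assumes Y: "\<And>j. Y j \<in> clinear_ops" and x: "x \<in> symmetry_class m \<tau> \<pi>"
  shows "deriv_op k Y x \<in> symmetry_class m \<tau> \<pi>"
proof (rule symmetry_class_invariant[OF deriv_op_clinear[OF Y] _ x])
  fix \<sigma> assume \<sigma>: "\<sigma> permutes {1..m}"
  have "perm_op \<tau> \<sigma> o\<^sub>L deriv_op k Y = (\<Sum>\<phi>\<in>placements m k. perm_op \<tau> \<sigma> o\<^sub>L tensor_ops \<tau> (\<lambda>i. Y (\<phi> i)))"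
    unfolding deriv_op_def by (intro blinfun_eqI) (simp add: blinfun.sum_left blinfun.sum_right)
  also have "\<dots> = (\<Sum>\<phi>\<in>placements m k. tensor_ops \<tau> (\<lambda>i. Y ((\<phi> \<circ> inv \<sigma>) i)) o\<^sub>L perm_op \<tau> \<sigma>)"
    using Y by (simp add: perm_op_tensor_ops[OF \<sigma>])
  also have "\<dots> = (\<Sum>\<phi>\<in>placements m k. tensor_ops \<tau> (\<lambda>i. Y (\<phi> i)) o\<^sub>L perm_op \<tau> \<sigma>)"
    by (rule sum.reindex_bij_betw[OF placements_permute[OF permutes_inv[OF \<sigma>]]])
  also have "\<dots> = deriv_op k Y o\<^sub>L perm_op \<tau> \<sigma>"
    unfolding deriv_op_def by (intro blinfun_eqI) (simp add: blinfun.sum_left)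
  finally show "perm_op \<tau> \<sigma> o\<^sub>L deriv_op k Y = deriv_op k Y o\<^sub>L perm_op \<tau> \<sigma>" .
qed

lemma tensor_ops_symmetry_class:
  assumes A: "A \<in> clinear_ops" and x: "x \<in> symmetry_class m \<tau> \<pi>"
  shows "blinfun_apply (tensor_ops \<tau> (\<lambda>_. A)) x \<in> symmetry_class m \<tau> \<pi>"
  using A by (intro symmetry_class_invariant[OF _ _ x] tensor_ops_props) (simp_all add: perm_op_tensor_ops)

lemma tensor_ops_isometry:
  assumes f: "onb {1..n} f" and A: "A \<in> clinear_ops" "\<And>a. a \<in> {1..n} \<Longrightarrow> blinfun_apply A (e a) = f a"
  shows "norm (blinfun_apply (tensor_ops \<tau> (\<lambda>_. A)) x) = norm x"
proof -
  interpret F: based_tensor_power m n \<tau> f by unfold_locales (fact tensor, fact f)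
  show ?thesis
  proof (rule norm_preserving_if_onb_to_orthonormal[OF onb_basis_tensor F.orthonormal_basis_tensor])
    show "tensor_ops \<tau> (\<lambda>_. A) \<in> clinear_ops" by (intro tensor_ops_props A)
    fix \<alpha> assume "\<alpha> \<in> multi_index"
    thus "blinfun_apply (tensor_ops \<tau> (\<lambda>_. A)) (basis_tensor \<alpha>) = F.basis_tensor \<alpha>"
      using tensor_ops_diagonal[of "\<lambda>_. A" \<alpha> "\<lambda>_ _. 1" f] A
      by (simp add: scaleC_one F.basis_tensor_def)
  qed
qed

lemma diagonal_op_coefficient:
  assumes D: "D \<in> clinear_ops"
    and diag: "\<And>\<alpha>. \<alpha> \<in> multi_index \<Longrightarrow> blinfun_apply D (basis_tensor \<alpha>) = complex_of_real (d \<alpha>) *\<^sub>C basis_tensor \<alpha>"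
    and \<alpha>: "\<alpha> \<in> multi_index"
  shows "cinner (blinfun_apply D x) (basis_tensor \<alpha>) = of_real (d \<alpha>) * cinner x (basis_tensor \<alpha>)"
proof -
  have "blinfun_apply D x = blinfun_apply D (\<Sum>\<beta>\<in>multi_index. cinner x (basis_tensor \<beta>) *\<^sub>C basis_tensor \<beta>)"
    using onb_expansion[OF onb_basis_tensor, of x] by simp
  also have "\<dots> = (\<Sum>\<beta>\<in>multi_index. (of_real (d \<beta>) * cinner x (basis_tensor \<beta>)) *\<^sub>C basis_tensor \<beta>)"
    by (simp add: blinfun.sum_right clinear_opsD[OF D] diag scaleC_scaleC mult.commute)
  finally show ?thesis
    using cinner_orthonormal_sum[OF orthonormal_basis_tensor finite_multi_index \<alpha>] by simp
qed

lemma diagonal_op_selfadjoint: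
  assumes D: "D \<in> clinear_ops"
    and diag: "\<And>\<alpha>. \<alpha> \<in> multi_index \<Longrightarrow> blinfun_apply D (basis_tensor \<alpha>) = complex_of_real (d \<alpha>) *\<^sub>C basis_tensor \<alpha>"
  shows "cinner (blinfun_apply D x) y = cinner x (blinfun_apply D y)"
proof -
  let ?c = "\<lambda>z \<alpha>. cinner z (basis_tensor \<alpha>)"
  have parseval: "cinner u v = (\<Sum>\<alpha>\<in>multi_index. ?c u \<alpha> * cnj (?c v \<alpha>))" for u v
  proof -
    have "cinner u v = cinner u (\<Sum>\<alpha>\<in>multi_index. ?c v \<alpha> *\<^sub>C basis_tensor \<alpha>)"
      using onb_expansion[OF onb_basis_tensor, of v] by simp
    thus ?thesis by (simp add: cinner_sum_right cinner_scaleC_right mult.commute)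
  qed
  have "cinner (blinfun_apply D x) y = (\<Sum>\<alpha>\<in>multi_index. ?c (blinfun_apply D x) \<alpha> * cnj (?c y \<alpha>))"
    by (rule parseval)
  also have "\<dots> = (\<Sum>\<alpha>\<in>multi_index. ?c x \<alpha> * cnj (?c (blinfun_apply D y) \<alpha>))"
    by (rule sum.cong[OF refl]) (simp add: diagonal_op_coefficient[OF D diag])
  also have "\<dots> = cinner x (blinfun_apply D y)" by (rule parseval[symmetric])
  finally show ?thesis .
qed

text \<open>The left-hand side is the quadratic form of the derivative at the diagonal operator with
  entries \<open>\<nu>\<close> in the directions \<open>I, \<dots>, I\<close>.  It is diagonal with the entries \<open>k! p(\<nu>\<^sub>\<alpha>)\<close>, and only
  those \<open>\<alpha>\<close> matter that fill the tableau without repetition in a column.\<close>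

lemma sum_weights_symmetry_class_le:
  assumes \<pi>: "is_partition m \<pi>" and km: "k \<le> m"
    and \<nu>: "\<And>i. i \<in> {1..n} \<Longrightarrow> 0 \<le> \<nu> i"
      "\<And>i j. i \<in> {1..n} \<Longrightarrow> j \<in> {1..n} \<Longrightarrow> i \<le> j \<Longrightarrow> \<nu> j \<le> \<nu> i"
    and x: "x \<in> symmetry_class m \<tau> \<pi>"
  shows "(\<Sum>\<phi>\<in>placements m k. \<Sum>\<alpha>\<in>multi_index.
      (\<Prod>i | i \<in> {1..m} \<and> \<phi> i = 0. \<nu> (\<alpha> i)) * (cmod (cinner x (basis_tensor \<alpha>)))\<^sup>2)
    \<le> fact k * elem_sym_fun m (m - k) (\<lambda>i. \<nu> (tableau_row \<pi> i)) * (norm x)\<^sup>2"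
proof -
  let ?x = "\<lambda>\<alpha>. (cmod (cinner x (basis_tensor \<alpha>)))\<^sup>2"
  have "(\<Sum>\<phi>\<in>placements m k. \<Sum>\<alpha>\<in>multi_index. (\<Prod>i | i \<in> {1..m} \<and> \<phi> i = 0. \<nu> (\<alpha> i)) * ?x \<alpha>) =
      (\<Sum>\<alpha>\<in>multi_index. (\<Sum>\<phi>\<in>placements m k. \<Prod>i | i \<in> {1..m} \<and> \<phi> i = 0. \<nu> (\<alpha> i)) * ?x \<alpha>)"
    by (subst sum.swap) (simp add: sum_distrib_right)
  also have "\<dots> = (\<Sum>\<alpha>\<in>multi_index. fact k * elem_sym_fun m (m - k) (\<lambda>i. \<nu> (\<alpha> i)) * ?x \<alpha>)"
    by (simp only: sum_placements[OF km])
  also have "\<dots> \<le> (\<Sum>\<alpha>\<in>multi_index. fact k * elem_sym_fun m (m - k) (\<lambda>i. \<nu> (tableau_row \<pi> i)) * ?x \<alpha>)"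
  proof (rule sum_mono)
    fix \<alpha> assume \<alpha>: "\<alpha> \<in> multi_index"
    show "fact k * elem_sym_fun m (m - k) (\<lambda>i. \<nu> (\<alpha> i)) * ?x \<alpha> \<le>
        fact k * elem_sym_fun m (m - k) (\<lambda>i. \<nu> (tableau_row \<pi> i)) * ?x \<alpha>"
    proof (cases "cinner x (basis_tensor \<alpha>) = 0")
      case False
      then obtain r where r: "r permutes {1..m}" "\<forall>i\<in>{1..m}. \<forall>j\<in>{1..m}.
          tableau_col \<pi> i = tableau_col \<pi> j \<longrightarrow> \<alpha> (r i) = \<alpha> (r j) \<longrightarrow> i = j"
        using symmetry_class_support[OF x \<alpha>] by blast
      have "elem_sym_fun m (m - k) (\<lambda>i. \<nu> (\<alpha> i)) \<le> elem_sym_fun m (m - k) (\<lambda>i. \<nu> (tableau_row \<pi> i))"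
        using r(2) by (intro elem_sym_fun_le_rows[OF \<pi> r(1) multi_index_range[OF \<alpha>] _ \<nu>]) blast+
      thus ?thesis by (intro mult_right_mono mult_left_mono) auto
    qed simp
  qed
  also have "\<dots> = fact k * elem_sym_fun m (m - k) (\<lambda>i. \<nu> (tableau_row \<pi> i)) * (norm x)\<^sup>2"
    by (simp add: onb_norm_sqr[OF onb_basis_tensor, of x] sum_distrib_left)
  finally show ?thesis .
qed

text \<open>The upper bound.  Undoing the isometry \<open>e a \<mapsto> f a\<close>, the base point becomes the nonnegative
  diagonal operator \<open>P\<close> with entries \<open>\<nu>\<close>.  A summand of the derivative has \<open>P\<close> at some sites and
  contractions at the others; writing \<open>P\<close> as the square of \<open>Q\<close>, the summand is \<open>Q\<^sub>\<phi> X\<^sub>\<phi> Q\<^sub>\<phi>\<close> with a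
  contraction \<open>X\<^sub>\<phi>\<close>.  Cauchy--Schwarz, within each summand and over the summands, bounds the sum by
  \<open>\<Sum>\<phi>. Q\<^sub>\<phi>\<^sup>2\<close>, which is the derivative at \<open>P\<close> in the directions \<open>I, \<dots>, I\<close>.\<close>

lemma norm_deriv_op_le:
  assumes \<pi>: "is_partition m \<pi>" and km: "k \<le> m" and mn: "m \<le> n"
    and \<nu>: "\<And>i. i \<in> {1..n} \<Longrightarrow> 0 \<le> \<nu> i"
      "\<And>i j. i \<in> {1..n} \<Longrightarrow> j \<in> {1..n} \<Longrightarrow> i \<le> j \<Longrightarrow> \<nu> j \<le> \<nu> i"
    and f: "onb {1..n} f"
    and Y: "\<And>j. Y j \<in> clinear_ops" "\<And>j. j \<in> {1..k} \<Longrightarrow> norm (Y j) \<le> 1"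
      "\<And>a. a \<in> {1..n} \<Longrightarrow> blinfun_apply (Y 0) (e a) = complex_of_real (\<nu> a) *\<^sub>C f a"
    and x: "x \<in> symmetry_class m \<tau> \<pi>"
  shows "norm (deriv_op k Y x) \<le>
    fact k * elem_sym_fun m (m - k) (\<lambda>i. \<nu> (tableau_row \<pi> i)) * norm x"
proof -
  let ?p = "fact k * elem_sym_fun m (m - k) (\<lambda>i. \<nu> (tableau_row \<pi> i))"
  have p0: "0 \<le> ?p" using elem_sym_fun_rows_nonneg[where \<nu> = \<nu>, OF \<pi> mn \<nu>(1)] by simp
  define V where "V = op_of_basis {1..n} f e"
  define Q where "Q = op_of_basis {1..n} e (\<lambda>a. complex_of_real (sqrt (\<nu> a)) *\<^sub>C e a)"
  have orth_f: "orthonormal {1..n} f" using f by (simp add: onb_def)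
  have V: "V \<in> clinear_ops" "\<And>a. a \<in> {1..n} \<Longrightarrow> V (f a) = e a"
    using op_of_basis_on_basis[OF orth_f] by (simp_all add: V_def op_of_basis_clinear)
  have Q: "Q \<in> clinear_ops" "\<And>a. a \<in> {1..n} \<Longrightarrow> Q (e a) = complex_of_real (sqrt (\<nu> a)) *\<^sub>C e a"
    using op_of_basis_on_basis[OF orthonormal_e] by (simp_all add: Q_def op_of_basis_clinear)
  interpret F: based_tensor_power m n \<tau> f by unfold_locales (fact tensor, fact f)
  have normV: "norm (V y) = norm y" for y
    by (rule norm_preserving_if_onb_to_orthonormal[OF f orthonormal_e V])
  have "V o\<^sub>L Y 0 = Q o\<^sub>L Q"
  proof (rule clinear_ops_eqI_onb[OF onb_e])
    fix a assume a: "a \<in> {1..n}"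
    have "complex_of_real (sqrt (\<nu> a)) * complex_of_real (sqrt (\<nu> a)) = complex_of_real (\<nu> a)"
      using \<nu>(1)[OF a] by (simp flip: of_real_mult)
    thus "blinfun_apply (V o\<^sub>L Y 0) (e a) = blinfun_apply (Q o\<^sub>L Q) (e a)"
      using Y(3)[OF a] V(2)[OF a] Q(2)[OF a]
      by (simp add: clinear_opsD[OF V(1)] clinear_opsD[OF Q(1)] scaleC_scaleC)
  qed (intro clinear_ops_compose V Q Y)+
  note VY0 = this
  have VY0': "V (blinfun_apply (Y 0) z) = Q (Q z)" for z
    using arg_cong[OF VY0, of "\<lambda>B. blinfun_apply B z"] by simp
  define QB where "QB \<phi> = tensor_ops \<tau> (\<lambda>i. if \<phi> i = 0 then Q else id_blinfun)" for \<phi> :: "nat \<Rightarrow> nat"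
  define XA where "XA \<phi> = tensor_ops \<tau> (\<lambda>i. if \<phi> i = 0 then id_blinfun else V o\<^sub>L Y (\<phi> i))" for \<phi>
  let ?q = "\<lambda>\<phi> \<alpha>. \<Prod>i | i \<in> {1..m} \<and> \<phi> i = 0. sqrt (\<nu> (\<alpha> i))"
  have siteQ: "(if \<phi> i = 0 then Q else id_blinfun) \<in> clinear_ops" for \<phi> :: "nat \<Rightarrow> nat" and i
    using Q by (simp add: clinear_ops_id)
  have siteX: "(if \<phi> i = 0 then id_blinfun else V o\<^sub>L Y (\<phi> i)) \<in> clinear_ops" for \<phi> :: "nat \<Rightarrow> nat" and i
    using V Y by (simp add: clinear_ops_id clinear_ops_compose)
  have QB: "QB \<phi> \<in> clinear_ops" for \<phi> unfolding QB_def by (rule tensor_ops_props(1)[OF siteQ])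
  have QB_diag: "QB \<phi> (basis_tensor \<alpha>) = complex_of_real (?q \<phi> \<alpha>) *\<^sub>C basis_tensor \<alpha>"
    if \<alpha>: "\<alpha> \<in> multi_index" for \<phi> \<alpha>
  proof -
    have "QB \<phi> (basis_tensor \<alpha>) =
        (\<Prod>i\<in>{1..m}. if \<phi> i = 0 then complex_of_real (sqrt (\<nu> (\<alpha> i))) else 1) *\<^sub>C basis_tensor \<alpha>"
      unfolding QB_def basis_tensor_def[of \<alpha>, symmetric]
      by (subst tensor_ops_diagonal[OF siteQ \<alpha>,
            where q = "\<lambda>i a. if \<phi> i = 0 then complex_of_real (sqrt (\<nu> a)) else 1" and f = e])
        (auto simp: Q(2) scaleC_one basis_tensor_def)
    also have "(\<Prod>i\<in>{1..m}. if \<phi> i = 0 then complex_of_real (sqrt (\<nu> (\<alpha> i))) else 1) = complex_of_real (?q \<phi> \<alpha>)"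
      by (simp only: of_real_prod prod.inter_filter[OF finite_atLeastAtMost]
        if_distrib[of complex_of_real] of_real_1)
    finally show ?thesis .
  qed
  have QB_norm: "(norm (QB \<phi> z))\<^sup>2 = (\<Sum>\<alpha>\<in>multi_index.
      (\<Prod>i | i \<in> {1..m} \<and> \<phi> i = 0. \<nu> (\<alpha> i)) * (cmod (cinner z (basis_tensor \<alpha>)))\<^sup>2)" for \<phi> z
    unfolding onb_norm_sqr[OF onb_basis_tensor, of "QB \<phi> z"]
  proof (rule sum.cong[OF refl])
    fix \<alpha> assume \<alpha>: "\<alpha> \<in> multi_index"
    have "(?q \<phi> \<alpha>)\<^sup>2 = (\<Prod>i | i \<in> {1..m} \<and> \<phi> i = 0. \<nu> (\<alpha> i))"
      unfolding prod_power_distrib using \<nu>(1) multi_index_range[OF \<alpha>]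
      by (intro prod.cong refl) auto
    moreover have "cinner (QB \<phi> z) (basis_tensor \<alpha>) =
        complex_of_real (?q \<phi> \<alpha>) * cinner z (basis_tensor \<alpha>)"
      by (rule diagonal_op_coefficient[OF QB _ \<alpha>]) (rule QB_diag)
    ultimately show "(cmod (cinner (QB \<phi> z) (basis_tensor \<alpha>)))\<^sup>2 =
      (\<Prod>i | i \<in> {1..m} \<and> \<phi> i = 0. \<nu> (\<alpha> i)) * (cmod (cinner z (basis_tensor \<alpha>)))\<^sup>2"
      by (simp only: norm_mult norm_of_real power_mult_distrib power2_abs)
  qed
  have QB_sum: "L2_set (\<lambda>\<phi>. norm (QB \<phi> z)) (placements m k) \<le> sqrt ?p * norm z"
    if "z \<in> symmetry_class m \<tau> \<pi>" for z
  proof -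
    have "(\<Sum>\<phi>\<in>placements m k. (norm (QB \<phi> z))\<^sup>2) \<le> ?p * (norm z)\<^sup>2"
      unfolding QB_norm by (rule sum_weights_symmetry_class_le[OF \<pi> km \<nu> that])
    hence "L2_set (\<lambda>\<phi>. norm (QB \<phi> z)) (placements m k) \<le> sqrt (?p * (norm z)\<^sup>2)"
      unfolding L2_set_def by (rule real_sqrt_le_mono)
    thus ?thesis by (simp only: real_sqrt_mult real_sqrt_abs abs_norm_cancel)
  qed
  have site_factors: "tensor_ops \<tau> (\<lambda>_. V) o\<^sub>L tensor_ops \<tau> (\<lambda>i. Y (\<phi> i)) = QB \<phi> o\<^sub>L (XA \<phi> o\<^sub>L QB \<phi>)" for \<phi>
  proof -
    have XQ: "XA \<phi> o\<^sub>L QB \<phi> = tensor_ops \<tau> (\<lambda>i.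
      (if \<phi> i = 0 then id_blinfun else V o\<^sub>L Y (\<phi> i)) o\<^sub>L (if \<phi> i = 0 then Q else id_blinfun))"
      unfolding QB_def XA_def by (rule tensor_ops_compose) (rule siteX, rule siteQ)
    have "QB \<phi> o\<^sub>L (XA \<phi> o\<^sub>L QB \<phi>) = tensor_ops \<tau> (\<lambda>i. (if \<phi> i = 0 then Q else id_blinfun) o\<^sub>L
      ((if \<phi> i = 0 then id_blinfun else V o\<^sub>L Y (\<phi> i)) o\<^sub>L (if \<phi> i = 0 then Q else id_blinfun)))"
      unfolding XQ unfolding QB_def
      by (rule tensor_ops_compose) (rule siteQ, intro clinear_ops_compose siteX siteQ)
    also have "\<dots> = tensor_ops \<tau> (\<lambda>i. V o\<^sub>L Y (\<phi> i))"
      by (rule arg_cong[of _ _ "tensor_ops \<tau>"]) (intro ext blinfun_eqI, simp add: VY0')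
    also have "\<dots> = tensor_ops \<tau> (\<lambda>_. V) o\<^sub>L tensor_ops \<tau> (\<lambda>i. Y (\<phi> i))"
      by (rule tensor_ops_compose[symmetric]) (simp_all add: V Y)
    finally show ?thesis ..
  qed
  define y where "y = blinfun_apply (tensor_ops \<tau> (\<lambda>_. V)) (deriv_op k Y x)"
  have norm_y: "norm y = norm (deriv_op k Y x)"
    unfolding y_def by (rule F.tensor_ops_isometry[OF onb_e V])
  have yS: "y \<in> symmetry_class m \<tau> \<pi>"
    unfolding y_def by (intro tensor_ops_symmetry_class V deriv_op_symmetry_class Y x)
  have y_sum: "y = (\<Sum>\<phi>\<in>placements m k. QB \<phi> (XA \<phi> (QB \<phi> x)))"
    unfolding y_def deriv_op_def blinfun.sum_left blinfun.sum_right
  proof (rule sum.cong[OF refl])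
    fix \<phi>
    show "blinfun_apply (tensor_ops \<tau> (\<lambda>_. V)) (blinfun_apply (tensor_ops \<tau> (\<lambda>i. Y (\<phi> i))) x) =
      QB \<phi> (XA \<phi> (QB \<phi> x))"
      using arg_cong[OF site_factors[of \<phi>], of "\<lambda>B. blinfun_apply B x"] by simp
  qed
  have "(norm y)\<^sup>2 = cmod (cinner y y)" by (simp add: cinner_self norm_power)
  also have "cinner y y = (\<Sum>\<phi>\<in>placements m k.
      cinner (QB \<phi> (XA \<phi> (QB \<phi> x))) y)"
    by (subst (1) y_sum) (rule cinner_sum_left)
  also have "cmod \<dots> \<le> (\<Sum>\<phi>\<in>placements m k. norm (QB \<phi> x) * norm (QB \<phi> y))"
  proof (rule order_trans[OF norm_sum], rule sum_mono)
    fix \<phi> assume \<phi>: "\<phi> \<in> placements m k"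
    have contr: "norm (XA \<phi> z) \<le> norm z" for z
      unfolding XA_def
    proof (rule norm_tensor_ops_contraction[OF siteX])
      fix i assume "i \<in> {1..m}"
      hence "\<phi> i \<in> {0..k}" using \<phi> by (auto simp: placements_def dest: PiE_mem)
      hence Yi: "norm (Y (\<phi> i)) \<le> 1" if "\<phi> i \<noteq> 0" using Y(2)[of "\<phi> i"] that by simp
      have "norm (V o\<^sub>L Y (\<phi> i)) \<le> 1" if "\<phi> i \<noteq> 0"
      proof (rule norm_blinfun_bound)
        fix z
        show "norm (blinfun_apply (V o\<^sub>L Y (\<phi> i)) z) \<le> 1 * norm z"
          using norm_blinfun[of "Y (\<phi> i)" z] mult_right_mono[OF Yi[OF that], of "norm z"] by (simp add: normV)
      qed simp
      moreover have "norm (id_blinfun :: 'v \<Rightarrow>\<^sub>L 'v) \<le> 1" by (rule norm_blinfun_id_le)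
      ultimately show "norm (if \<phi> i = 0 then id_blinfun else V o\<^sub>L Y (\<phi> i)) \<le> 1" by simp
    qed
    have "cmod (cinner (QB \<phi> (XA \<phi> (QB \<phi> x))) y) =
        cmod (cinner (XA \<phi> (QB \<phi> x)) (QB \<phi> y))"
      by (simp only: diagonal_op_selfadjoint[where D = "QB \<phi>" and d = "?q \<phi>", OF QB QB_diag])
    also have "\<dots> \<le> norm (XA \<phi> (QB \<phi> x)) * norm (QB \<phi> y)"
      by (rule cinner_Cauchy_Schwarz)
    also have "\<dots> \<le> norm (QB \<phi> x) * norm (QB \<phi> y)"
      by (intro mult_right_mono contr) simp
    finally show "cmod (cinner (QB \<phi> (XA \<phi> (QB \<phi> x))) y) \<le>
      norm (QB \<phi> x) * norm (QB \<phi> y)" .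
  qed
  also have "\<dots> \<le> L2_set (\<lambda>\<phi>. norm (QB \<phi> x)) (placements m k) *
      L2_set (\<lambda>\<phi>. norm (QB \<phi> y)) (placements m k)"
    using L2_set_mult_ineq[of "\<lambda>\<phi>. norm (QB \<phi> x)" "\<lambda>\<phi>. norm (QB \<phi> y)"] by simp
  also have "\<dots> \<le> (sqrt ?p * norm x) * (sqrt ?p * norm y)"
    by (intro mult_mono' QB_sum x yS) simp_all
  also have "\<dots> = (sqrt ?p * sqrt ?p) * norm x * norm y" by (simp only: mult_ac)
  also have "sqrt ?p * sqrt ?p = ?p" using p0 by simp
  finally have "norm y * norm y \<le> (?p * norm x) * norm y" by (simp only: power2_eq_square)
  moreover have "0 \<le> ?p * norm x" using p0 by simp
  ultimately have "norm y \<le> ?p * norm x"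
    by (metis mult_le_cancel_right norm_ge_zero not_le order_trans less_le)
  thus ?thesis by (simp only: norm_y)
qed

text \<open>The bound is attained in the directions \<open>U, \<dots>, U\<close> with the isometry \<open>U\<close> that sends \<open>e a\<close> to
  \<open>f a\<close>: on \<open>basis_tensor \<alpha>\<close> the derivative is then \<open>k! p(\<nu>\<^sub>\<alpha>)\<close> times \<open>U \<otimes> \<dots> \<otimes> U\<close>, and the
  number \<open>p(\<nu>\<^sub>\<alpha>)\<close> does not change when \<open>\<alpha>\<close> is permuted.\<close>

lemma norm_deriv_op_attained:
  assumes \<pi>: "is_partition m \<pi>" and km: "k \<le> m" and mn: "m \<le> n"
    and f: "onb {1..n} f"
    and Y: "\<And>j. Y j \<in> clinear_ops" "\<And>j a. j \<in> {1..k} \<Longrightarrow> a \<in> {1..n} \<Longrightarrow> blinfun_apply (Y j) (e a) = f a"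
      "\<And>a. a \<in> {1..n} \<Longrightarrow> blinfun_apply (Y 0) (e a) = complex_of_real (\<nu> a) *\<^sub>C f a"
    and x: "x = symmetrizer m \<tau> \<pi> (basis_tensor (row_index \<pi>))"
  shows "norm (deriv_op k Y x) =
    \<bar>fact k * elem_sym_fun m (m - k) (\<lambda>i. \<nu> (tableau_row \<pi> i))\<bar> * norm x"
proof -
  let ?p = "fact k * elem_sym_fun m (m - k) (\<lambda>i. \<nu> (tableau_row \<pi> i))"
  interpret F: based_tensor_power m n \<tau> f by unfold_locales (fact tensor, fact f)
  have w: "row_index \<pi> \<in> multi_index" by (rule row_index_multi_index[OF \<pi> mn])
  have on_basis: "deriv_op k Y (basis_tensor \<alpha>) =
      complex_of_real (fact k * elem_sym_fun m (m - k) (\<lambda>i. \<nu> (\<alpha> i))) *\<^sub>C F.basis_tensor \<alpha>"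
    if \<alpha>: "\<alpha> \<in> multi_index" for \<alpha>
  proof -
    have "blinfun_apply (tensor_ops \<tau> (\<lambda>i. Y (\<phi> i))) (basis_tensor \<alpha>) =
       complex_of_real (\<Prod>i | i \<in> {1..m} \<and> \<phi> i = 0. \<nu> (\<alpha> i)) *\<^sub>C F.basis_tensor \<alpha>"
      if \<phi>: "\<phi> \<in> placements m k" for \<phi>
    proof -
      have "blinfun_apply (tensor_ops \<tau> (\<lambda>i. Y (\<phi> i))) (basis_tensor \<alpha>) =
        (\<Prod>i\<in>{1..m}. if \<phi> i = 0 then complex_of_real (\<nu> (\<alpha> i)) else 1) *\<^sub>C \<tau> (\<lambda>i. f (\<alpha> i))"
      proof (rule tensor_ops_diagonal[OF Y(1) \<alpha>,
            where q = "\<lambda>i a. if \<phi> i = 0 then complex_of_real (\<nu> a) else 1"])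
        fix i a assume i: "i \<in> {1..m}" and a: "a \<in> {1..n}"
        have "\<phi> i \<in> {0..k}" using \<phi> i by (auto simp: placements_def dest: PiE_mem)
        thus "blinfun_apply (Y (\<phi> i)) (e a) = (if \<phi> i = 0 then complex_of_real (\<nu> a) else 1) *\<^sub>C f a"
          using Y(2)[of "\<phi> i" a] Y(3)[OF a] a by (cases "\<phi> i = 0") (auto simp: scaleC_one)
      qed
      thus ?thesis by (simp only: of_real_prod prod.inter_filter[OF finite_atLeastAtMost]
        if_distrib[of complex_of_real] of_real_1 F.basis_tensor_def)
    qed
    hence "deriv_op k Y (basis_tensor \<alpha>) =
      complex_of_real (\<Sum>\<phi>\<in>placements m k. \<Prod>i | i \<in> {1..m} \<and> \<phi> i = 0. \<nu> (\<alpha> i)) *\<^sub>C F.basis_tensor \<alpha>"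
      unfolding deriv_op_def blinfun.sum_left of_real_sum complex_space.scale_sum_left
      by (intro sum.cong refl)
    thus ?thesis by (simp only: sum_placements[OF km])
  qed
  have same: "cinner x (basis_tensor \<alpha>) *\<^sub>C deriv_op k Y (basis_tensor \<alpha>) =
      (complex_of_real ?p * cinner x (basis_tensor \<alpha>)) *\<^sub>C F.basis_tensor \<alpha>" if \<alpha>: "\<alpha> \<in> multi_index" for \<alpha>
  proof (cases "cinner x (basis_tensor \<alpha>) = 0")
    case False
    then obtain \<sigma> where \<sigma>: "\<sigma> permutes {1..m}" "\<alpha> = row_index \<pi> \<circ> inv \<sigma>"
      using cinner_symmetrizer_basis_tensor_nonzero[OF w \<alpha>] x by blast
    have "elem_sym_fun m (m - k) (\<lambda>i. \<nu> (\<alpha> i)) = elem_sym_fun m (m - k) (\<lambda>i. \<nu> (row_index \<pi> i))"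
      using elem_sym_fun_permute[OF permutes_inv[OF \<sigma>(1)], of "m - k" "\<lambda>i. \<nu> (row_index \<pi> i)"]
      by (simp add: \<sigma>(2))
    also have "\<dots> = elem_sym_fun m (m - k) (\<lambda>i. \<nu> (tableau_row \<pi> i))"
      by (rule elem_sym_fun_cong) (simp add: row_index_def)
    finally show ?thesis by (simp only: on_basis[OF \<alpha>] scaleC_scaleC mult.commute)
  qed simp
  have "deriv_op k Y x =
      deriv_op k Y (\<Sum>\<alpha>\<in>multi_index. cinner x (basis_tensor \<alpha>) *\<^sub>C basis_tensor \<alpha>)"
    using onb_expansion[OF onb_basis_tensor, of x] by simp
  also have "\<dots> = (\<Sum>\<alpha>\<in>multi_index. (complex_of_real ?p * cinner x (basis_tensor \<alpha>)) *\<^sub>C F.basis_tensor \<alpha>)"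
    unfolding blinfun.sum_right
    by (intro sum.cong refl) (simp only: clinear_opsD[OF deriv_op_clinear[OF Y(1)]] same)
  finally have "(norm (deriv_op k Y x))\<^sup>2 =
      (\<Sum>\<alpha>\<in>multi_index. (cmod (complex_of_real ?p * cinner x (basis_tensor \<alpha>)))\<^sup>2)"
    by (simp only: orthonormal_norm_sqr_sum[OF F.orthonormal_basis_tensor finite_multi_index])
  also have "\<dots> = ?p\<^sup>2 * (norm x)\<^sup>2"
    by (simp only: onb_norm_sqr[OF onb_basis_tensor, of x] sum_distrib_left norm_mult norm_of_real
        power_mult_distrib power2_abs)
  finally have "(norm (deriv_op k Y x))\<^sup>2 = (\<bar>?p\<bar> * norm x)\<^sup>2"
    by (simp only: power_mult_distrib power2_abs)
  thus ?thesis by (simp only: power2_eq_iff_nonneg norm_ge_zero mult_nonneg_nonneg abs_ge_zero)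
qed

text \<open>\<open>P\<close> is the orthogonal projection onto the symmetry class.\<close>

lemma higher_deriv_induced_op:
  assumes Y: "\<And>j. Y j \<in> clinear_ops"
  shows "\<exists>P. higher_deriv k (induced_op m \<tau> \<pi>) (Y 0) Y = deriv_op k Y o\<^sub>L P \<and>
    (\<forall>x. norm (P x) \<le> norm x) \<and> (\<forall>x. P x \<in> symmetry_class m \<tau> \<pi>) \<and>
    (\<forall>x\<in>symmetry_class m \<tau> \<pi>. P x = x)"
proof -
  let ?S = "symmetry_class m \<tau> \<pi>"
  obtain b :: "nat \<Rightarrow> 'w" where b: "orthonormal {..<cdim ?S} b" "b ` {..<cdim ?S} \<subseteq> ?S"
    using orthonormal_extend[OF symmetry_class_subspace[of \<pi>], of "{..<cdim ?S}" "{}"]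
    by (auto simp: orthonormal_def)
  have span: "cspan (b ` {..<cdim ?S}) = ?S"
    using onb_basis_tensor
    by (intro orthonormal_spans_subspace[OF symmetry_class_subspace _ _ b, of "basis_tensor ` multi_index"])
      (auto simp: onb_def)
  let ?P = "op_of_basis {..<cdim ?S} b b"
  have "induced_op m \<tau> \<pi> = (\<lambda>A. tensor_op \<tau> A o\<^sub>L ?P)"
    unfolding induced_op_def using restriction_op_eq_compose_projection[OF b(1) _ span] by auto
  hence "higher_deriv k (induced_op m \<tau> \<pi>) (Y 0) Y = deriv_op k Y o\<^sub>L ?P"
    by (simp add: higher_deriv_tensor_op[of Y, OF Y] deriv_op_def)
  moreover have "norm (blinfun_apply ?P x) \<le> norm x" "blinfun_apply ?P x \<in> ?S" for x
    using norm_orthonormal_projection_le[OF b(1)] orthonormal_projection_in_span[of "{..<cdim ?S}" b] span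
    by auto
  moreover have "blinfun_apply ?P x = x" if "x \<in> ?S" for x
    using orthonormal_projection_fixes[OF b(1)] that span by simp
  ultimately show ?thesis by blast
qed

end

theorem theorem4p1:
  fixes T :: "'v::complex_inner_space \<Rightarrow>\<^sub>L 'v"
    and \<tau> :: "(nat \<Rightarrow> 'v) \<Rightarrow> 'w::complex_inner_space"
    and n m k :: nat
    and \<pi> :: "nat list"
    and \<nu> :: "nat \<Rightarrow> real"
  assumes "cdim (UNIV :: 'v set) = n"
    and "1 \<le> k" and "k \<le> m" and "m \<le> n"
    and "is_tensor_power m \<tau>"
    and "is_partition m \<pi>"
    and "T \<in> clinear_ops"
    and "singular_values n T \<nu>"
  shows "multilinear_norm k (higher_deriv k (induced_op m \<tau> \<pi>) T)
           = fact k * elem_sym (m - k) (map \<nu> (omega \<pi>))"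
proof -
  let ?p = "fact k * elem_sym_fun m (m - k) (\<lambda>i. \<nu> (tableau_row \<pi> i))"
  let ?\<Phi> = "higher_deriv k (induced_op m \<tau> \<pi>) T"
  \<comment> \<open>The base point gets the label \<open>0\<close>.  Labels beyond \<open>k\<close> do not occur; the value \<open>T\<close> there keeps
    all members of the family complex linear.\<close>
  let ?Y = "\<lambda>X j. if j \<in> {1..k} then X j else T"
  have n: "1 \<le> n" using assms by simp
  obtain e f where e: "onb {1..n} e" and f: "onb {1..n} f"
    and Te: "\<And>i. i \<in> {1..n} \<Longrightarrow> T (e i) = complex_of_real (\<nu> i) *\<^sub>C f i"
    using singular_value_decomposition[OF assms(1) n assms(7,8)] by blast
  interpret based_tensor_power m n \<tau> e by unfold_locales (fact assms(5), fact e)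
  have \<nu>: "\<And>i. i \<in> {1..n} \<Longrightarrow> 0 \<le> \<nu> i"
      "\<And>i j. i \<in> {1..n} \<Longrightarrow> j \<in> {1..n} \<Longrightarrow> i \<le> j \<Longrightarrow> \<nu> j \<le> \<nu> i"
    using assms(8) by (auto simp: singular_values_def)
  have p0: "0 \<le> ?p"
    using elem_sym_fun_rows_nonneg[where \<nu> = \<nu>, OF assms(6,4) \<nu>(1)] by simp
  have Y: "?Y X j \<in> clinear_ops" if "\<forall>j\<in>{1..k}. X j \<in> clinear_ops" for X j
    using that assms(7) by simp
  have \<Phi>: "?\<Phi> X = higher_deriv k (induced_op m \<tau> \<pi>) (?Y X 0) (?Y X)" for X
  proof -
    have "(\<Sum>j\<in>{1..k}. t j *\<^sub>R X j) = (\<Sum>j\<in>{1..k}. t j *\<^sub>R ?Y X j)" for t by (rule sum.cong) auto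
    thus ?thesis unfolding higher_deriv_def by simp
  qed
  have upper: "norm (?\<Phi> X) \<le> ?p" if X: "\<forall>j\<in>{1..k}. X j \<in> clinear_ops \<and> norm (X j) = 1" for X
  proof -
    have XY: "?Y X j \<in> clinear_ops" for j by (rule Y) (use X in blast)
    obtain P where P: "?\<Phi> X = deriv_op k (?Y X) o\<^sub>L P"
      "\<And>x. norm (P x) \<le> norm x" "\<And>x. P x \<in> symmetry_class m \<tau> \<pi>"
      using higher_deriv_induced_op[of "?Y X" k \<pi>, OF XY] unfolding \<Phi> by blast
    show ?thesis unfolding P(1)
    proof (rule norm_blinfun_bound[OF p0])
      fix x
      have "norm (blinfun_apply (deriv_op k (?Y X)) (P x)) \<le> ?p * norm (P x)"
        using X Te by (intro norm_deriv_op_le[OF assms(6,3,4) \<nu> f XY _ _ P(3)]) auto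
      also have "\<dots> \<le> ?p * norm x" by (intro mult_left_mono P(2) p0)
      finally show "norm (blinfun_apply (deriv_op k (?Y X) o\<^sub>L P) x) \<le> ?p * norm x" by simp
    qed
  qed
  define U where "U = op_of_basis {1..n} e f"
  have orth_f: "orthonormal {1..n} f" using f by (simp add: onb_def)
  have U: "U \<in> clinear_ops" "\<And>a. a \<in> {1..n} \<Longrightarrow> U (e a) = f a"
    using op_of_basis_on_basis[OF orthonormal_e] by (simp_all add: U_def op_of_basis_clinear)
  have normU: "norm (U y) = norm y" for y
    by (rule norm_preserving_if_onb_to_orthonormal[OF e orth_f U])
  have "norm U = 1"
  proof (rule antisym)
    show "norm U \<le> 1" by (rule norm_blinfun_bound) (simp_all add: normU)
    have "cinner (e 1) (e 1) = 1" using orthonormalD[OF orthonormal_e, of 1 1] n by simp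
    hence "(norm (e 1))\<^sup>2 = 1\<^sup>2" using norm_sqr_eq_cinner[of "e 1"] by simp
    hence "norm (e 1) = 1" by (rule power2_eq_imp_eq) simp_all
    thus "1 \<le> norm U" using norm_blinfun[of U "e 1"] by (simp add: normU)
  qed
  hence U_adm: "\<forall>j\<in>{1..k}. (\<lambda>_. U) j \<in> clinear_ops \<and> norm ((\<lambda>_. U) j) = 1" using U by simp
  have attained: "norm (?\<Phi> (\<lambda>_. U)) = ?p"
  proof (rule antisym)
    show "norm (?\<Phi> (\<lambda>_. U)) \<le> ?p" by (rule upper[OF U_adm])
    let ?x = "symmetrizer m \<tau> \<pi> (basis_tensor (row_index \<pi>))"
    have YU: "?Y (\<lambda>_. U) j \<in> clinear_ops" for j by (rule Y) (use U in blast)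
    obtain P where P: "?\<Phi> (\<lambda>_. U) = deriv_op k (?Y (\<lambda>_. U)) o\<^sub>L P"
      "\<And>x. x \<in> symmetry_class m \<tau> \<pi> \<Longrightarrow> P x = x"
      using higher_deriv_induced_op[of "?Y (\<lambda>_. U)" k \<pi>, OF YU] unfolding \<Phi> by blast
    have "norm (blinfun_apply (deriv_op k (?Y (\<lambda>_. U))) ?x) = \<bar>?p\<bar> * norm ?x"
      using U Te by (intro norm_deriv_op_attained[OF assms(6,3,4) f YU _ _ refl]) auto
    hence "?p * norm ?x = norm (blinfun_apply (?\<Phi> (\<lambda>_. U)) ?x)"
      using P(2)[of ?x] p0 unfolding P(1) by (simp add: symmetry_class_def)
    also have "\<dots> \<le> norm (?\<Phi> (\<lambda>_. U)) * norm ?x" by (rule norm_blinfun)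
    finally show "?p \<le> norm (?\<Phi> (\<lambda>_. U))"
      using symmetrizer_row_index_nonzero[OF assms(6,4)] by simp
  qed
  have "multilinear_norm k ?\<Phi> = ?p"
    unfolding multilinear_norm_def
  proof (rule cSup_eq_maximum)
    show "?p \<in> {norm (?\<Phi> X) |X. \<forall>j\<in>{1..k}. X j \<in> clinear_ops \<and> norm (X j) = 1}"
      using attained U_adm by (intro CollectI exI[of _ "\<lambda>_. U"]) simp
  qed (use upper in blast)
  moreover have "elem_sym (m - k) (map \<nu> (omega \<pi>)) = elem_sym_fun m (m - k) (\<lambda>i. \<nu> (tableau_row \<pi> i))"
  proof -
    have len: "length (omega \<pi>) = m" using assms(6) by (simp add: length_omega is_partition_def)
    hence "elem_sym (m - k) (map \<nu> (omega \<pi>)) = elem_sym_fun m (m - k) (\<lambda>i. map \<nu> (omega \<pi>) ! (i - 1))"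
      by (intro elem_sym_eq_elem_sym_fun) simp
    also have "\<dots> = elem_sym_fun m (m - k) (\<lambda>i. \<nu> (tableau_row \<pi> i))"
      using len by (intro elem_sym_fun_cong) (auto simp: tableau_row_def)
    finally show ?thesis .
  qed
  ultimately show ?thesis by simp
qed

end
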